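(* For any $p \in [1,\infty)$ and any constant $\alpha > 1/2^{1/p}$, there exists a randomized polynomial-time algorithm that, given any sufficiently large positive integer $r$ in unary as input, outputs a $(p,\alpha,r,R)$-locally dense lattice with $R = \mathrm{poly}(r)$ with probability at least $2/3$. Moreover, the algorithm's output satisfies condition (i) of the definition of a locally dense lattice (namely $\lambda_1^{(p)}(\mathcal{L}(A)) \geq \ell^{1/p}$) with probability $1$.
   Context: For $p \in [1,\infty)$, real $\alpha>0$ and positive integers $r,R$, a $(p,\alpha,r,R)$-locally dense lattice consists of a basis matrix $A \in \mathbb{Z}^{n \times R}$ (linearly independent columns) of an integer lattice $\mathcal{L}(A)$ of rank $R$ (in some dimension $n$), a positive integer $\ell$, a shift $\vec x \in \mathbb{Z}^n$, and a matrix $T \in \mathbb{Z}^{r \times n}$ such that: (i) $\lambda_1^{(p)}(\mathcal{L}(A)) \geq \ell^{1/p}$, where $\lambda_1^{(p)}(\mathcal{L}) := \min_{\vec v \in \mathcal{L}\setminus\{\vec 0\}}\|\vec v\|_p$; and (ii) $\{0,1\}^r \subseteq \{T\vec v : \vec v \in V\}$, where $V := (\vec x + \mathcal{L}(A)) \cap \{\vec y \in \mathbb{R}^n : \|\vec y\|_p \leq \alpha\cdot \ell^{1/p}\}$. Arithmetic with $T$ is over the integers. *)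

theory Defs
  imports
    "HOL-Probability.Probability_Mass_Function"
    "HOL-Library.Log_Nat"
    "HOL-Computational_Algebra.Polynomial"
    "Jordan_Normal_Form.Matrix"
begin

unbundle no vec_syntax

section \<open>Locally dense lattices\<close>

definition lp_norm :: "real \<Rightarrow> real vec \<Rightarrow> real" where
  "lp_norm p v = (\<Sum>i<dim_vec v. \<bar>v $ i\<bar> powr p) powr (1 / p)"

definition independent_cols :: "real mat \<Rightarrow> bool" where
  "independent_cols A \<longleftrightarrow>
     (\<forall>z \<in> carrier_vec (dim_col A). A *\<^sub>v z = 0\<^sub>v (dim_row A) \<longrightarrow> z = 0\<^sub>v (dim_col A))"

definition lattice_gen :: "int mat \<Rightarrow> int vec set" where
  "lattice_gen A = (\<lambda>z. A *\<^sub>v z) ` carrier_vec (dim_col A)"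

text \<open>For a non-zero integer lattice the infimum is attained, see \<open>lambda1_is_minimum\<close> below.\<close>

definition lambda1 :: "real \<Rightarrow> int vec set \<Rightarrow> real" where
  "lambda1 p L = Inf {lp_norm p (map_vec real_of_int v) | v. v \<in> L \<and> v \<noteq> 0\<^sub>v (dim_vec v)}"

text \<open>The shapes of the four components; the ambient dimension \<open>n\<close> is \<open>dim_row A\<close>.\<close>

definition ld_shape :: "nat \<Rightarrow> nat \<Rightarrow> int mat \<Rightarrow> nat \<Rightarrow> int vec \<Rightarrow> int mat \<Rightarrow> bool" where
  "ld_shape r R A l x T \<longleftrightarrow>
     0 < r \<and> 0 < R \<and>
     dim_col A = R \<and> independent_cols (map_mat real_of_int A) \<and>
     0 < l \<and>
     x \<in> carrier_vec (dim_row A) \<and>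
     T \<in> carrier_mat r (dim_row A)"

definition ld_min_dist :: "real \<Rightarrow> int mat \<Rightarrow> nat \<Rightarrow> bool" where
  "ld_min_dist p A l \<longleftrightarrow> lambda1 p (lattice_gen A) \<ge> real l powr (1 / p)"

definition short_coset_vectors :: "real \<Rightarrow> real \<Rightarrow> int mat \<Rightarrow> nat \<Rightarrow> int vec \<Rightarrow> int vec set" where
  "short_coset_vectors p \<alpha> A l x =
     {x + u | u. u \<in> lattice_gen A} \<inter> {y. lp_norm p (map_vec real_of_int y) \<le> \<alpha> * real l powr (1 / p)}"

definition ld_dense ::
    "real \<Rightarrow> real \<Rightarrow> nat \<Rightarrow> int mat \<Rightarrow> nat \<Rightarrow> int vec \<Rightarrow> int mat \<Rightarrow> bool" where
  "ld_dense p \<alpha> r A l x T \<longleftrightarrow>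
     {w \<in> carrier_vec r. \<forall>i<r. w $ i \<in> {0, 1}}
       \<subseteq> (\<lambda>v. T *\<^sub>v v) ` short_coset_vectors p \<alpha> A l x"

definition locally_dense_lattice ::
    "real \<Rightarrow> real \<Rightarrow> nat \<Rightarrow> nat \<Rightarrow> int mat \<Rightarrow> nat \<Rightarrow> int vec \<Rightarrow> int mat \<Rightarrow> bool" where
  "locally_dense_lattice p \<alpha> r R A l x T \<longleftrightarrow>
     ld_shape r R A l x T \<and> ld_min_dist p A l \<and> ld_dense p \<alpha> r A l x T"

lemma lambda1_is_minimum:
  assumes "p > 0" "L \<subseteq> carrier_vec n" "v0 \<in> L" "v0 \<noteq> 0\<^sub>v n"
  shows "\<exists>v \<in> L. v \<noteq> 0\<^sub>v n \<and> lp_norm p (map_vec real_of_int v) = lambda1 p L \<and>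
     (\<forall>w \<in> L. w \<noteq> 0\<^sub>v n \<longrightarrow> lp_norm p (map_vec real_of_int v) \<le> lp_norm p (map_vec real_of_int w))"
proof -
  let ?N = "\<lambda>v. lp_norm p (map_vec real_of_int v)"
  define S where "S = {v \<in> L. v \<noteq> 0\<^sub>v n \<and> ?N v \<le> ?N v0}"
  define B where "B = \<lceil>?N v0\<rceil>"
  have "S \<subseteq> vec_of_list ` {xs. set xs \<subseteq> {-B..B} \<and> length xs = n}"
  proof
    fix v assume v: "v \<in> S"
    then have dv: "dim_vec v = n" using assms(2) by (auto simp: S_def)
    have bd: "v $ i \<in> {-B..B}" if i: "i < n" for i
    proof -
      have "\<bar>real_of_int (v $ i)\<bar> powr p \<le> (\<Sum>j<n. \<bar>real_of_int (v $ j)\<bar> powr p)"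
        using i by (intro member_le_sum) auto
      then have "(\<bar>real_of_int (v $ i)\<bar> powr p) powr (1/p)
          \<le> (\<Sum>j<n. \<bar>real_of_int (v $ j)\<bar> powr p) powr (1/p)"
        using assms(1) by (intro powr_mono2) auto
      moreover have "(\<Sum>j<n. \<bar>real_of_int (v $ j)\<bar> powr p) powr (1/p) = ?N v"
        using dv by (simp add: lp_norm_def)
      ultimately have "\<bar>real_of_int (v $ i)\<bar> \<le> ?N v"
        using assms(1) by (simp add: powr_powr)
      also have "?N v \<le> ?N v0" using v by (simp add: S_def)
      also have "\<dots> \<le> of_int B" by (simp add: B_def)
      finally show ?thesis by simp linarith
    qed
    have "v = vec_of_list (list_of_vec v)" by (simp add: vec_list)
    moreover have "set (list_of_vec v) \<subseteq> {-B..B}"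
      using bd dv by (auto simp: in_set_conv_nth list_of_vec_index)
    ultimately show "v \<in> vec_of_list ` {xs. set xs \<subseteq> {-B..B} \<and> length xs = n}"
      using dv by (intro image_eqI[where x = "list_of_vec v"]) auto
  qed
  then have "finite S"
    using finite_lists_length_eq[of "{-B..B}" n] by (meson finite_atLeastAtMost_int finite_imageI finite_subset)
  moreover have "v0 \<in> S" using assms by (auto simp: S_def)
  ultimately obtain v where v: "v \<in> S" "\<And>w. w \<in> S \<Longrightarrow> ?N v \<le> ?N w"
    using arg_min_if_finite(1)[of S ?N] arg_min_least[of S _ ?N] by (metis empty_iff)
  have min: "?N v \<le> ?N w" if "w \<in> L" "w \<noteq> 0\<^sub>v n" for w
    using v that by (cases "?N w \<le> ?N v0") (auto simp: S_def)
  have dim: "dim_vec w = n" if "w \<in> L" for w using that assms(2) by auto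
  have "lambda1 p L = ?N v"
    unfolding lambda1_def
    by (rule cInf_eq_minimum) (use v(1) min dim in \<open>auto simp: S_def\<close>)
  then show ?thesis using v(1) min by (auto simp: S_def)
qed

section \<open>Coin-tossing random access machines with logarithmic cost\<close>

text \<open>
  The machine has integer registers addressed by natural numbers (all initially 0), a read-only
  one-way input tape and a write-only one-way output tape. Indirect addressing is \<open>Load\<close> applied to
  a non-constant address. Every integer that is computed, fetched, read or written is charged its
  bit length, so polynomial cost means polynomial time on a (probabilistic) Turing machine.
\<close>

datatype binop = Add | Sub | Mul | Div | Mod | Less

datatype expr = Const int | Load expr | Op binop expr expr

datatype prog =
    Skip
  | Store expr expr
  | Read expr
  | Write expr
  | Toss expr
  | Seq prog prog
  | IfPos expr prog prog
  | WhilePos expr prog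

record ram =
  mem :: "nat \<Rightarrow> int"
  inp :: "int list"
  out :: "int list"
  cost :: nat

definition bits :: "int \<Rightarrow> nat" where
  "bits k = 1 + floorlog 2 (nat \<bar>k\<bar>)"

fun binop_val :: "binop \<Rightarrow> int \<Rightarrow> int \<Rightarrow> int" where
  "binop_val Add a b = a + b"
| "binop_val Sub a b = a - b"
| "binop_val Mul a b = a * b"
| "binop_val Div a b = a div b"
| "binop_val Mod a b = a mod b"
| "binop_val Less a b = (if a < b then 1 else 0)"

text \<open>A negative address denotes register 0, because \<open>nat k = 0\<close> for \<open>k \<le> 0\<close>.\<close>

fun expr_val :: "expr \<Rightarrow> (nat \<Rightarrow> int) \<Rightarrow> int" where
  "expr_val (Const k) m = k"
| "expr_val (Load e) m = m (nat (expr_val e m))"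
| "expr_val (Op f a b) m = binop_val f (expr_val a m) (expr_val b m)"

fun expr_cost :: "expr \<Rightarrow> (nat \<Rightarrow> int) \<Rightarrow> nat" where
  "expr_cost (Const k) m = bits k"
| "expr_cost (Load e) m = expr_cost e m + bits (expr_val (Load e) m)"
| "expr_cost (Op f a b) m = expr_cost a m + expr_cost b m + bits (expr_val (Op f a b) m)"

definition value_of :: "expr \<Rightarrow> ram \<Rightarrow> int" where
  "value_of e s = expr_val e (mem s)"

definition charge :: "expr \<Rightarrow> ram \<Rightarrow> ram" where
  "charge e s = s\<lparr>cost := cost s + 1 + expr_cost e (mem s)\<rparr>"

definition set_reg :: "int \<Rightarrow> int \<Rightarrow> ram \<Rightarrow> ram" where
  "set_reg a k s = s\<lparr>mem := (mem s)(nat a := k), cost := cost s + bits k\<rparr>"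

definition read_head :: "ram \<Rightarrow> int" where
  "read_head s = (case inp s of [] \<Rightarrow> 0 | k # _ \<Rightarrow> k)"

text \<open>
  \<open>exec c s \<mu>\<close>: started in \<open>s\<close>, program \<open>c\<close> halts for every sequence of coin tosses, and \<open>\<mu>\<close> is the
  distribution of the final machine state (including the accumulated cost) over independent fair
  coin tosses.
\<close>

inductive exec :: "prog \<Rightarrow> ram \<Rightarrow> ram pmf \<Rightarrow> bool" where
  Skip: "exec Skip s (return_pmf s)"
| Store: "exec (Store a e) s
     (return_pmf (set_reg (value_of a s) (value_of e s) (charge a (charge e s))))"
| Read: "exec (Read a) s
     (return_pmf (set_reg (value_of a s) (read_head s) (charge a (s\<lparr>inp := tl (inp s)\<rparr>))))"
| Write: "exec (Write e) s (return_pmf ((charge e s)\<lparr>out := out s @ [value_of e s]\<rparr>))"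
| Toss: "exec (Toss a) s
     (map_pmf (\<lambda>b. set_reg (value_of a s) (if b then 1 else 0) (charge a s)) (bernoulli_pmf (1/2)))"
| Seq: "exec c s \<mu> \<Longrightarrow> (\<And>t. t \<in> set_pmf \<mu> \<Longrightarrow> exec d t (\<nu> t)) \<Longrightarrow>
     exec (Seq c d) s (bind_pmf \<mu> \<nu>)"
| IfTrue: "value_of e s > 0 \<Longrightarrow> exec c (charge e s) \<mu> \<Longrightarrow> exec (IfPos e c d) s \<mu>"
| IfFalse: "value_of e s \<le> 0 \<Longrightarrow> exec d (charge e s) \<mu> \<Longrightarrow> exec (IfPos e c d) s \<mu>"
| WhileTrue: "value_of e s > 0 \<Longrightarrow> exec (Seq c (WhilePos e c)) (charge e s) \<mu> \<Longrightarrow>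
     exec (WhilePos e c) s \<mu>"
| WhileFalse: "value_of e s \<le> 0 \<Longrightarrow> exec (WhilePos e c) s (return_pmf (charge e s))"

inductive_cases SkipE: "exec Skip s \<mu>"
inductive_cases StoreE: "exec (Store a e) s \<mu>"
inductive_cases ReadE: "exec (Read a) s \<mu>"
inductive_cases WriteE: "exec (Write e) s \<mu>"
inductive_cases TossE: "exec (Toss a) s \<mu>"
inductive_cases SeqE: "exec (Seq c d) s \<mu>"
inductive_cases IfPosE: "exec (IfPos e c d) s \<mu>"
inductive_cases WhilePosE: "exec (WhilePos e c) s \<mu>"

lemma exec_unique: "exec c s \<mu> \<Longrightarrow> exec c s \<mu>' \<Longrightarrow> \<mu> = \<mu>'"
proof (induction arbitrary: \<mu>' rule: exec.induct)
  case (Seq c s \<mu> d \<nu>)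
  from Seq.prems obtain \<rho> \<tau> where *: "\<mu>' = bind_pmf \<rho> \<tau>" "exec c s \<rho>"
      "\<And>t. t \<in> set_pmf \<rho> \<Longrightarrow> exec d t (\<tau> t)"
    by (rule SeqE) (rule that)
  from Seq.IH(1)[OF *(2)] have eq: "\<mu> = \<rho>" .
  show ?case unfolding *(1) eq
    by (rule bind_pmf_cong[OF refl]) (rule Seq.IH(2)[unfolded eq, OF _ *(3)])
next
  case (IfTrue e s c \<mu> d)
  from IfTrue.prems have "exec c (charge e s) \<mu>'" by (rule IfPosE) (use IfTrue.hyps(1) in simp_all)
  then show ?case by (rule IfTrue.IH)
next
  case (IfFalse e s d \<mu> c)
  from IfFalse.prems have "exec d (charge e s) \<mu>'" by (rule IfPosE) (use IfFalse.hyps(1) in simp_all)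
  then show ?case by (rule IfFalse.IH)
next
  case (WhileTrue e s c \<mu>)
  from WhileTrue.prems have "exec (Seq c (WhilePos e c)) (charge e s) \<mu>'" by (rule WhilePosE) (use WhileTrue.hyps(1) in simp_all)
  then show ?case by (rule WhileTrue.IH)
next
  case (WhileFalse e s c)
  from WhileFalse.prems show ?case by (rule WhilePosE) (use WhileFalse.hyps in simp_all)
qed (erule SkipE StoreE ReadE WriteE TossE, rule sym, assumption)+

definition initial :: "int list \<Rightarrow> ram" where
  "initial xs = \<lparr>mem = (\<lambda>_. 0), inp = xs, out = [], cost = 0\<rparr>"

definition unary :: "nat \<Rightarrow> int list" where
  "unary r = replicate r 1"

definition halts_within :: "prog \<Rightarrow> int list \<Rightarrow> nat \<Rightarrow> bool" where
  "halts_within M xs t \<longleftrightarrow> (\<exists>\<mu>. exec M (initial xs) \<mu> \<and> (\<forall>s \<in> set_pmf \<mu>. cost s \<le> t))"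

text \<open>Only meaningful if \<open>M\<close> halts on \<open>xs\<close>; the distribution is then unique by \<open>exec_unique\<close>.\<close>

definition output_dist :: "prog \<Rightarrow> int list \<Rightarrow> int list pmf" where
  "output_dist M xs = map_pmf out (THE \<mu>. exec M (initial xs) \<mu>)"

definition poly_time_on_unary :: "prog \<Rightarrow> bool" where
  "poly_time_on_unary M \<longleftrightarrow> (\<exists>P :: nat poly. \<forall>r. halts_within M (unary r) (poly P r))"

definition poly_bounded :: "(nat \<Rightarrow> nat) \<Rightarrow> bool" where
  "poly_bounded f \<longleftrightarrow> (\<exists>P :: nat poly. \<forall>r. f r \<le> poly P r)"

text \<open>Matrices are written row by row. The first two numbers determine all shapes once \<open>dim_row T\<close>
  is known, so the encoding is unambiguous for data satisfying \<open>ld_shape r R\<close>.\<close>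

definition encode :: "int mat \<Rightarrow> nat \<Rightarrow> int vec \<Rightarrow> int mat \<Rightarrow> int list" where
  "encode A l x T =
     [int (dim_row A), int (dim_col A), int l]
       @ concat (mat_to_list A) @ list_of_vec x @ concat (mat_to_list T)"

end

theory Submission
  imports
    Defs
    "HOL-Computational_Algebra.Formal_Power_Series"
    "HOL-Computational_Algebra.Primes"
    "HOL-Number_Theory.Cong"
begin

text \<open>
  Let \<open>q\<close> be a prime and let \<open>H\<close> be the Reed-Solomon parity check matrix with \<open>k\<close> rows
  \<open>(a ^ j)\<close>, where \<open>a\<close> ranges over \<open>n \<le> q\<close> evaluation points. An integer vector \<open>u\<close> with
  \<open>H u = 0\<close> modulo \<open>q\<close> and \<open>\<ell>\<^sub>1\<close> norm below \<open>2 k\<close> splits into two disjoint multisets of fewer than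
  \<open>k\<close> points with equal power sums, so \<open>u = 0\<close> by Newton's identities. Random hash values are made part
  of the lattice: for \<open>T\<close> uniform modulo a power of two \<open>B \<ge> 2 k\<close>, the vectors
  \<open>(B (H u + q g), T u + B y, u)\<close> with integral \<open>u, g, y\<close> form a lattice with the explicit triangular basis
  \<open>[B q I, 0, B H; 0, B I, T; 0, 0, I]\<close> and the same bound \<open>2 k\<close> on its minimum distance, whatever \<open>T\<close> is.

  The evaluation points come in \<open>h = (1 + \<epsilon>) k\<close> blocks of size \<open>B\<close>, and the number \<open>P < B ^ h\<close> encodes the
  binary vector \<open>u\<close> of weight \<open>h\<close> whose positions within the blocks are the digits of \<open>P\<close> in base \<open>B\<close>.
  There are far more such vectors than syndromes, so a random one shares its syndrome with many others.
  Any two of these collide under the hash \<open>u \<mapsto> T u\<close> with exactly the uniform probability, and hence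
  by a second moment bound the hash reaches every value modulo \<open>B\<close>, in particular every \<open>w \<in> {0, 1} ^ r\<close>. The coset of
  \<open>(- B H u, 0, 0)\<close> therefore contains a vector \<open>(0, w, u')\<close> with \<open>u'\<close> binary of weight \<open>h\<close>, and
  \<open>r + h \<le> \<alpha> ^ p * 2 k\<close>.
\<close>

section \<open>Primes in polynomially long intervals\<close>

text \<open>The minimum distance must hold for every outcome of the coins, so the randomness sits
  where it cannot shorten a vector: the hash rows have columns \<open>B I\<close> of their own, and
  when \<open>u = 0\<close> only multiples of \<open>B\<close> are left. The factor \<open>B\<close>
  on the check rows serves the vectors with \<open>H u + q g \<noteq> 0\<close>. For integers a
  lower bound in l1 passes to every \<open>p \<ge> 1\<close>, so \<open>p\<close> and \<alpha> enter
  the program only through a constant \<open>b\<close>, with \<open>k = b r\<close> and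
  \<open>h = (b + 3) r\<close>: density asks for
  \<open>(b + 4) r \<le> \<alpha> ^ p * 2 b r\<close>, solvable in \<open>b\<close> exactly because
  \<open>\<alpha> ^ p > 1/2\<close>. Of the excess \<open>3 r\<close> of \<open>h\<close> over
  \<open>k\<close>, \<open>2 r\<close> pay for the squared number of hash values in the second
  moment bound; as \<open>q < 2 h B\<close>, the remaining \<open>r\<close> pay for a loss of
  \<open>(2 h) ^ k\<close>, which asks for \<open>B > 36 (2 h) ^ b\<close>. \<open>B\<close> is a
  power of two so that finitely many coins give exactly uniform draws; hashing survives the
  composite modulus because the difference of two distinct code vectors has a coefficient 1.\<close>

lemma leibniz_triangle_dvd:
  fixes d m j :: nat
  assumes "\<And>i. 0 < i \<Longrightarrow> i \<le> m \<Longrightarrow> i dvd d" "0 < j" "j \<le> m"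
  shows "j * (m choose j) dvd d"
proof -
  have "\<exists>z::int. rat_of_nat d / rat_of_nat (j * (m choose j)) = of_int z"
    using assms(2,3,1)
  proof (induction j arbitrary: m)
    case 0
    then show ?case by simp
  next
    case (Suc j)
    show ?case
    proof (cases "j = 0")
      case True
      have "m dvd d" using Suc.prems by auto
      then obtain c where "d = m * c" ..
      then show ?thesis using True Suc.prems by (intro exI[of _ "int c"]) auto
    next
      case False
      then obtain m' where m: "m = Suc m'" "j \<le> m'" using Suc.prems by (cases m) auto
      obtain z1 z2 :: int where
        z1: "rat_of_nat d / rat_of_nat (j * (m' choose j)) = of_int z1" and
        z2: "rat_of_nat d / rat_of_nat (j * (m choose j)) = of_int z2"
        using Suc.IH[of m'] Suc.IH[of m] False m Suc.prems by (metis Suc_leD le_SucI neq0_conv)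
      have a: "Suc j * (m choose Suc j) = m * (m' choose j)"
        unfolding m by (rule Suc_times_binomial_eq[symmetric, simplified mult.commute])
      have b: "(m - j) * (m choose j) = m * (m' choose j)"
        using binomial_absorb_comp[of m j] m by simp
      have b': "(of_nat m - of_nat j) * rat_of_nat (m choose j) = of_nat m * of_nat (m' choose j)"
        using arg_cong[OF b, of rat_of_nat] m(2) unfolding m(1) of_nat_mult by (simp add: of_nat_diff)
      have nz: "rat_of_nat (m' choose j) \<noteq> 0" "rat_of_nat (m choose j) \<noteq> 0" "rat_of_nat m \<noteq> 0"
           "rat_of_nat j \<noteq> 0" using m False by auto
      \<comment> \<open>The recurrence of Leibniz's harmonic triangle: an entry is the difference of
        two entries of index \<open>j\<close>. Multiplied by \<open>d\<close>, both are integers by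
        induction.\<close>
      have "1 / rat_of_nat (Suc j * (m choose Suc j))
          = 1 / (rat_of_nat j * rat_of_nat (m' choose j)) - 1 / (rat_of_nat j * rat_of_nat (m choose j))"
        unfolding a of_nat_mult using nz b' by (simp add: divide_simps) (simp add: algebra_simps)
      from arg_cong[OF this, of "\<lambda>x. rat_of_nat d * x"]
      have "rat_of_nat d / rat_of_nat (Suc j * (m choose Suc j)) = of_int (z1 - z2)"
        using z1 z2 by (simp add: right_diff_distrib del: mult_Suc)
      then show ?thesis by blast
    qed
  qed
  then obtain z where z: "rat_of_nat d / rat_of_nat (j * (m choose j)) = of_int z" ..
  have "rat_of_nat (j * (m choose j)) \<noteq> 0" using assms by (simp add: zero_less_binomial)
  then have "rat_of_nat d = rat_of_nat (j * (m choose j)) * of_int z"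
    using z by (simp add: field_simps)
  then have "of_int (int d) = (of_int (int (j * (m choose j)) * z) :: rat)" by simp
  then have "int d = int (j * (m choose j)) * z" unfolding of_int_eq_iff .
  then have "int (j * (m choose j)) dvd int d" by simp
  then show ?thesis by (simp only: int_dvd_int_iff)
qed

text \<open>If the interval had no prime, at most \<open>N\<close> primes would lie below
  \<open>m\<close>, so the least common multiple of \<open>1..m\<close>, a product of prime powers
  each at most \<open>m\<close>, would be at most \<open>m ^ N\<close>. But it is a multiple of
  \<open>n * (m choose n)\<close>, which is exponential in \<open>n\<close>.\<close>

lemma prime_between:
  fixes N :: nat
  shows "\<exists>q. prime q \<and> N < q \<and> q \<le> 2 * (N + 1)\<^sup>2"
proof (rule ccontr)
  assume none: "\<not> ?thesis"
  define n where "n = (N + 1)\<^sup>2"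
  define m where "m = 2 * n"
  have n: "0 < n" by (simp add: n_def)
  have m: "m > 1" using n by (simp add: m_def)
  define S where "S = {p::nat. prime p \<and> p \<le> m}"
  have "finite S" by (rule finite_subset[of _ "{..m}"]) (auto simp: S_def)
  moreover have "p \<le> N" if "prime p" "p \<le> m" for p
    using none that unfolding m_def n_def by (meson not_le_imp_less)
  ultimately have S: "finite S" "S \<subseteq> {1..N}"
    by (auto simp: S_def prime_ge_1_nat simp del: One_nat_def)
  have cS: "card S \<le> N" using card_mono[OF _ S(2)] by simp
  define e where "e p = Max {e. p ^ e \<le> m}" for p :: nat
  have fin: "finite {e. p ^ e \<le> m}" if "p \<in> S" for p
  proof (rule finite_subset)
    show "{e. p ^ e \<le> m} \<subseteq> {..m}"
    proof safe
      fix e assume "p ^ e \<le> m"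
      moreover have "e < p ^ e" using that by (intro power_gt_expt) (auto simp: S_def prime_nat_iff)
      ultimately show "e \<le> m" by simp
    qed
  qed simp
  have ne: "{e. p ^ e \<le> m} \<noteq> {}" for p using m by (auto intro: exI[of _ 0])
  define d where "d = (\<Prod>p\<in>S. p ^ e p)"
  have dvd: "i dvd d" if i: "0 < i" "i \<le> m" for i
  proof -
    have sub: "prime_factors i \<subseteq> S"
      using i by (auto simp: S_def in_prime_factors_iff intro: order_trans[OF dvd_imp_le])
    have "i = (\<Prod>p\<in>prime_factors i. p ^ multiplicity p i)"
      using i by (simp add: prime_factorization_nat)
    also have "\<dots> dvd (\<Prod>p\<in>prime_factors i. p ^ e p)"
    proof (rule prod_dvd_prod)
      fix p assume p: "p \<in> prime_factors i"
      have "p ^ multiplicity p i dvd i" by (rule multiplicity_dvd)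
      then have "p ^ multiplicity p i \<le> m" using i by (meson dvd_imp_le le_trans)
      then have "multiplicity p i \<le> e p"
        unfolding e_def using fin p sub by (intro Max_ge) auto
      then show "p ^ multiplicity p i dvd p ^ e p" by (rule le_imp_power_dvd)
    qed
    also have "\<dots> dvd d" unfolding d_def using S sub by (intro prod_dvd_prod_subset) auto
    finally show ?thesis .
  qed
  have "d \<le> (\<Prod>p\<in>S. m)"
    unfolding d_def
  proof (rule prod_mono, safe)
    fix p assume "p \<in> S"
    then show "p ^ e p \<le> m" using Max_in[OF fin ne, of p] by (simp add: e_def)
  qed
  also have "\<dots> \<le> m ^ N" using cS m by (simp add: power_increasing)
  finally have dm: "d \<le> m ^ N" .
  have "d > 0" unfolding d_def by (intro prod_pos) (auto simp: S_def prime_gt_0_nat)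
  then have "n * (m choose n) \<le> d"
    using leibniz_triangle_dvd[of m d n] dvd n by (intro dvd_imp_le) (auto simp: m_def)
  moreover have "(m choose n) \<le> n * (m choose n)" using n by simp
  ultimately have "(m choose n) \<le> m ^ N" using dm by linarith
  moreover have "4 ^ n / (2 * real n) \<le> real (m choose n)"
    using central_binomial_lower_bound[OF n(1)] by (simp add: m_def)
  ultimately have "4 ^ n / (2 * real n) \<le> real (m ^ N)"
    by (meson of_nat_le_iff order_trans)
  then have "4 ^ n \<le> real (m ^ N) * (2 * real n)"
    using n by (simp add: divide_simps)
  also have "\<dots> = real (m ^ (N + 1))" by (simp add: m_def)
  finally have le: "(4::real) ^ n \<le> real m ^ (N + 1)" by simp
  \<comment> \<open>The reason for the square in \<open>n\<close>: \<open>4 ^ n\<close> is the power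
    \<open>N + 1\<close> of \<open>4 ^ (N + 1)\<close>, so it only remains to compare the bases
    \<open>m\<close> and \<open>4 ^ (N + 1)\<close>.\<close>
  have aux: "2 * (x + 1)\<^sup>2 < 4 ^ (x + 1)" for x :: nat
  proof (induction x)
    case (Suc x)
    have "2 * (Suc x + 1)\<^sup>2 \<le> 4 * (2 * (x + 1)\<^sup>2)" by (simp add: power2_eq_square algebra_simps)
    also have "\<dots> < 4 * 4 ^ (x + 1)" using Suc by simp
    finally show ?case by simp
  qed simp
  have "real m ^ (N + 1) < (4 ^ (N + 1)) ^ (N + 1)"
  proof (rule power_strict_mono)
    have "real (2 * (N + 1)\<^sup>2) < real (4 ^ (N + 1))" using aux[of N] by (simp only: of_nat_less_iff)
    then show "real m < 4 ^ (N + 1)" by (simp add: m_def n_def)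
  qed auto
  also have "\<dots> = 4 ^ n" by (simp only: n_def power2_eq_square power_mult)
  finally show False using le by simp
qed

section \<open>Power sums modulo a prime\<close>

text \<open>The reversed polynomial with roots \<open>xs\<close>. Its coefficient
  \<open>esym xs i\<close> is the elementary symmetric function of degree \<open>i\<close> with sign
  \<open>(-1) ^ i\<close>. Power series rather than polynomials, because the generating series of
  the power sums is infinite.\<close>

definition sympoly :: "int list \<Rightarrow> int fps" where
  "sympoly xs = prod_list (map (\<lambda>a. 1 - fps_const a * fps_X) xs)"

abbreviation esym :: "int list \<Rightarrow> nat \<Rightarrow> int" where
  "esym xs \<equiv> fps_nth (sympoly xs)"

lemma sympoly_Nil [simp]: "sympoly [] = 1"
  and sympoly_Cons: "sympoly (a # xs) = (1 - fps_const a * fps_X) * sympoly xs"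
  by (simp_all add: sympoly_def)

lemma sympoly_nth_0 [simp]: "esym xs 0 = 1"
  by (induction xs) (simp_all add: sympoly_Cons)

lemma sympoly_Cons_Suc: "esym (a # xs) (Suc i) = esym xs (Suc i) - a * (esym xs i)"
  by (simp add: sympoly_Cons left_diff_distrib mult.assoc)

lemma sympoly_nth_gt: "length xs < i \<Longrightarrow> esym xs i = 0"
proof (induction xs arbitrary: i)
  case (Cons a xs)
  then show ?case by (cases i) (auto simp: sympoly_Cons_Suc)
qed simp

text \<open>Logarithmic differentiation of the product, kept free of division: for one factor,
  \<open>a\<close> equals \<open>1 - a X\<close> times the geometric series with coefficients
  \<open>a ^ Suc j\<close>.\<close>

lemma newton_fps:
  "fps_deriv (sympoly xs) = - (sympoly xs * Abs_fps (\<lambda>j. \<Sum>a\<leftarrow>xs. a ^ Suc j))"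
proof (induction xs)
  case Nil
  have "Abs_fps (\<lambda>j. 0) = (0 :: int fps)" by (simp add: fps_eq_iff)
  then show ?case by simp
next
  case (Cons a xs)
  let ?P = "Abs_fps (\<lambda>j. \<Sum>a\<leftarrow>xs. a ^ Suc j)" and ?G = "Abs_fps (\<lambda>j. a ^ Suc j)"
  have split: "Abs_fps (\<lambda>j. \<Sum>a\<leftarrow>a # xs. a ^ Suc j) = ?G + ?P" by (simp add: fps_eq_iff)
  have geo: "(1 - fps_const a * fps_X) * ?G = fps_const a"
  proof (rule fps_ext)
    fix n show "fps_nth ((1 - fps_const a * fps_X) * ?G) n = fps_nth (fps_const a) n"
      by (cases n) (simp_all add: left_diff_distrib mult.assoc)
  qed
  have "fps_deriv (sympoly (a # xs))
      = - (fps_const a * sympoly xs) - (1 - fps_const a * fps_X) * (sympoly xs * ?P)"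
    using Cons by (simp add: sympoly_Cons algebra_simps)
  also have "\<dots> = - (((1 - fps_const a * fps_X) * ?G) * sympoly xs) - (1 - fps_const a * fps_X) * (sympoly xs * ?P)"
    by (simp only: geo)
  also have "\<dots> = - (sympoly (a # xs) * (?G + ?P))" by (simp add: sympoly_Cons algebra_simps)
  finally show ?case by (simp only: split)
qed

lemma newton_identity:
  "int (Suc j) * (esym xs (Suc j)) = - (\<Sum>i\<le>j. (esym xs i) * (\<Sum>a\<leftarrow>xs. a ^ Suc (j - i)))"
  using arg_cong[OF newton_fps[of xs], of "\<lambda>f. fps_nth f j"]
  by (simp add: fps_mult_nth atLeast0AtMost)

lemma prod_list_diff_eq_sympoly:
  "(\<Prod>a\<leftarrow>xs. x - a) = (\<Sum>i\<le>length xs. (esym xs i) * x ^ (length xs - i))"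
proof (induction xs)
  case (Cons a xs)
  let ?m = "length xs"
  have "(\<Sum>i\<le>Suc ?m. (esym (a # xs) i) * x ^ (Suc ?m - i))
      = x ^ Suc ?m + (\<Sum>i\<le>?m. (esym xs (Suc i) - a * (esym xs i)) * x ^ (?m - i))"
    by (simp add: sum.atMost_Suc_shift sympoly_Cons_Suc del: sum.atMost_Suc)
  also have "\<dots> = x ^ Suc ?m + (\<Sum>i\<le>?m. (esym xs (Suc i)) * x ^ (?m - i))
      - a * (\<Sum>i\<le>?m. (esym xs i) * x ^ (?m - i))"
    by (simp add: left_diff_distrib sum_subtractf sum_distrib_left mult.assoc)
  also have "x ^ Suc ?m + (\<Sum>i\<le>?m. (esym xs (Suc i)) * x ^ (?m - i))
      = (\<Sum>i\<le>Suc ?m. (esym xs i) * x ^ (Suc ?m - i))"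
    by (subst sum.atMost_Suc_shift) simp
  also have "\<dots> = x * (\<Sum>i\<le>?m. (esym xs i) * x ^ (?m - i))"
    by (auto simp: sum_distrib_left sympoly_nth_gt Suc_diff_le intro!: sum.cong)
  finally show ?case using Cons by (simp add: algebra_simps)
qed simp

text \<open>Newton's identity expresses \<open>i\<close> times the coefficient of index
  \<open>i\<close> through power sums and smaller coefficients. Since
  \<open>0 < i < k \<le> q\<close>, the factor \<open>i\<close> is invertible modulo the prime and
  can be cancelled.\<close>

lemma sympoly_cong:
  fixes q :: nat
  assumes "prime q" "k \<le> q"
    and "\<And>j. j < k \<Longrightarrow> [(\<Sum>a\<leftarrow>xs. a ^ j) = (\<Sum>a\<leftarrow>ys. a ^ j)] (mod int q)"
    and "i < k"
  shows "[esym xs i = esym ys i] (mod int q)"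
  using assms(4)
proof (induction i rule: less_induct)
  case (less i)
  show ?case
  proof (cases i)
    case (Suc j)
    have "[int (Suc j) * (esym xs (Suc j)) = int (Suc j) * (esym ys (Suc j))] (mod int q)"
      unfolding newton_identity
      by (intro cong_minus_minus_iff[THEN iffD2] cong_sum cong_mult less.IH assms(3))
        (use Suc less.prems in auto)
    moreover have "coprime (int (Suc j)) (int q)"
      using assms(1,2) less.prems Suc
      by (metis coprime_int_iff coprime_commute prime_imp_coprime nat_dvd_not_less zero_less_Suc less_le_trans)
    ultimately show ?thesis using Suc by (simp add: cong_mult_lcancel)
  qed simp
qed

lemma prime_dvd_prod_list:
  fixes p :: int
  assumes "prime p" "p dvd prod_list xs"
  shows "\<exists>x \<in> set xs. p dvd x"
  using assms(2) by (induction xs) (use assms(1) in \<open>auto simp: prime_dvd_mult_iff\<close>)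

text \<open>Fewer than \<open>k\<close> points have all their coefficients controlled by the power
  sums, so the two polynomials agree modulo \<open>q\<close>. Evaluated at a root \<open>x\<close>
  of the first, the second vanishes modulo \<open>q\<close>; primality yields a factor
  \<open>x - y\<close> divisible by \<open>q\<close>, and the range forces
  \<open>x = y\<close>.\<close>

lemma disjoint_power_sums:
  fixes q :: nat
  assumes q: "prime q" "k \<le> q" "length xs = length ys" "length xs < k"
    and ps: "\<And>j. j < k \<Longrightarrow> [(\<Sum>a\<leftarrow>xs. a ^ j) = (\<Sum>a\<leftarrow>ys. a ^ j)] (mod int q)"
    and range: "set xs \<subseteq> {0..<int q}" "set ys \<subseteq> {0..<int q}" "set xs \<inter> set ys = {}"
  shows "xs = []"
proof (cases xs)
  case (Cons x xs')
  have "[(\<Prod>a\<leftarrow>xs. x - a) = (\<Prod>a\<leftarrow>ys. x - a)] (mod int q)"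
    unfolding prod_list_diff_eq_sympoly q(3)
    by (intro cong_sum cong_mult cong_refl sympoly_cong[OF q(1,2) ps]) (use q in auto)
  moreover have "(\<Prod>a\<leftarrow>xs. x - a) = 0" by (simp add: Cons)
  ultimately have "int q dvd (\<Prod>a\<leftarrow>ys. x - a)"
    by (simp add: cong_0_iff[symmetric] cong_sym)
  then obtain y where y: "y \<in> set ys" "int q dvd x - y"
    using q(1) prime_dvd_prod_list[of "int q" "map (\<lambda>a. x - a) ys"] by auto
  then have "[x = y] (mod int q)" by (simp add: cong_iff_dvd_diff)
  moreover have "x \<in> {0..<int q}" "y \<in> {0..<int q}" using range Cons y by auto
  ultimately have "x = y" by (auto simp: cong_def)
  then show ?thesis using range(3) y Cons by auto
qed simp

lemma vandermonde_kernel_l1: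
  fixes z :: "nat \<Rightarrow> int" and q k n :: nat
  assumes q: "prime q" "2 * k \<le> q" "n \<le> q"
    and ker: "\<And>j. j < k \<Longrightarrow> int q dvd (\<Sum>a<n. z a * int a ^ j)"
    and small: "(\<Sum>a<n. \<bar>z a\<bar>) < 2 * int k"
    and a: "a < n"
  shows "z a = 0"
proof -
  \<comment> \<open>\<open>nat\<close> truncates negative numbers to 0, so \<open>ms z\<close> and
    \<open>ms (\<lambda>a. - z a)\<close> list the positive and the negative part of
    \<open>z\<close> with multiplicity.\<close>
  define ms where "ms f = concat (map (\<lambda>a. replicate (nat (f a)) (int a)) [0..<n])" for f :: "nat \<Rightarrow> int"
  have len: "int (length (ms f)) = (\<Sum>a<n. int (nat (f a)))" for f
    unfolding ms_def length_concat
    by (simp add: comp_def sum_list_sum_nth atLeast0LessThan interv_sum_list_conv_sum_set_nat)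
  have pow: "(\<Sum>a\<leftarrow>ms f. a ^ j) = (\<Sum>a<n. int (nat (f a)) * int a ^ j)" for f j
  proof -
    have "(\<Sum>a\<leftarrow>concat (map (\<lambda>a. replicate (nat (f a)) (int a)) as). a ^ j)
        = (\<Sum>a\<leftarrow>as. int (nat (f a)) * int a ^ j)" for as
      by (induction as) (simp_all add: sum_list_replicate)
    then show ?thesis
      by (simp add: ms_def atLeast0LessThan interv_sum_list_conv_sum_set_nat)
  qed
  let ?x = "ms z" and ?y = "ms (\<lambda>a. - z a)"
  have diff: "(\<Sum>a\<leftarrow>?x. a ^ j) - (\<Sum>a\<leftarrow>?y. a ^ j) = (\<Sum>a<n. z a * int a ^ j)" for j
    unfolding pow sum_subtractf[symmetric]
    by (intro sum.cong) (auto simp: left_diff_distrib[symmetric])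
  have cong: "[(\<Sum>a\<leftarrow>?x. a ^ j) = (\<Sum>a\<leftarrow>?y. a ^ j)] (mod int q)" if "j < k" for j
    using ker[OF that] by (simp add: cong_iff_dvd_diff diff)
  have tot: "int (length ?x) + int (length ?y) = (\<Sum>a<n. \<bar>z a\<bar>)"
    unfolding len sum.distrib[symmetric] by (intro sum.cong) auto
  have "0 \<le> (\<Sum>a<n. \<bar>z a\<bar>)" by (intro sum_nonneg) simp
  then have k: "0 < k" using small by linarith
  \<comment> \<open>Exponent 0 counts the points. Both lengths are below
    \<open>2 * k \<le> q\<close>, so the congruence is an equality and each length is below
    \<open>k\<close>.\<close>
  have "[int (length ?x) = int (length ?y)] (mod int q)"
    using cong[OF k] by (simp add: sum_list_triv)
  moreover have "length ?x < q" "length ?y < q" using tot small q by linarith+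
  ultimately have leq: "length ?x = length ?y" by (auto simp: cong_def)
  have mem: "i \<in> set (ms f) \<longleftrightarrow> (\<exists>a<n. i = int a \<and> f a > 0)" for f i
    by (auto simp: ms_def set_replicate_conv_if)
  have "?x = []"
    by (rule disjoint_power_sums[of q k _ ?y]) (use q leq tot small cong in \<open>auto simp: mem\<close>)
  with leq have "(\<Sum>a<n. \<bar>z a\<bar>) = 0" using tot by simp
  then show ?thesis using a by (simp add: sum_nonneg_eq_0_iff)
qed

section \<open>Exact output distributions and costs of programs\<close>

text \<open>A size independent of the memory: if all registers are below \<open>2 ^ L\<close>, the
  value of \<open>e\<close> is below \<open>2 ^ (L * val_width e)\<close>. Together with
  \<open>expr_weight\<close> it shows that every step of a fixed program costs at most linearly in
  \<open>L\<close>.\<close>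

fun val_width :: "expr \<Rightarrow> nat" where
  "val_width (Const k) = nat \<bar>k\<bar> + 1"
| "val_width (Load e) = 1"
| "val_width (Op f a b) = val_width a + val_width b + 1"

fun expr_weight :: "expr \<Rightarrow> nat" where
  "expr_weight (Const k) = bits k"
| "expr_weight (Load e) = expr_weight e + 2"
| "expr_weight (Op f a b) = expr_weight a + expr_weight b + val_width (Op f a b) + 1"

text \<open>Both branches of a conditional and the body of a loop count once; repetition is measured
  separately by the step count of \<open>runs\<close>. The additive constants pay for the flat
  charge of a command and for the bit length of a stored value.\<close>

fun prog_weight :: "prog \<Rightarrow> nat" where
  "prog_weight Skip = 0"
| "prog_weight (Store a e) = 4 + expr_weight a + expr_weight e"
| "prog_weight (Read a) = 3 + expr_weight a"
| "prog_weight (Write e) = 1 + expr_weight e"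
| "prog_weight (Toss a) = 3 + expr_weight a"
| "prog_weight (Seq c d) = prog_weight c + prog_weight d"
| "prog_weight (IfPos e c d) = 1 + expr_weight e + prog_weight c + prog_weight d"
| "prog_weight (WhilePos e c) = 1 + expr_weight e + prog_weight c"

definition mem_bounded :: "nat \<Rightarrow> (nat \<Rightarrow> int) \<Rightarrow> bool" where
  "mem_bounded L m \<longleftrightarrow> 0 < L \<and> (\<forall>i. \<bar>m i\<bar> < 2 ^ L)"

lemma bits_le: "\<bar>k\<bar> < 2 ^ w \<Longrightarrow> bits k \<le> Suc w"
proof -
  assume "\<bar>k\<bar> < 2 ^ w"
  then have "int (nat \<bar>k\<bar>) < int (2 ^ w)" by simp
  then have "nat \<bar>k\<bar> < 2 ^ w" unfolding of_nat_less_iff .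
  then have "floorlog 2 (nat \<bar>k\<bar>) \<le> w" by (intro floorlog_leI) auto
  then show ?thesis by (simp add: bits_def)
qed

lemma abs_div_le: "\<bar>a div b\<bar> \<le> \<bar>a :: int\<bar>"
proof -
  have pos: "\<bar>a div b\<bar> \<le> \<bar>a\<bar>" if b: "b > 0" for a b :: int
  proof (cases "a div b \<ge> 0")
    case True
    have "1 * (a div b) \<le> b * (a div b)" using b True by (intro mult_right_mono) auto
    also have "\<dots> \<le> a" using b pos_mod_sign[of b a] mult_div_mod_eq[of b a] by linarith
    finally show ?thesis using True by simp
  next
    case False
    have "a < b * (a div b) + b" using b pos_mod_bound[of b a] mult_div_mod_eq[of b a] by linarith
    also have "\<dots> = b * (a div b + 1)" by (simp add: algebra_simps)
    also have "\<dots> \<le> 1 * (a div b + 1)" using b False by (intro mult_right_mono_neg) auto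
    finally show ?thesis using False by simp
  qed
  consider "b = 0" | "b > 0" | "- b > 0" by linarith
  then show ?thesis
  proof cases
    case 3
    then show ?thesis using pos[of "- b" "- a"] by simp
  qed (use pos in auto)
qed

lemma abs_mod_le: "\<bar>a mod b\<bar> \<le> max \<bar>a\<bar> \<bar>b :: int\<bar>"
  by (cases "b = 0") (use abs_mod_less[of b a] in auto)

lemma binop_val_bound:
  assumes "\<bar>a\<bar> < 2 ^ v" "\<bar>b\<bar> < 2 ^ w"
  shows "\<bar>binop_val f a b\<bar> < 2 ^ (v + w + 1)"
proof -
  have le: "(2::int) ^ v \<le> 2 ^ (v + w)" "(2::int) ^ w \<le> 2 ^ (v + w)"
    by (simp_all add: power_increasing)
  have dbl: "(2::int) ^ (v + w + 1) = 2 * 2 ^ (v + w)" by simp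
  have pos: "(1::int) \<le> 2 ^ (v + w)" by simp
  show ?thesis
  proof (cases f)
    case Mul
    have "\<bar>a\<bar> * \<bar>b\<bar> < 2 ^ v * 2 ^ w" using assms by (intro mult_strict_mono') auto
    then show ?thesis using Mul dbl pos by (simp add: abs_mult power_add)
  next
    case Div
    then have "\<bar>binop_val f a b\<bar> < 2 ^ v" using assms abs_div_le[of a b] by simp
    then show ?thesis unfolding dbl using le pos by linarith
  next
    case Mod
    then have "\<bar>binop_val f a b\<bar> < max (2 ^ v) (2 ^ w)" using assms abs_mod_le[of a b] by simp
    then show ?thesis unfolding dbl using le pos by linarith
  next
    case Less
    then show ?thesis unfolding dbl using pos by (simp add: less_le_trans[of _ 2])
  next
    case Add
    then have "\<bar>binop_val f a b\<bar> \<le> \<bar>a\<bar> + \<bar>b\<bar>" by (simp add: abs_triangle_ineq)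
    then show ?thesis unfolding dbl using assms le by linarith
  next
    case Sub
    then have "\<bar>binop_val f a b\<bar> \<le> \<bar>a\<bar> + \<bar>b\<bar>" by (simp add: abs_triangle_ineq4)
    then show ?thesis unfolding dbl using assms le by linarith
  qed
qed

lemma expr_val_bound:
  assumes "mem_bounded L m"
  shows "\<bar>expr_val e m\<bar> < 2 ^ (L * val_width e)"
proof (induction e)
  case (Const k)
  have "\<bar>k\<bar> = int (nat \<bar>k\<bar>)" by simp
  also have "\<dots> < int (2 ^ nat \<bar>k\<bar>)" unfolding of_nat_less_iff by simp
  also have "\<dots> = 2 ^ nat \<bar>k\<bar>" by simp
  also have "\<dots> \<le> (2::int) ^ (L * (nat \<bar>k\<bar> + 1))"
    using assms by (intro power_increasing) (auto simp: mem_bounded_def trans_le_add2)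
  finally show ?case by simp
next
  case (Load e)
  then show ?case using assms by (simp add: mem_bounded_def)
next
  case (Op f a b)
  have "\<bar>expr_val (Op f a b) m\<bar> < 2 ^ (L * val_width a + L * val_width b + 1)"
    using binop_val_bound[OF Op.IH] by simp
  also have "\<dots> \<le> (2::int) ^ (L * val_width (Op f a b))"
    using assms by (intro power_increasing) (auto simp: mem_bounded_def algebra_simps)
  finally show ?case .
qed

lemma expr_cost_bound:
  assumes "mem_bounded L m"
  shows "expr_cost e m \<le> L * expr_weight e"
proof (induction e)
  case (Const k)
  then show ?case using assms by (simp add: mem_bounded_def)
next
  case (Load e)
  have "\<bar>m (nat (expr_val e m))\<bar> < 2 ^ L" "0 < L" using assms by (auto simp: mem_bounded_def)
  then show ?case using Load bits_le[of "m (nat (expr_val e m))" L] by simp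
next
  case (Op f a b)
  have "bits (expr_val (Op f a b) m) \<le> Suc (L * val_width (Op f a b))"
    by (rule bits_le[OF expr_val_bound[OF assms]])
  moreover have "0 < L" using assms by (simp add: mem_bounded_def)
  ultimately show ?case using Op by (simp add: algebra_simps)
qed

text \<open>Started with memory \<open>m\<close> and output \<open>w\<close>, the final state of \<open>c\<close> is a function of a random value
  distributed according to \<open>\<nu>\<close>; \<open>T\<close> counts elementary steps, each of which costs at most
  \<open>L * prog_weight c\<close> as long as all registers stay below \<open>2 ^ L\<close> in absolute value.\<close>

definition runs :: "nat \<Rightarrow> 'v pmf \<Rightarrow> prog \<Rightarrow> (nat \<Rightarrow> int) \<Rightarrow> int list \<Rightarrow> nat \<Rightarrow>
    ('v \<Rightarrow> (nat \<Rightarrow> int) \<Rightarrow> int list \<Rightarrow> bool) \<Rightarrow> bool" where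
  "runs L \<nu> c m w T Q \<longleftrightarrow> (\<forall>s. mem s = m \<longrightarrow> out s = w \<longrightarrow> mem_bounded L m \<longrightarrow>
     (\<exists>f. exec c s (map_pmf f \<nu>) \<and>
       (\<forall>v \<in> set_pmf \<nu>. cost (f v) \<le> cost s + L * prog_weight c * T \<and> mem_bounded L (mem (f v)) \<and>
          Q v (mem (f v)) (out (f v)))))"

abbreviation druns :: "nat \<Rightarrow> prog \<Rightarrow> (nat \<Rightarrow> int) \<Rightarrow> int list \<Rightarrow> nat \<Rightarrow>
    ((nat \<Rightarrow> int) \<Rightarrow> int list \<Rightarrow> bool) \<Rightarrow> bool" where
  "druns L c m w T Q \<equiv> runs L (return_pmf ()) c m w T (\<lambda>_. Q)"

section \<open>Change of sample space, weakening and sequencing\<close>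

lemma runs_cong_pmf:
  assumes "runs L (map_pmf g \<nu>) c m w T Q"
  shows "runs L \<nu> c m w T (\<lambda>v. Q (g v))"
  unfolding runs_def
proof (intro allI impI)
  fix s :: ram assume "mem s = m" "out s = w" "mem_bounded L m"
  with assms obtain f where "exec c s (map_pmf f (map_pmf g \<nu>))"
     "\<forall>v \<in> set_pmf (map_pmf g \<nu>). cost (f v) \<le> cost s + L * prog_weight c * T \<and> mem_bounded L (mem (f v)) \<and>
          Q v (mem (f v)) (out (f v))" unfolding runs_def by blast
  then show "\<exists>f. exec c s (map_pmf f \<nu>) \<and>
       (\<forall>v \<in> set_pmf \<nu>. cost (f v) \<le> cost s + L * prog_weight c * T \<and> mem_bounded L (mem (f v)) \<and>
          Q (g v) (mem (f v)) (out (f v)))"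
    by (intro exI[of _ "f \<circ> g"]) (simp add: pmf.map_comp)
qed

text \<open>The final state is a function of the old value \<open>v\<close>, so \<open>v\<close>
  must be recoverable from \<open>g v\<close>. This is how \<open>(x, xs)\<close> becomes
  \<open>x # xs\<close> and a bit with a remainder becomes one number.\<close>

lemma runs_map_inj:
  assumes "runs L \<nu> c m w T (\<lambda>v. Q (g v))" "inj_on g (set_pmf \<nu>)"
  shows "runs L (map_pmf g \<nu>) c m w T Q"
proof -
  let ?h = "inv_into (set_pmf \<nu>) g"
  have "map_pmf ?h (map_pmf g \<nu>) = map_pmf (\<lambda>v. v) \<nu>"
    unfolding pmf.map_comp by (rule map_pmf_cong[OF refl]) (use assms(2) in simp)
  then have "runs L (map_pmf ?h (map_pmf g \<nu>)) c m w T (\<lambda>v. Q (g v))"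
    using assms(1) by simp
  from runs_cong_pmf[OF this]
  have r: "runs L (map_pmf g \<nu>) c m w T (\<lambda>x. Q (g (?h x)))" .
  have "g (?h x) = x" if "x \<in> set_pmf (map_pmf g \<nu>)" for x
    using that by (auto intro: f_inv_into_f)
  then show ?thesis using r unfolding runs_def by (metis (no_types, lifting))
qed

lemma runs_weaken:
  assumes "runs L \<nu> c m w T Q" "T \<le> T'"
    "\<And>v m' w'. v \<in> set_pmf \<nu> \<Longrightarrow> mem_bounded L m' \<Longrightarrow> Q v m' w' \<Longrightarrow> Q' v m' w'"
  shows "runs L \<nu> c m w T' Q'"
  unfolding runs_def
proof (intro allI impI)
  fix s :: ram assume "mem s = m" "out s = w" "mem_bounded L m"
  with assms obtain f where f: "exec c s (map_pmf f \<nu>)"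
     "\<forall>v \<in> set_pmf \<nu>. cost (f v) \<le> cost s + L * prog_weight c * T \<and> mem_bounded L (mem (f v)) \<and>
          Q v (mem (f v)) (out (f v))" unfolding runs_def by blast
  have "L * prog_weight c * T \<le> L * prog_weight c * T'" using assms(2) by simp
  then show "\<exists>f. exec c s (map_pmf f \<nu>) \<and>
       (\<forall>v \<in> set_pmf \<nu>. cost (f v) \<le> cost s + L * prog_weight c * T' \<and> mem_bounded L (mem (f v)) \<and>
          Q' v (mem (f v)) (out (f v)))"
    using f assms(3) by (intro exI[of _ f]) (meson add_left_mono order_trans)
qed

lemma runs_assume_bounded:
  assumes "mem_bounded L m \<Longrightarrow> runs L \<nu> c m w T Q"
  shows "runs L \<nu> c m w T Q"
  using assms unfolding runs_def by blast

lemma runsD: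
  assumes "runs L \<nu> c m w T Q" "mem s = m" "out s = w" "mem_bounded L m"
  shows "\<exists>f. exec c s (map_pmf f \<nu>) \<and> (\<forall>v \<in> set_pmf \<nu>. cost (f v) \<le> cost s + L * prog_weight c * T) \<and>
     (\<forall>v \<in> set_pmf \<nu>. mem_bounded L (mem (f v))) \<and> (\<forall>v \<in> set_pmf \<nu>. Q v (mem (f v)) (out (f v)))"
  using assms unfolding runs_def by blast

lemma runsI:
  assumes "\<And>s :: ram. mem s = m \<Longrightarrow> out s = w \<Longrightarrow> mem_bounded L m \<Longrightarrow>
     \<exists>f. exec c s (map_pmf f \<nu>) \<and>
       (\<forall>v \<in> set_pmf \<nu>. cost (f v) \<le> cost s + L * prog_weight c * T \<and> mem_bounded L (mem (f v)) \<and>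
          Q v (mem (f v)) (out (f v)))"
  shows "runs L \<nu> c m w T Q"
  using assms unfolding runs_def by blast

text \<open>The support of a distribution is nonempty, hence the postcondition is satisfiable. It
  lets a decreasing measure be seen to be positive.\<close>

lemma runs_post:
  assumes "runs L \<nu> c m w T Q" "mem_bounded L m"
  shows "\<exists>v m' w'. Q v m' w'"
proof -
  obtain f :: "_ \<Rightarrow> ram" where "\<forall>v \<in> set_pmf \<nu>. Q v (mem (f v)) (out (f v))"
    using runsD[OF assms(1), of "\<lparr>mem = m, inp = [], out = w, cost = 0\<rparr>", OF _ _ assms(2), simplified]
    by (elim exE conjE) (rule that)
  then show ?thesis using set_pmf_not_empty[of \<nu>] by blast
qed

lemma exec_seq_runs:
  assumes c: "exec c s (map_pmf f \<nu>)"
     "\<forall>v \<in> set_pmf \<nu>. cost (f v) \<le> C"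
     "\<forall>v \<in> set_pmf \<nu>. mem_bounded L (mem (f v))"
     "\<forall>v \<in> set_pmf \<nu>. Q v (mem (f v)) (out (f v))"
    and d: "\<forall>v \<in> set_pmf \<nu>. \<forall>m' w'. Q v m' w' \<longrightarrow> runs L \<nu>' d m' w' T (Q' v)"
  shows "\<exists>g. exec (Seq c d) s (map_pmf g (pair_pmf \<nu> \<nu>')) \<and>
     (\<forall>(v, v') \<in> set_pmf (pair_pmf \<nu> \<nu>'). cost (g (v, v')) \<le> C + L * prog_weight d * T \<and>
        mem_bounded L (mem (g (v, v'))) \<and> Q' v v' (mem (g (v, v'))) (out (g (v, v'))))"
proof -
  have "\<exists>g. exec d (f v) (map_pmf g \<nu>') \<and>
       (\<forall>v' \<in> set_pmf \<nu>'. cost (g v') \<le> cost (f v) + L * prog_weight d * T \<and> mem_bounded L (mem (g v')) \<and>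
          Q' v v' (mem (g v')) (out (g v')))" if "v \<in> set_pmf \<nu>" for v
    using d that bspec[OF c(4) that] bspec[OF c(3) that] unfolding runs_def by blast
  then obtain G where G: "\<And>v. v \<in> set_pmf \<nu> \<Longrightarrow> exec d (f v) (map_pmf (G v) \<nu>') \<and>
       (\<forall>v' \<in> set_pmf \<nu>'. cost (G v v') \<le> cost (f v) + L * prog_weight d * T \<and> mem_bounded L (mem (G v v')) \<and>
          Q' v v' (mem (G v v')) (out (G v v')))"
    by metis
  \<comment> \<open>The rule for \<open>Seq\<close> wants a distribution for each intermediate
    state, while \<open>G\<close> is indexed by the random value, and two values may lead to the
    same state. Uniqueness of execution makes the choice by state consistent.\<close>
  define \<mu> where "\<mu> t = (THE \<mu>. exec d t \<mu>)" for t
  have \<mu>: "\<mu> (f v) = map_pmf (G v) \<nu>'" if "v \<in> set_pmf \<nu>" for v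
    unfolding \<mu>_def using G[OF that] exec_unique by blast
  have "exec (Seq c d) s (bind_pmf (map_pmf f \<nu>) \<mu>)"
    by (rule exec.Seq[OF c(1)]) (use G \<mu> in auto)
  also have "bind_pmf (map_pmf f \<nu>) \<mu> = bind_pmf \<nu> (\<lambda>v. map_pmf (G v) \<nu>')"
    unfolding bind_map_pmf by (rule bind_pmf_cong[OF refl]) (simp add: \<mu>)
  also have "\<dots> = map_pmf (\<lambda>(v, v'). G v v') (pair_pmf \<nu> \<nu>')"
    by (simp add: pair_pmf_def map_bind_pmf map_pmf_def bind_assoc_pmf bind_return_pmf)
  finally have ex: "exec (Seq c d) s (map_pmf (\<lambda>(v, v'). G v v') (pair_pmf \<nu> \<nu>'))" .
  have "cost (G v v') \<le> C + L * prog_weight d * T"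
    if "v \<in> set_pmf \<nu>" "v' \<in> set_pmf \<nu>'" for v v'
    using G[OF that(1)] bspec[OF c(2) that(1)] that(2) by fastforce
  then show ?thesis
    using ex G by (intro exI[of _ "\<lambda>(v, v'). G v v'"]) auto
qed

text \<open>The distribution \<open>\<nu>'\<close> is the same for all outcomes \<open>v\<close> of
  the first program; this independence makes the joint distribution a product.\<close>

lemma runs_seq:
  assumes c: "runs L \<nu> c m w T Q"
    and d: "\<And>v m' w'. v \<in> set_pmf \<nu> \<Longrightarrow> Q v m' w' \<Longrightarrow> runs L \<nu>' d m' w' T' (Q' v)"
  shows "runs L (pair_pmf \<nu> \<nu>') (Seq c d) m w (T + T') (\<lambda>(v, v'). Q' v v')"
proof (rule runsI)
  fix s :: ram assume s: "mem s = m" "out s = w" "mem_bounded L m"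
  from runsD[OF c s] obtain f where f: "exec c s (map_pmf f \<nu>)"
     "\<forall>v \<in> set_pmf \<nu>. cost (f v) \<le> cost s + L * prog_weight c * T"
     "\<forall>v \<in> set_pmf \<nu>. mem_bounded L (mem (f v))"
     "\<forall>v \<in> set_pmf \<nu>. Q v (mem (f v)) (out (f v))"
    by (elim exE conjE) (rule that)
  have d': "\<forall>v \<in> set_pmf \<nu>. \<forall>m' w'. Q v m' w' \<longrightarrow> runs L \<nu>' d m' w' T' (Q' v)"
    using d by simp
  from exec_seq_runs[where Q = Q and Q' = Q', OF f d'] obtain g where
    g: "exec (Seq c d) s (map_pmf g (pair_pmf \<nu> \<nu>'))"
     "\<forall>(v, v') \<in> set_pmf (pair_pmf \<nu> \<nu>'). cost (g (v, v')) \<le> cost s + L * prog_weight c * T + L * prog_weight d * T' \<and>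
        mem_bounded L (mem (g (v, v'))) \<and> Q' v v' (mem (g (v, v'))) (out (g (v, v')))" by (elim exE conjE) (rule that)
  have le: "cost s + L * prog_weight c * T + L * prog_weight d * T' \<le> cost s + L * prog_weight (Seq c d) * (T + T')"
    by (simp add: algebra_simps)
  show "\<exists>f. exec (Seq c d) s (map_pmf f (pair_pmf \<nu> \<nu>')) \<and>
       (\<forall>v \<in> set_pmf (pair_pmf \<nu> \<nu>'). cost (f v) \<le> cost s + L * prog_weight (Seq c d) * (T + T') \<and>
          mem_bounded L (mem (f v)) \<and>
          (case v of (v, v') \<Rightarrow> Q' v v') (mem (f v)) (out (f v)))"
  proof (intro exI[of _ g] conjI ballI g(1))
    fix v assume "v \<in> set_pmf (pair_pmf \<nu> \<nu>')"
    moreover obtain a b where v: "v = (a, b)" by (cases v)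
    ultimately have *: "cost (g v) \<le> cost s + L * prog_weight c * T + L * prog_weight d * T'" "mem_bounded L (mem (g v))"
        "Q' a b (mem (g v)) (out (g v))"
      using bspec[OF g(2), of v] by (simp_all only: prod.case)
    show "cost (g v) \<le> cost s + L * prog_weight (Seq c d) * (T + T')" using *(1) le by (rule order_trans)
    show "mem_bounded L (mem (g v))" "(case v of (v, v') \<Rightarrow> Q' v v') (mem (g v)) (out (g v))"
      using * v by simp_all
  qed
qed

lemma runs_seq_det:
  assumes "druns L c m w T Q" "\<And>m' w'. Q m' w' \<Longrightarrow> runs L \<nu> d m' w' T' Q'"
  shows "runs L \<nu> (Seq c d) m w (T + T') Q'"
proof -
  have "runs L (pair_pmf (return_pmf ()) \<nu>) (Seq c d) m w (T + T') (\<lambda>(v, v'). Q' v')"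
    using assms by (intro runs_seq[where Q = "\<lambda>_. Q"]) auto
  then have "runs L (map_pmf (Pair ()) \<nu>) (Seq c d) m w (T + T') (\<lambda>(v, v'). Q' v')"
    by (simp add: pair_return_pmf1)
  from runs_cong_pmf[OF this] show ?thesis by simp
qed

lemma runs_det_seq:
  assumes "runs L \<nu> c m w T Q"
    "\<And>v m' w'. v \<in> set_pmf \<nu> \<Longrightarrow> Q v m' w' \<Longrightarrow> druns L d m' w' T' (Q' v)"
  shows "runs L \<nu> (Seq c d) m w (T + T') Q'"
proof -
  have "runs L (pair_pmf \<nu> (return_pmf ())) (Seq c d) m w (T + T') (\<lambda>(v, v'). Q' v)"
    using assms by (intro runs_seq[where Q = Q]) auto
  then have "runs L (map_pmf (\<lambda>v. (v, ())) \<nu>) (Seq c d) m w (T + T') (\<lambda>(v, v'). Q' v)"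
    by (simp add: pair_return_pmf2)
  from runs_cong_pmf[OF this] show ?thesis by simp
qed

section \<open>Rules for single commands, branching and loops\<close>

abbreviation Reg :: "nat \<Rightarrow> expr" where "Reg v \<equiv> Load (Const (int v))"
abbreviation Assign :: "nat \<Rightarrow> expr \<Rightarrow> prog" where "Assign v e \<equiv> Store (Const (int v)) e"

lemma runs_assign:
  assumes "\<bar>expr_val e m\<bar> < 2 ^ L" "Q (m(v := expr_val e m)) w"
  shows "druns L (Assign v e) m w 1 Q"
  unfolding runs_def
proof (intro allI impI)
  fix s :: ram assume s: "mem s = m" "out s = w" "mem_bounded L m"
  have L: "0 < L" using s by (simp add: mem_bounded_def)
  let ?t = "set_reg (int v) (value_of e s) (charge (Const (int v)) (charge e s))"
  have "bits (expr_val e m) \<le> Suc L" by (rule bits_le[OF assms(1)])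
  moreover have "expr_cost e m \<le> L * expr_weight e" by (rule expr_cost_bound[OF s(3)])
  moreover have "bits (int v) \<le> L * bits (int v)" using L by simp
  moreover have "cost ?t = cost s + (1 + expr_cost e m) + (1 + bits (int v)) + bits (expr_val e m)"
    using s by (simp add: set_reg_def charge_def value_of_def)
  moreover have "L * prog_weight (Assign v e) * 1 = L * 4 + L * bits (int v) + L * expr_weight e"
    by (simp add: algebra_simps)
  ultimately have "cost ?t \<le> cost s + L * prog_weight (Assign v e) * 1"
    using L by linarith
  moreover have "mem_bounded L (mem ?t)"
    using s assms by (auto simp: set_reg_def charge_def value_of_def mem_bounded_def)
  moreover have "Q (mem ?t) (out ?t)"
    using s assms by (simp add: set_reg_def charge_def value_of_def)
  moreover have "exec (Assign v e) s (return_pmf ?t)"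
    using exec.Store[of "Const (int v)" e s] by (simp add: value_of_def)
  ultimately show "\<exists>f. exec (Assign v e) s (map_pmf f (return_pmf ())) \<and>
       (\<forall>v' \<in> set_pmf (return_pmf ()). cost (f v') \<le> cost s + L * prog_weight (Assign v e) * 1 \<and>
         mem_bounded L (mem (f v')) \<and> Q (mem (f v')) (out (f v')))"
    by (intro exI[of _ "\<lambda>_. ?t"]) simp
qed

lemma runs_write:
  assumes "Q m (w @ [expr_val e m])"
  shows "druns L (Write e) m w 1 Q"
  unfolding runs_def
proof (intro allI impI)
  fix s :: ram assume s: "mem s = m" "out s = w" "mem_bounded L m"
  have L: "0 < L" using s by (simp add: mem_bounded_def)
  let ?t = "(charge e s)\<lparr>out := out s @ [value_of e s]\<rparr>"
  have "expr_cost e m \<le> L * expr_weight e" by (rule expr_cost_bound[OF s(3)])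
  then have "cost ?t \<le> cost s + L * prog_weight (Write e) * 1"
    using s L by (simp add: charge_def value_of_def algebra_simps)
  moreover have "mem_bounded L (mem ?t)" "Q (mem ?t) (out ?t)"
    using s assms by (auto simp: charge_def value_of_def)
  ultimately show "\<exists>f. exec (Write e) s (map_pmf f (return_pmf ())) \<and>
       (\<forall>v' \<in> set_pmf (return_pmf ()). cost (f v') \<le> cost s + L * prog_weight (Write e) * 1 \<and>
         mem_bounded L (mem (f v')) \<and> Q (mem (f v')) (out (f v')))"
    using exec.Write[of e s] by (intro exI[of _ "\<lambda>_. ?t"]) simp
qed

lemma runs_toss:
  assumes "\<And>b. Q b (m(v := of_bool b)) w"
  shows "runs L (bernoulli_pmf (1/2)) (Toss (Const (int v))) m w 1 Q"
  unfolding runs_def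
proof (intro allI impI)
  fix s :: ram assume s: "mem s = m" "out s = w" "mem_bounded L m"
  have L: "0 < L" using s by (simp add: mem_bounded_def)
  let ?c = "Toss (Const (int v))"
  define f where "f b = set_reg (int v) (if b then 1 else 0) (charge (Const (int v)) s)" for b
  have f: "cost (f b) \<le> cost s + L * prog_weight ?c * 1 \<and> mem_bounded L (mem (f b)) \<and>
      Q b (mem (f b)) (out (f b))" for b
  proof -
    have "bits (if b then 1 else 0) \<le> Suc 1" by (intro bits_le) auto
    moreover have "bits (int v) \<le> L * bits (int v)" using L by simp
    moreover have "cost (f b) = cost s + (1 + bits (int v)) + bits (if b then 1 else 0)"
      by (simp add: f_def set_reg_def charge_def value_of_def)
    moreover have "L * prog_weight ?c * 1 = L * 3 + L * bits (int v)" by (simp add: algebra_simps)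
    ultimately have "cost (f b) \<le> cost s + L * prog_weight ?c * 1" using L by linarith
    moreover have *: "mem (f b) = m(v := of_bool b)" "out (f b) = w"
      using s by (cases b; simp add: f_def set_reg_def charge_def)+
    moreover have "(1::int) < 2 ^ L" using L by simp
    then have "\<bar>(m(v := of_bool b)) i\<bar> < 2 ^ L" for i
      using s(3) by (cases b) (simp_all add: mem_bounded_def)
    then have "mem_bounded L (mem (f b))" unfolding * mem_bounded_def using L by blast
    ultimately show ?thesis using assms[of b] by simp
  qed
  have "exec ?c s (map_pmf f (bernoulli_pmf (1/2)))"
    using exec.Toss[of "Const (int v)" s] by (simp add: f_def[abs_def] value_of_def)
  with f show "\<exists>f. exec ?c s (map_pmf f (bernoulli_pmf (1/2))) \<and>
       (\<forall>v' \<in> set_pmf (bernoulli_pmf (1/2)). cost (f v') \<le> cost s + L * prog_weight ?c * 1 \<and>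
         mem_bounded L (mem (f v')) \<and> Q v' (mem (f v')) (out (f v')))" by blast
qed

lemma runs_if:
  assumes "expr_val e m > 0 \<Longrightarrow> runs L \<nu> c m w T Q" "expr_val e m \<le> 0 \<Longrightarrow> runs L \<nu> d m w T Q"
  shows "runs L \<nu> (IfPos e c d) m w (Suc T) Q"
  unfolding runs_def
proof (intro allI impI)
  fix s :: ram assume s: "mem s = m" "out s = w" "mem_bounded L m"
  have L: "0 < L" using s by (simp add: mem_bounded_def)
  have ch: "mem (charge e s) = m" "out (charge e s) = w" using s by (auto simp: charge_def)
  have cc: "cost (charge e s) \<le> cost s + L * (1 + expr_weight e)"
    using expr_cost_bound[OF s(3), of e] s L by (simp add: charge_def algebra_simps)
  obtain c' where c': "runs L \<nu> c' m w T Q" "prog_weight c' \<le> prog_weight c + prog_weight d"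
      "\<And>\<mu>. exec c' (charge e s) \<mu> \<Longrightarrow> exec (IfPos e c d) s \<mu>"
  proof (cases "expr_val e m > 0")
    case True
    then have "value_of e s > 0" using s by (simp add: value_of_def)
    show ?thesis
      by (rule that[OF assms(1)[OF True] _ exec.IfTrue[OF \<open>value_of e s > 0\<close>]]) simp_all
  next
    case False
    then have *: "expr_val e m \<le> 0" "value_of e s \<le> 0" using s by (simp_all add: value_of_def)
    show ?thesis
      by (rule that[OF assms(2)[OF *(1)] _ exec.IfFalse[OF *(2)]]) simp_all
  qed
  from runsD[OF c'(1) ch s(3)] obtain f where f: "exec c' (charge e s) (map_pmf f \<nu>)"
     "\<forall>v \<in> set_pmf \<nu>. cost (f v) \<le> cost (charge e s) + L * prog_weight c' * T"
     "\<forall>v \<in> set_pmf \<nu>. mem_bounded L (mem (f v))"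
     "\<forall>v \<in> set_pmf \<nu>. Q v (mem (f v)) (out (f v))"
    by (elim exE conjE) (rule that)
  have "cost (f v) \<le> cost s + L * prog_weight (IfPos e c d) * Suc T" if v: "v \<in> set_pmf \<nu>" for v
  proof -
    have "cost (f v) \<le> cost s + L * (1 + expr_weight e) + L * (prog_weight c + prog_weight d) * T"
      using bspec[OF f(2) v] cc mult_le_mono1[OF mult_le_mono2[OF c'(2), of L], of T] by linarith
    also have "\<dots> \<le> cost s + L * prog_weight (IfPos e c d) * Suc T" by (simp add: algebra_simps)
    finally show ?thesis .
  qed
  then show "\<exists>f. exec (IfPos e c d) s (map_pmf f \<nu>) \<and>
       (\<forall>v \<in> set_pmf \<nu>. cost (f v) \<le> cost s + L * prog_weight (IfPos e c d) * Suc T \<and>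
         mem_bounded L (mem (f v)) \<and> Q v (mem (f v)) (out (f v)))"
    using c'(3)[OF f(1)] f(3,4) by (intro exI[of _ f]) (auto simp del: prog_weight.simps)
qed

lemma runs_while_false:
  assumes "expr_val e m \<le> 0" "Q m w"
  shows "druns L (WhilePos e c) m w 1 Q"
  unfolding runs_def
proof (intro allI impI)
  fix s :: ram assume s: "mem s = m" "out s = w" "mem_bounded L m"
  have L: "0 < L" using s by (simp add: mem_bounded_def)
  have "cost (charge e s) \<le> cost s + L * prog_weight (WhilePos e c) * 1"
    using expr_cost_bound[OF s(3), of e] s L by (simp add: charge_def algebra_simps)
  moreover have "mem (charge e s) = m" "out (charge e s) = w" using s by (auto simp: charge_def)
  moreover have "exec (WhilePos e c) s (return_pmf (charge e s))"
    using assms s by (intro exec.WhileFalse) (simp add: value_of_def)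
  ultimately show "\<exists>f. exec (WhilePos e c) s (map_pmf f (return_pmf ())) \<and>
       (\<forall>v' \<in> set_pmf (return_pmf ()). cost (f v') \<le> cost s + L * prog_weight (WhilePos e c) * 1 \<and>
         mem_bounded L (mem (f v')) \<and> Q (mem (f v')) (out (f v')))"
    using assms s by (intro exI[of _ "\<lambda>_. charge e s"]) simp
qed

lemma runs_while_true:
  assumes "expr_val e m > 0" and c: "runs L \<nu> c m w T Q"
    and d: "\<And>v m' w'. v \<in> set_pmf \<nu> \<Longrightarrow> Q v m' w' \<Longrightarrow> runs L \<nu>' (WhilePos e c) m' w' T' (Q' v)"
  shows "runs L (pair_pmf \<nu> \<nu>') (WhilePos e c) m w (Suc (T + T')) (\<lambda>(v, v'). Q' v v')"
  unfolding runs_def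
proof (intro allI impI)
  fix s :: ram assume s: "mem s = m" "out s = w" "mem_bounded L m"
  have L: "0 < L" using s by (simp add: mem_bounded_def)
  have ch: "mem (charge e s) = m" "out (charge e s) = w" using s by (auto simp: charge_def)
  have cc: "cost (charge e s) \<le> cost s + L * (1 + expr_weight e)"
    using expr_cost_bound[OF s(3), of e] s L by (simp add: charge_def algebra_simps)
  from runsD[OF c ch s(3)] obtain f where f: "exec c (charge e s) (map_pmf f \<nu>)"
     "\<forall>v \<in> set_pmf \<nu>. cost (f v) \<le> cost (charge e s) + L * prog_weight c * T"
     "\<forall>v \<in> set_pmf \<nu>. mem_bounded L (mem (f v))"
     "\<forall>v \<in> set_pmf \<nu>. Q v (mem (f v)) (out (f v))"
    by (elim exE conjE) (rule that)
  let ?d = "WhilePos e c" and ?C = "cost (charge e s) + L * prog_weight c * T"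
  have d': "\<forall>v \<in> set_pmf \<nu>. \<forall>m' w'. Q v m' w' \<longrightarrow> runs L \<nu>' ?d m' w' T' (Q' v)"
    using d by simp
  from exec_seq_runs[where Q = Q and Q' = Q', OF f d'] obtain g where
    g: "exec (Seq c ?d) (charge e s) (map_pmf g (pair_pmf \<nu> \<nu>'))"
     "\<forall>(v, v') \<in> set_pmf (pair_pmf \<nu> \<nu>'). cost (g (v, v')) \<le> ?C + L * prog_weight ?d * T' \<and>
        mem_bounded L (mem (g (v, v'))) \<and> Q' v v' (mem (g (v, v'))) (out (g (v, v')))" by (elim exE conjE) (rule that)
  have ex: "exec ?d s (map_pmf g (pair_pmf \<nu> \<nu>'))"
    using assms(1) s g(1) by (intro exec.WhileTrue) (auto simp: value_of_def)
  have "?C + L * prog_weight ?d * T' \<le> cost s + L * (1 + expr_weight e) + L * prog_weight c * T + L * prog_weight ?d * T'"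
    using cc by simp
  also have "\<dots> \<le> cost s + L * prog_weight ?d * Suc (T + T')" by (simp add: algebra_simps)
  finally have le: "?C + L * prog_weight ?d * T' \<le> cost s + L * prog_weight ?d * Suc (T + T')" .
  show "\<exists>f. exec ?d s (map_pmf f (pair_pmf \<nu> \<nu>')) \<and>
       (\<forall>v \<in> set_pmf (pair_pmf \<nu> \<nu>'). cost (f v) \<le> cost s + L * prog_weight ?d * Suc (T + T') \<and>
          mem_bounded L (mem (f v)) \<and>
          (case v of (v, v') \<Rightarrow> Q' v v') (mem (f v)) (out (f v)))"
  proof (intro exI[of _ g] conjI ballI ex)
    fix v assume "v \<in> set_pmf (pair_pmf \<nu> \<nu>')"
    moreover obtain a b where v: "v = (a, b)" by (cases v)
    ultimately have *: "cost (g v) \<le> ?C + L * prog_weight ?d * T'" "mem_bounded L (mem (g v))"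
        "Q' a b (mem (g v)) (out (g v))"
      using bspec[OF g(2), of v] by (simp_all only: prod.case)
    show "cost (g v) \<le> cost s + L * prog_weight ?d * Suc (T + T')" using *(1) le by (rule order_trans)
    show "mem_bounded L (mem (g v))" "(case v of (v, v') \<Rightarrow> Q' v v') (mem (g v)) (out (g v))"
      using * v by simp_all
  qed
qed

text \<open>Induction on the measure \<open>f\<close>, which also counts the iterations. Meant for
  coin-free searches whose number of rounds is not known beforehand.\<close>

lemma runs_while:
  fixes f :: "(nat \<Rightarrow> int) \<Rightarrow> nat"
  assumes "I m w"
    and "\<And>m w. I m w \<Longrightarrow> expr_val e m > 0 \<Longrightarrow> druns L c m w T (\<lambda>m' w'. I m' w' \<and> f m' < f m)"
  shows "druns L (WhilePos e c) m w (f m * Suc T + 1) (\<lambda>m' w'. I m' w' \<and> expr_val e m' \<le> 0)"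
  using assms(1)
proof (induction "f m" arbitrary: m w rule: less_induct)
  case less
  show ?case
  proof (rule runs_assume_bounded, cases "expr_val e m > 0")
    case True
    assume bd: "mem_bounded L m"
    have "runs L (pair_pmf (return_pmf ()) (return_pmf ())) (WhilePos e c) m w
       (Suc (T + ((f m - 1) * Suc T + 1))) (\<lambda>(v, v'). \<lambda>m' w'. I m' w' \<and> expr_val e m' \<le> 0)"
    proof (rule runs_while_true[OF True assms(2)[OF less.prems True]], elim conjE)
      fix m' w' assume *: "I m' w'" "f m' < f m"
      show "druns L (WhilePos e c) m' w' ((f m - 1) * Suc T + 1) (\<lambda>m' w'. I m' w' \<and> expr_val e m' \<le> 0)"
        by (rule runs_weaken[OF less.hyps[OF *(2,1)]])
          (use * in \<open>auto intro!: add_mono mult_right_mono simp del: mult_Suc_right\<close>)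
    qed
    then have r: "runs L (map_pmf (\<lambda>_. ((), ())) (return_pmf ())) (WhilePos e c) m w
       (Suc (T + ((f m - 1) * Suc T + 1))) (\<lambda>(v, v'). \<lambda>m' w'. I m' w' \<and> expr_val e m' \<le> 0)"
      by (simp add: pair_return_pmf1)
    \<comment> \<open>Some memory attains the postcondition of the body and has a measure below
      \<open>f m\<close>, so a unit of the measure is left to pay for this round.\<close>
    have "f m > 0" using runs_post[OF assms(2)[OF less.prems True] bd] by auto
    then have "Suc (T + ((f m - 1) * Suc T + 1)) \<le> f m * Suc T + 1" by (cases "f m") auto
    then show ?thesis by (rule runs_weaken[OF runs_cong_pmf[OF r]]) auto
  next
    case False
    then show ?thesis using less.prems
      by (intro runs_weaken[OF runs_while_false[where Q = "\<lambda>m' w'. I m' w' \<and> expr_val e m' \<le> 0"]]) auto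
  qed
qed

definition For :: "nat \<Rightarrow> expr \<Rightarrow> prog \<Rightarrow> prog" where
  "For v e c = Seq (Assign v (Const 0))
     (WhilePos (Op Less (Reg v) e) (Seq c (Assign v (Op Add (Reg v) (Const 1)))))"

text \<open>The invariant sees the list of values drawn so far, so that the coins of all rounds
  appear as one list from \<open>replicate_pmf n \<nu>\<close>. The body keeps the counter and the
  increment comes after it, hence the update of \<open>v\<close> inside the premise.\<close>

lemma runs_for:
  fixes I :: "nat \<Rightarrow> 'v list \<Rightarrow> (nat \<Rightarrow> int) \<Rightarrow> int list \<Rightarrow> bool"
  assumes init: "I 0 [] (m(v := 0)) w"
    and idx: "\<And>j vs m w. I j vs m w \<Longrightarrow> m v = int j \<and> expr_val e m = int n"
    and body: "\<And>j vs m w. j < n \<Longrightarrow> length vs = j \<Longrightarrow> I j vs m w \<Longrightarrow>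
       runs L \<nu> c m w T (\<lambda>x m' w'. m' v = int j \<and> I (Suc j) (vs @ [x]) (m'(v := int (Suc j))) w')"
    and n: "int n < 2 ^ L"
  shows "runs L (replicate_pmf n \<nu>) (For v e c) m w (n * (T + 2) + 2) (\<lambda>vs m' w'. I n vs m' w')"
proof -
  let ?W = "WhilePos (Op Less (Reg v) e) (Seq c (Assign v (Op Add (Reg v) (Const 1))))"
  \<comment> \<open>Generalised to a prefix \<open>vs\<close> and \<open>d\<close> remaining rounds,
    because \<open>replicate_pmf\<close> splits off the first draw, not the last.\<close>
  have loop: "runs L (replicate_pmf d \<nu>) ?W m w (d * (T + 2) + 1) (\<lambda>xs m' w'. I n (vs @ xs) m' w')"
    if "I j vs m w" "length vs = j" "j + d = n" for d j vs m w
    using that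
  proof (induction d arbitrary: j vs m w)
    case 0
    have "runs L (map_pmf (\<lambda>_. []) (return_pmf ())) ?W m w 1 (\<lambda>xs m' w'. I n (vs @ xs) m' w')"
      by (rule runs_map_inj[OF runs_while_false]) (use 0 idx[OF 0(1)] in auto)
    then show ?case by simp
  next
    case (Suc d)
    have j: "j < n" using Suc.prems by simp
    then have j': "1 + int j < 2 ^ L" using n by linarith
    have "runs L (pair_pmf \<nu> (replicate_pmf d \<nu>)) ?W m w (Suc ((T + 1) + (d * (T + 2) + 1)))
       (\<lambda>(x, xs). \<lambda>m' w'. I n (vs @ x # xs) m' w')"
    proof (rule runs_while_true)
      show "runs L \<nu> (Seq c (Assign v (Op Add (Reg v) (Const 1)))) m w (T + 1)
         (\<lambda>x m' w'. I (Suc j) (vs @ [x]) m' w')"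
        by (rule runs_det_seq[OF body[OF j Suc.prems(2,1)] runs_assign])
          (use j' in \<open>auto simp: algebra_simps\<close>)
      show "runs L (replicate_pmf d \<nu>) ?W m' w' (d * (T + 2) + 1) (\<lambda>xs m' w'. I n (vs @ x # xs) m' w')"
        if "I (Suc j) (vs @ [x]) m' w'" for x m' w'
        using Suc.IH[OF that] Suc.prems by simp
    qed (use idx[OF Suc.prems(1)] j in auto)
    moreover have "(\<lambda>(x, xs). \<lambda>m' w'. I n (vs @ x # xs) m' w')
        = (\<lambda>p. (\<lambda>xs m' w'. I n (vs @ xs) m' w') ((\<lambda>(x, xs). x # xs) p))" by auto
    ultimately have "runs L (pair_pmf \<nu> (replicate_pmf d \<nu>)) ?W m w (Suc d * (T + 2) + 1)
       (\<lambda>p. (\<lambda>xs m' w'. I n (vs @ xs) m' w') ((\<lambda>(x, xs). x # xs) p))"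
      by (simp add: algebra_simps)
    then have "runs L (map_pmf (\<lambda>(x, xs). x # xs) (pair_pmf \<nu> (replicate_pmf d \<nu>))) ?W m w (Suc d * (T + 2) + 1)
       (\<lambda>xs m' w'. I n (vs @ xs) m' w')"
      by (rule runs_map_inj) (auto simp: inj_on_def)
    then show ?case
      by (simp add: pair_pmf_def map_bind_pmf map_pmf_def bind_assoc_pmf bind_return_pmf)
  qed
  have "runs L (replicate_pmf n \<nu>) (For v e c) m w (1 + (n * (T + 2) + 1)) (\<lambda>vs m' w'. I n vs m' w')"
    unfolding For_def
  proof (rule runs_seq_det[OF runs_assign])
    show "runs L (replicate_pmf n \<nu>) ?W m' w' (n * (T + 2) + 1) (\<lambda>vs m' w'. I n vs m' w')"
      if "m' = m(v := 0) \<and> w' = w" for m' w'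
      using loop[of 0 "[]" "m(v := 0)" w n] init that by simp
  qed auto
  then show ?thesis by simp
qed

lemma runs_for_det:
  fixes I :: "nat \<Rightarrow> (nat \<Rightarrow> int) \<Rightarrow> int list \<Rightarrow> bool"
  assumes init: "I 0 (m(v := 0)) w"
    and idx: "\<And>j m w. I j m w \<Longrightarrow> m v = int j \<and> expr_val e m = int n"
    and body: "\<And>j m w. j < n \<Longrightarrow> I j m w \<Longrightarrow>
       druns L c m w T (\<lambda>m' w'. m' v = int j \<and> I (Suc j) (m'(v := int (Suc j))) w')"
    and n: "int n < 2 ^ L"
  shows "druns L (For v e c) m w (n * (T + 2) + 2) (I n)"
proof -
  have "replicate_pmf n (return_pmf ()) = map_pmf (\<lambda>_. replicate n ()) (return_pmf ())"
    by (induction n) (simp_all add: bind_return_pmf)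
  moreover have "runs L (replicate_pmf n (return_pmf ())) (For v e c) m w (n * (T + 2) + 2) (\<lambda>_. I n)"
    by (rule runs_for[where I = "\<lambda>j vs. I j"]) (fact init idx | rule body n | assumption)+
  ultimately have "runs L (map_pmf (\<lambda>_. replicate n ()) (return_pmf ())) (For v e c) m w
     (n * (T + 2) + 2) (\<lambda>_. I n)" by (simp only:)
  from runs_cong_pmf[OF this] show ?thesis .
qed

text \<open>A frame condition. Registers are numbered by nesting, with parameters lowest and scratch
  highest, so one threshold says what a program part preserves.\<close>

definition agree :: "nat \<Rightarrow> (nat \<Rightarrow> int) \<Rightarrow> (nat \<Rightarrow> int) \<Rightarrow> bool" where
  "agree a m m' \<longleftrightarrow> (\<forall>i<a. m' i = m i)"

lemma agree_refl [simp]: "agree a m m"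
  and agree_trans: "agree a m m' \<Longrightarrow> agree a m' m'' \<Longrightarrow> agree a m m''"
  and agree_upd: "a \<le> v \<Longrightarrow> agree a m (m'(v := x)) \<longleftrightarrow> agree a m m'"
  and agreeD: "agree a m m' \<Longrightarrow> i < a \<Longrightarrow> m' i = m i"
  by (auto simp: agree_def)

text \<open>
  Register allocation: 0 to 3 and 5 to 9 hold \<open>r, k, h, q\<close> and \<open>B, n, k + r, k + r + n, P\<close>, register 4 the
  trial divisor, 10 and 11 are outer and inner loop counters, 12 and 13 hold a partial sum and the
  remaining digits of \<open>P\<close> (or the range for drawing \<open>P\<close>). \<open>PowProg\<close> and \<open>Sample\<close> overwrite only
  registers from 14 on.
\<close>

definition PowProg :: "expr \<Rightarrow> expr \<Rightarrow> prog" where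
  "PowProg a e = Seq (Assign 15 (Const 1)) (For 16 e (Assign 15 (Op Mul (Reg 15) a)))"

lemma runs_pow:
  assumes ae: "\<And>m'. agree 15 m m' \<Longrightarrow> expr_val a m' = int x \<and> expr_val e m' = int y"
    and bd: "int x ^ y < 2 ^ L" "int y < 2 ^ L"
  shows "druns L (PowProg a e) m w (3 * y + 3) (\<lambda>m' w'. agree 15 m m' \<and> m' 15 = int x ^ y \<and> w' = w)"
proof (rule runs_assume_bounded)
  assume "mem_bounded L m"
  then have L: "(1::int) < 2 ^ L" by (simp add: mem_bounded_def)
  have pw: "int x ^ j < 2 ^ L" if "j \<le> y" for j
  proof (cases "x = 0")
    case True
    then show ?thesis using L by (cases j) auto
  next
    case False
    then have "int x ^ j \<le> int x ^ y" using that by (intro power_increasing) auto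
    then show ?thesis using bd by simp
  qed
  have "druns L (PowProg a e) m w (1 + (y * (1 + 2) + 2)) (\<lambda>m' w'. agree 15 m m' \<and> m' 15 = int x ^ y \<and> w' = w)"
    unfolding PowProg_def
  proof (rule runs_seq_det[OF runs_assign[where Q = "\<lambda>m' w'. m' = m(15 := 1) \<and> w' = w"]])
    fix m' w' assume m': "m' = m(15 := 1) \<and> w' = w"
    let ?I = "\<lambda>j m' w'. agree 15 m m' \<and> m' 16 = int j \<and> m' 15 = int x ^ j \<and> w' = w"
    have "druns L (For 16 e (Assign 15 (Op Mul (Reg 15) a))) m' w' (y * (1 + 2) + 2) (?I y)"
    proof (rule runs_for_det)
      show "druns L (Assign 15 (Op Mul (Reg 15) a)) m w 1
          (\<lambda>m' w'. m' 16 = int j \<and> ?I (Suc j) (m'(16 := int (Suc j))) w')"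
        if "j < y" "?I j m w" for j m w
        using that pw[of "Suc j"] ae[of m] by (intro runs_assign) (auto simp: agree_upd mult.commute)
    qed (use m' ae bd in \<open>auto simp: agree_def\<close>)
    then show "druns L (For 16 e (Assign 15 (Op Mul (Reg 15) a))) m' w' (y * (1 + 2) + 2)
        (\<lambda>m' w'. agree 15 m m' \<and> m' 15 = int x ^ y \<and> w' = w)"
      by (rule runs_weaken) auto
  qed (use L in auto)
  then show ?thesis by (rule runs_weaken) auto
qed

text \<open>One toss per doubling of the range, most significant bit first. As the range is a power
  of two, no draw is ever rejected: the loop ends for every sequence of tosses and the value is
  exactly uniform.\<close>

definition Sample :: "nat \<Rightarrow> prog" where
  "Sample l = Seq (Assign 14 (Const 0)) (Seq (Assign 15 (Const 1))
     (WhilePos (Op Less (Reg 15) (Reg l))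
       (Seq (Toss (Const (int 16)))
         (Seq (Assign 14 (Op Add (Op Mul (Const 2) (Reg 14)) (Reg 16)))
           (Assign 15 (Op Mul (Const 2) (Reg 15)))))))"

lemma pair_pmf_of_set:
  assumes "finite A" "A \<noteq> {}" "finite B" "B \<noteq> {}"
  shows "pair_pmf (pmf_of_set A) (pmf_of_set B) = pmf_of_set (A \<times> B)"
proof (rule pmf_eqI)
  fix p :: "'a \<times> 'b"
  obtain a b where "p = (a, b)" by (cases p)
  then show "pmf (pair_pmf (pmf_of_set A) (pmf_of_set B)) p = pmf (pmf_of_set (A \<times> B)) p"
    using assms by (simp add: pmf_pair card_cartesian_product indicator_def)
qed

lemma uniform_bit_decomposition:
  "map_pmf (\<lambda>(b, y). of_bool b * 2 ^ d + y) (pair_pmf (bernoulli_pmf (1/2)) (pmf_of_set {0..<2 ^ d}))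
    = pmf_of_set {0..<(2::int) ^ Suc d}"
proof -
  let ?g = "\<lambda>(b, y). of_bool b * 2 ^ d + y :: int"
  have inj: "inj_on ?g (UNIV \<times> {0..<2 ^ d})"
    by (auto simp: inj_on_def of_bool_def split: if_splits)
  have img: "?g ` (UNIV \<times> {0..<2 ^ d}) = {0..<(2::int) ^ Suc d}"
  proof
    show "?g ` (UNIV \<times> {0..<2 ^ d}) \<subseteq> {0..<(2::int) ^ Suc d}" by (auto simp: of_bool_def)
    show "{0..<(2::int) ^ Suc d} \<subseteq> ?g ` (UNIV \<times> {0..<2 ^ d})"
    proof
      fix z :: int assume "z \<in> {0..<2 ^ Suc d}"
      then show "z \<in> ?g ` (UNIV \<times> {0..<2 ^ d})"
        by (intro image_eqI[of _ _ "(2 ^ d \<le> z, if 2 ^ d \<le> z then z - 2 ^ d else z)"]) auto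
    qed
  qed
  have "pair_pmf (bernoulli_pmf (1/2)) (pmf_of_set {0..<(2::int) ^ d}) = pmf_of_set (UNIV \<times> {0..<2 ^ d})"
    unfolding bernoulli_pmf_half_conv_pmf_of_set by (rule pair_pmf_of_set) auto
  then show ?thesis using map_pmf_of_set_inj[OF inj] img by simp
qed

lemma runs_sample:
  assumes l: "l < 14" "m l = 2 ^ t" "t < L"
  shows "runs L (pmf_of_set {0..<2 ^ t}) (Sample l) m w (4 * t + 3)
    (\<lambda>x m' w'. agree 14 m m' \<and> m' 14 = x \<and> w' = w)"
proof -
  let ?B = "Seq (Toss (Const (int 16)))
         (Seq (Assign 14 (Op Add (Op Mul (Const 2) (Reg 14)) (Reg 16)))
           (Assign 15 (Op Mul (Const 2) (Reg 15))))"
  let ?W = "WhilePos (Op Less (Reg 15) (Reg l)) ?B"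
  have pow2: "(2::int) ^ e < 2 ^ L" if "e \<le> t" for e
    using that l by (intro power_strict_increasing) auto
  \<comment> \<open>With the leading \<open>e\<close> bits fixed to \<open>x\<close>, the
    \<open>d\<close> outstanding bits add a uniform number below \<open>2 ^ d\<close> to
    \<open>x * 2 ^ d\<close>.\<close>
  have loop: "runs L (pmf_of_set {0..<2 ^ d}) ?W m' w (4 * d + 1)
      (\<lambda>y m'' w'. agree 14 m m'' \<and> m'' 14 = x * 2 ^ d + y \<and> w' = w)"
    if "agree 14 m m'" "m' 14 = x" "m' 15 = 2 ^ e" "0 \<le> x" "x < 2 ^ e" "e + d = t" for d e x m'
    using that
  proof (induction d arbitrary: e x m')
    case 0
    have "{0..<(2::int) ^ 0} = {0}" by auto
    then have eq: "pmf_of_set {0..<(2::int) ^ 0} = map_pmf (\<lambda>_. 0) (return_pmf ())"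
      by (simp add: pmf_of_set_singleton)
    show ?case unfolding eq
      by (rule runs_weaken[OF runs_map_inj[where Q = "\<lambda>y m'' w'. m'' = m' \<and> w' = w \<and> y = 0", OF runs_while_false]])
        (use 0 l agreeD[OF 0(1) l(1)] in auto)
  next
    case (Suc d)
    have "runs L (pair_pmf (bernoulli_pmf (1/2)) (pmf_of_set {0..<2 ^ d})) ?W m' w (Suc ((1 + (1 + 1)) + (4 * d + 1)))
      (\<lambda>(b, y) m'' w'. agree 14 m m'' \<and> m'' 14 = (2 * x + of_bool b) * 2 ^ d + y \<and> w' = w)"
    proof (rule runs_while_true)
      have "(2::int) ^ e < 2 ^ t" using Suc.prems by (intro power_strict_increasing) auto
      then show "0 < expr_val (Op Less (Reg 15) (Reg l)) m'"
        using Suc.prems l agreeD[OF Suc.prems(1) l(1)] by simp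
      have bd: "\<bar>2 * x + of_bool b\<bar> < 2 ^ L" "(2::int) * 2 ^ e < 2 ^ L" for b
        using pow2[of "Suc e"] Suc.prems by auto
      show "runs L (bernoulli_pmf (1/2)) ?B m' w (1 + (1 + 1)) (\<lambda>b m'' w'. agree 14 m m'' \<and>
           m'' 14 = 2 * x + of_bool b \<and> m'' 15 = 2 ^ Suc e \<and> w' = w)"
      proof (rule runs_det_seq[OF runs_toss[where Q = "\<lambda>b m'' w'. m'' = m'(16 := of_bool b) \<and> w' = w"]], simp)
        fix b m1 w1 assume m1: "m1 = m'(16 := of_bool b) \<and> w1 = w"
        show "druns L (Seq (Assign 14 (Op Add (Op Mul (Const 2) (Reg 14)) (Reg 16)))
             (Assign 15 (Op Mul (Const 2) (Reg 15)))) m1 w1 (1 + 1) (\<lambda>m'' w'. agree 14 m m'' \<and>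
           m'' 14 = 2 * x + of_bool b \<and> m'' 15 = 2 ^ Suc e \<and> w' = w)"
        proof (rule runs_seq_det[OF runs_assign[where Q = "\<lambda>m'' w'. m'' = m1(14 := 2 * x + of_bool b) \<and> w' = w"]])
          fix m2 w2 assume "m2 = m1(14 := 2 * x + of_bool b) \<and> w2 = w"
          then show "druns L (Assign 15 (Op Mul (Const 2) (Reg 15))) m2 w2 1 (\<lambda>m'' w'. agree 14 m m'' \<and>
           m'' 14 = 2 * x + of_bool b \<and> m'' 15 = 2 ^ Suc e \<and> w' = w)"
            using m1 Suc.prems bd by (intro runs_assign) (auto simp: agree_upd)
        qed (use m1 Suc.prems bd in auto)
      qed
      fix b m2 w2 assume m2: "agree 14 m m2 \<and>
           m2 14 = 2 * x + of_bool b \<and> m2 15 = 2 ^ Suc e \<and> w2 = w"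
      then show "runs L (pmf_of_set {0..<2 ^ d}) ?W m2 w2 (4 * d + 1)
         (\<lambda>y m'' w'. agree 14 m m'' \<and> m'' 14 = (2 * x + of_bool b) * 2 ^ d + y \<and> w' = w)"
        using Suc.IH[of m2 "2 * x + of_bool b" "Suc e"] Suc.prems by (cases b) auto
    qed
    then have "runs L (pair_pmf (bernoulli_pmf (1/2)) (pmf_of_set {0..<2 ^ d})) ?W m' w (4 * Suc d + 1)
      (\<lambda>p. (\<lambda>y m'' w'. agree 14 m m'' \<and> m'' 14 = x * 2 ^ Suc d + y \<and> w' = w) ((\<lambda>(b, y). of_bool b * 2 ^ d + y) p))"
      by (rule runs_weaken) (auto simp: algebra_simps)
    then have "runs L (map_pmf (\<lambda>(b, y). of_bool b * 2 ^ d + y)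
         (pair_pmf (bernoulli_pmf (1/2)) (pmf_of_set {0..<2 ^ d}))) ?W m' w (4 * Suc d + 1)
      (\<lambda>y m'' w'. agree 14 m m'' \<and> m'' 14 = x * 2 ^ Suc d + y \<and> w' = w)"
      by (rule runs_map_inj) (auto simp: inj_on_def of_bool_def split: if_splits)
    then show ?case by (simp only: uniform_bit_decomposition)
  qed
  have L: "(1::int) < 2 ^ L" using pow2[of 0] by simp
  have "runs L (pmf_of_set {0..<2 ^ t}) (Sample l) m w (1 + (1 + (4 * t + 1)))
    (\<lambda>x m' w'. agree 14 m m' \<and> m' 14 = 0 * 2 ^ t + x \<and> w' = w)"
    unfolding Sample_def
  proof (rule runs_seq_det[OF runs_assign[where Q = "\<lambda>m' w'. m' = m(14 := 0) \<and> w' = w"]])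
    fix m1 w1 assume m1: "m1 = m(14 := 0) \<and> w1 = w"
    show "runs L (pmf_of_set {0..<2 ^ t}) (Seq (Assign 15 (Const 1)) ?W) m1 w1 (1 + (4 * t + 1))
       (\<lambda>x m' w'. agree 14 m m' \<and> m' 14 = 0 * 2 ^ t + x \<and> w' = w)"
    proof (rule runs_seq_det[OF runs_assign[where Q = "\<lambda>m' w'. m' = m1(15 := 1) \<and> w' = w"]])
      fix m2 w2 assume m2: "m2 = m1(15 := 1) \<and> w2 = w"
      then show "runs L (pmf_of_set {0..<2 ^ t}) ?W m2 w2 (4 * t + 1)
         (\<lambda>x m' w'. agree 14 m m' \<and> m' 14 = 0 * 2 ^ t + x \<and> w' = w)"
        using loop[of m2 0 0 t] m1 by (auto simp: agree_upd)
    qed (use m1 L in auto)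
  qed (use L in auto)
  then show ?thesis by (rule runs_weaken) auto
qed

text \<open>Equality as a 0/1 value built from the strict comparison, so that a row is written
  without branching.\<close>

definition EqInd :: "expr \<Rightarrow> expr \<Rightarrow> expr" where
  "EqInd a b = Op Mul (Op Sub (Const 1) (Op Less a b)) (Op Sub (Const 1) (Op Less b a))"

lemma EqInd_val: "expr_val (EqInd a b) m = of_bool (expr_val a m = expr_val b m)"
  by (simp add: EqInd_def)

definition UnitRow :: "expr \<Rightarrow> expr \<Rightarrow> expr \<Rightarrow> prog" where
  "UnitRow len pos val = For 11 len (Write (Op Mul val (EqInd (Reg 11) pos)))"

lemma runs_unit_row:
  assumes ae: "\<And>m'. agree 11 m m' \<Longrightarrow>
      expr_val len m' = int n \<and> expr_val pos m' = int i \<and> expr_val val m' = x"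
    and n: "int n < 2 ^ L"
  shows "druns L (UnitRow len pos val) m w (3 * n + 2)
    (\<lambda>m' w'. agree 11 m m' \<and> w' = w @ map (\<lambda>j. if i = j then x else 0) [0..<n])"
proof -
  let ?I = "\<lambda>k m' w'. agree 11 m m' \<and> m' 11 = int k \<and> w' = w @ map (\<lambda>j. if i = j then x else 0) [0..<k]"
  have "druns L (UnitRow len pos val) m w (n * (1 + 2) + 2) (?I n)"
    unfolding UnitRow_def
  proof (rule runs_for_det)
    show "druns L (Write (Op Mul val (EqInd (Reg 11) pos))) m w 1
          (\<lambda>m' w'. m' 11 = int j \<and> ?I (Suc j) (m'(11 := int (Suc j))) w')"
        if "j < n" "?I j m w" for j m w
      using that ae[of m] by (intro runs_write) (auto simp: agree_upd EqInd_val)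
  qed (use ae n in \<open>auto simp: agree_def\<close>)
  then show ?thesis by (rule runs_weaken) auto
qed

lemma runs_assign_seq:
  assumes "\<bar>expr_val e m\<bar> < 2 ^ L" "runs L \<nu> d (m(v := expr_val e m)) w T Q"
  shows "runs L \<nu> (Seq (Assign v e) d) m w (Suc T) Q"
proof -
  have "runs L \<nu> (Seq (Assign v e) d) m w (1 + T) Q"
    by (rule runs_seq_det[OF runs_assign[where Q = "\<lambda>m' w'. m' = m(v := expr_val e m) \<and> w' = w"]])
      (use assms in auto)
  then show ?thesis by simp
qed

lemma runs_write_seq:
  assumes "runs L \<nu> d m (w @ [expr_val e m]) T Q"
  shows "runs L \<nu> (Seq (Write e) d) m w (Suc T) Q"
proof -
  have "runs L \<nu> (Seq (Write e) d) m w (1 + T) Q"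
    by (rule runs_seq_det[OF runs_write[where Q = "\<lambda>m' w'. m' = m \<and> w' = w @ [expr_val e m]"]])
      (use assms in auto)
  then show ?thesis by simp
qed

text \<open>For an exponent that is a fixed number of the program, namely \<open>b + 1\<close>; the
  power unrolls into an expression of constant size, in contrast to \<open>PowProg\<close>, whose
  exponent is read from the memory.\<close>

primrec PowExpr :: "expr \<Rightarrow> nat \<Rightarrow> expr" where
  "PowExpr e 0 = Const 1"
| "PowExpr e (Suc n) = Op Mul e (PowExpr e n)"

lemma PowExpr_val: "expr_val (PowExpr e n) m = expr_val e m ^ n"
  by (induction n) auto

section \<open>The program\<close>

text \<open>Trial division up to the candidate itself, about quadratic in the prime. That is
  affordable because the prime is polynomial in a number given in unary.\<close>

definition PrimeSearch :: prog where
  "PrimeSearch = WhilePos (Op Less (Reg 4) (Reg 3))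
     (IfPos (Op Less (Op Mod (Reg 3) (Reg 4)) (Const 1))
       (Seq (Assign 3 (Op Add (Reg 3) (Const 1))) (Assign 4 (Const 2)))
       (Assign 4 (Op Add (Reg 4) (Const 1))))"

definition BlockSearch :: prog where
  "BlockSearch = WhilePos (Op Less (Op Mul (Op Mul (Const 2) (Reg 2)) (Reg 5)) (Op Add (Reg 3) (Const 1)))
     (Assign 5 (Op Mul (Const 2) (Reg 5)))"

definition unit_row :: "nat \<Rightarrow> nat \<Rightarrow> int \<Rightarrow> int list" where
  "unit_row n i x = map (\<lambda>j. if i = j then x else 0) [0..<n]"

lemma runs_for_rows:
  fixes row :: "nat \<Rightarrow> 'v \<Rightarrow> int list"
  assumes e: "\<And>m'. agree v m m' \<Longrightarrow> expr_val e m' = int n"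
    and body: "\<And>i m' w'. i < n \<Longrightarrow> agree v m m' \<Longrightarrow> m' v = int i \<Longrightarrow>
      runs L \<nu> c m' w' T (\<lambda>x m'' w''. agree (Suc v) m' m'' \<and> w'' = w' @ row i x)"
    and n: "int n < 2 ^ L"
  shows "runs L (replicate_pmf n \<nu>) (For v e c) m w (n * (T + 2) + 2)
    (\<lambda>xs m' w'. agree v m m' \<and> w' = w @ concat (map (\<lambda>i. row i (xs ! i)) [0..<n]))"
proof -
  let ?I = "\<lambda>j xs m' w'. agree v m m' \<and> m' v = int j \<and> length xs = j \<and>
     w' = w @ concat (map (\<lambda>i. row i (xs ! i)) [0..<j])"
  have "runs L (replicate_pmf n \<nu>) (For v e c) m w (n * (T + 2) + 2) (\<lambda>xs m' w'. ?I n xs m' w')"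
  proof (rule runs_for[where I = ?I])
    fix j xs m1 w1 assume j: "j < n" and I: "?I j xs m1 w1"
    have "concat (map (\<lambda>i. row i ((xs @ [x]) ! i)) [0..<j]) = concat (map (\<lambda>i. row i (xs ! i)) [0..<j])" for x
      using I by (intro arg_cong[of _ _ concat] map_cong) (auto simp: nth_append)
    then show "runs L \<nu> c m1 w1 T (\<lambda>x m' w'. m' v = int j \<and> ?I (Suc j) (xs @ [x]) (m'(v := int (Suc j))) w')"
      using I by (intro runs_weaken[OF body[OF j, of m1 w1]]) (auto simp: agree_def nth_append)
  qed (use e n in \<open>auto simp: agree_def\<close>)
  then show ?thesis by (rule runs_weaken) auto
qed

lemma druns_for_rows:
  fixes row :: "nat \<Rightarrow> int list"
  assumes e: "\<And>m'. agree v m m' \<Longrightarrow> expr_val e m' = int n"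
    and body: "\<And>i m' w'. i < n \<Longrightarrow> agree v m m' \<Longrightarrow> m' v = int i \<Longrightarrow>
      druns L c m' w' T (\<lambda>m'' w''. agree (Suc v) m' m'' \<and> w'' = w' @ row i)"
    and n: "int n < 2 ^ L"
  shows "druns L (For v e c) m w (n * (T + 2) + 2)
    (\<lambda>m' w'. agree v m m' \<and> w' = w @ concat (map row [0..<n]))"
proof -
  let ?I = "\<lambda>j m' w'. agree v m m' \<and> m' v = int j \<and> w' = w @ concat (map row [0..<j])"
  have "druns L (For v e c) m w (n * (T + 2) + 2) (?I n)"
  proof (rule runs_for_det[where I = ?I])
    fix j m1 w1 assume j: "j < n" and I: "?I j m1 w1"
    then show "druns L c m1 w1 T (\<lambda>m' w'. m' v = int j \<and> ?I (Suc j) (m'(v := int (Suc j))) w')"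
      by (intro runs_weaken[OF body[OF j, of m1 w1]]) (auto simp: agree_def)
  qed (use e n in \<open>auto simp: agree_def\<close>)
  then show ?thesis by (rule runs_weaken) auto
qed

definition TopRows :: prog where
  "TopRows = For 10 (Reg 1) (Seq (UnitRow (Reg 7) (Reg 10) (Op Mul (Reg 5) (Reg 3)))
     (For 11 (Reg 6) (Seq (PowProg (Reg 11) (Reg 10)) (Write (Op Mul (Reg 5) (Reg 15))))))"

definition MidRows :: prog where
  "MidRows = For 10 (Reg 0) (Seq (UnitRow (Reg 7) (Op Add (Reg 1) (Reg 10)) (Reg 5))
     (For 11 (Reg 6) (Seq (Sample 5) (Write (Reg 14)))))"

definition BotRows :: prog where
  "BotRows = For 10 (Reg 6) (UnitRow (Reg 8) (Op Add (Reg 7) (Reg 10)) (Const 1))"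

definition ShiftHead :: prog where
  "ShiftHead = For 10 (Reg 1) (Seq (Assign 12 (Const 0)) (Seq (Assign 13 (Reg 9))
     (Seq (For 11 (Reg 2)
        (Seq (PowProg (Op Add (Op Mul (Reg 11) (Reg 5)) (Op Mod (Reg 13) (Reg 5))) (Reg 10))
          (Seq (Assign 12 (Op Add (Reg 12) (Reg 15))) (Assign 13 (Op Div (Reg 13) (Reg 5))))))
       (Write (Op Sub (Const 0) (Op Mul (Reg 5) (Reg 12)))))))"

definition ProjRows :: prog where
  "ProjRows = For 10 (Reg 0) (UnitRow (Reg 8) (Op Add (Reg 1) (Reg 10)) (Const 1))"

text \<open>\<open>B ^ h\<close> is a power of two along with \<open>B\<close>, so all digits of
  \<open>P\<close> are drawn at once and separated later.\<close>

definition DrawShift :: prog where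
  "DrawShift = Seq (PowProg (Reg 5) (Reg 2)) (Seq (Assign 13 (Reg 15)) (Seq (Sample 13) (Assign 9 (Reg 14))))"

text \<open>The first assignment turns input 0 into 1. With \<open>r = 0\<close> the weight would be
  0 and \<open>BlockSearch\<close> would never stop, while polynomial time is claimed for every
  unary input.\<close>

definition Setup :: "nat \<Rightarrow> prog" where
  "Setup b = Seq (Assign 0 (Op Add (Reg 0) (Op Less (Reg 0) (Const 1))))
    (Seq (Assign 1 (Op Mul (Const (int b)) (Reg 0)))
    (Seq (Assign 2 (Op Mul (Const (int (b + 3))) (Reg 0)))
    (Seq (Assign 3 (Op Mul (Const 36) (PowExpr (Op Mul (Const 2) (Reg 2)) (b + 1))))
    (Seq (Assign 4 (Const 2))
    (Seq PrimeSearch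
    (Seq (Assign 5 (Const 1))
    (Seq BlockSearch
    (Seq (Assign 6 (Op Mul (Reg 2) (Reg 5)))
    (Seq (Assign 7 (Op Add (Reg 1) (Reg 0)))
      (Assign 8 (Op Add (Reg 7) (Reg 6))))))))))))"

text \<open>
  In the notation of the introduction, \<open>chk\<close> is \<open>k\<close>, \<open>wgt\<close> is \<open>h\<close>, \<open>prm\<close> is \<open>q\<close>, \<open>blk\<close> is \<open>B\<close>,
  \<open>pts\<close> is \<open>n\<close>, and \<open>dmn\<close> is the dimension \<open>k + r + n\<close>. The constant \<open>b\<close> determines \<open>\<epsilon> = 3 / b\<close>.
\<close>

locale lattice_params =
  fixes b r :: nat
  assumes b_pos: "0 < b" and r_pos: "0 < r"
begin

definition "chk = b * r"
definition "wgt = (b + 3) * r"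
text \<open>Chosen so that \<open>prm < 2 * wgt * blk\<close> yields
  \<open>36 * (2 * wgt) ^ b < blk\<close>: one factor \<open>2 * wgt\<close> is lost by dividing the
  points into blocks, the other \<open>b\<close> pay for the number of syndromes. The 36 is a factor
  6 for each of two failure events, small fibres and hashes that miss a value.\<close>

definition "prm_lb = 36 * (2 * wgt) ^ (b + 1)"
definition "prm = (LEAST q. prime q \<and> prm_lb \<le> q)"
text \<open>The least exponent makes \<open>pts \<le> prm < 2 * pts\<close>: the evaluation points
  are distinct residues, and the prime exceeds their number by less than a factor 2.\<close>

definition "lgb = (LEAST t. prm < 2 * wgt * 2 ^ t)"
definition blk :: nat where "blk = 2 ^ lgb"
definition "pts = wgt * blk"
definition "dmn = chk + r + pts"

lemma chk_pos: "0 < chk" and wgt_pos: "0 < wgt" and chk_less_wgt: "chk < wgt"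
  using b_pos r_pos by (simp_all add: chk_def wgt_def)

lemma prm: "prime prm" "prm_lb \<le> prm" "prm \<le> 2 * (prm_lb + 1)\<^sup>2"
proof -
  obtain p where p: "prime p" "prm_lb < p" "p \<le> 2 * (prm_lb + 1)\<^sup>2" using prime_between by blast
  then have ex: "prime p \<and> prm_lb \<le> p" by simp
  show "prime prm" "prm_lb \<le> prm" using LeastI[of "\<lambda>q. prime q \<and> prm_lb \<le> q", OF ex] by (auto simp: prm_def)
  have "prm \<le> p" unfolding prm_def using ex by (rule Least_le)
  then show "prm \<le> 2 * (prm_lb + 1)\<^sup>2" using p by simp
qed

lemma prm_least: "prime q \<Longrightarrow> prm_lb \<le> q \<Longrightarrow> prm \<le> q"
  unfolding prm_def by (rule Least_le) simp

lemma prm_lb_ge: "2 * wgt \<le> prm_lb" "2 \<le> prm_lb"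
proof -
  have "(2 * wgt) ^ 1 \<le> (2 * wgt) ^ (b + 1)" using wgt_pos by (intro power_increasing) auto
  then show "2 * wgt \<le> prm_lb" by (simp add: prm_lb_def)
  then show "2 \<le> prm_lb" using wgt_pos by linarith
qed

lemma lgb_upper: "prm < 2 * wgt * blk"
proof -
  have "prm < 2 ^ prm" by simp
  also have "\<dots> \<le> 2 * wgt * 2 ^ prm" using wgt_pos by simp
  finally show ?thesis unfolding blk_def lgb_def by (rule LeastI)
qed

lemma lgb_least: "prm < 2 * wgt * 2 ^ e \<Longrightarrow> lgb \<le> e"
  unfolding lgb_def by (rule Least_le)

lemma pts_le: "pts \<le> prm"
proof (cases lgb)
  case 0
  then show ?thesis using prm_lb_ge prm by (simp add: pts_def blk_def)
next
  case (Suc t)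
  then have "\<not> prm < 2 * wgt * 2 ^ t" using lgb_least[of t] by auto
  then show ?thesis using Suc by (simp add: pts_def blk_def)
qed

lemma blk_le_pts: "blk \<le> pts" and wgt_le_pts: "wgt \<le> pts"
  using wgt_pos by (simp_all add: pts_def blk_def)

lemma blk_gt: "36 * (2 * wgt) ^ b < blk"
proof -
  have "prm_lb = 2 * wgt * (36 * (2 * wgt) ^ b)" by (simp add: prm_lb_def)
  then have "2 * wgt * (36 * (2 * wgt) ^ b) < 2 * wgt * blk" using lgb_upper prm(2) by linarith
  then show ?thesis by (metis mult_less_cancel1)
qed

lemma chk_le_blk: "2 * chk \<le> blk"
proof -
  have "(2 * wgt) ^ 1 \<le> (2 * wgt) ^ b" using wgt_pos b_pos by (intro power_increasing) auto
  then show ?thesis using blk_gt chk_less_wgt by simp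
qed

text \<open>There are at most \<open>(2 * wgt * blk) ^ chk\<close> syndromes. The factor 36 and the
  power \<open>(2 * wgt) ^ chk\<close> are together absorbed by \<open>blk ^ r\<close>, and
  \<open>chk + 2 * r + r = wgt\<close>; here the 3 in \<open>wgt\<close> is spent.\<close>

lemma counting_bound: "36 * prm ^ chk * blk ^ (2 * r) \<le> blk ^ wgt"
proof -
  have "prm ^ chk \<le> (2 * wgt * blk) ^ chk" using lgb_upper by (intro power_mono) auto
  then have "36 * prm ^ chk * blk ^ (2 * r) \<le> 36 * (2 * wgt * blk) ^ chk * blk ^ (2 * r)" by simp
  also have "\<dots> = 36 * ((2 * wgt) ^ b) ^ r * blk ^ (chk + 2 * r)"
    by (simp add: chk_def power_mult_distrib power_mult power_add)
  also have "\<dots> \<le> (36 ^ r * ((2 * wgt) ^ b) ^ r) * blk ^ (chk + 2 * r)"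
    using r_pos self_le_power[of "36::nat" r] by simp
  also have "36 ^ r * ((2 * wgt) ^ b) ^ r = (36 * (2 * wgt) ^ b) ^ r" by (simp only: power_mult_distrib)
  also have "\<dots> * blk ^ (chk + 2 * r) \<le> blk ^ r * blk ^ (chk + 2 * r)"
    using blk_gt by (intro mult_right_mono power_mono) auto
  also have "\<dots> = blk ^ wgt" unfolding power_add[symmetric] by (simp add: wgt_def chk_def algebra_simps)
  finally show ?thesis .
qed

text \<open>One bit length for all registers of the whole run. The values kept are bounded by powers
  of \<open>X = dmn + prm + 2\<close> with exponents up to \<open>wgt + 2\<close>, and
  \<open>X < 2 ^ X\<close>.\<close>

definition "width = (dmn + prm + 2) * (wgt + 2)"

lemma pow_less_width:
  assumes "x \<le> dmn + prm + 2" "y \<le> wgt + 2"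
  shows "int x ^ y < 2 ^ width"
proof -
  have "x ^ y \<le> (dmn + prm + 2) ^ (wgt + 2)"
    by (rule order_trans[OF power_mono[OF assms(1)] power_increasing[OF assms(2)]]) auto
  also have "\<dots> < (2 ^ (dmn + prm + 2)) ^ (wgt + 2)"
    by (intro power_strict_mono less_exp) auto
  also have "\<dots> = 2 ^ width" by (simp only: width_def power_mult)
  finally have "int (x ^ y) < int (2 ^ width)" by (simp only: of_nat_less_iff)
  then show ?thesis by simp
qed

lemma less_width: "x \<le> dmn + prm + 2 \<Longrightarrow> int x < 2 ^ width"
  using pow_less_width[of x 1] by simp

section \<open>Correctness and step counts of the program blocks\<close>

lemma runs_prime_search:
  assumes "m 3 = int prm_lb" "m 4 = 2"
  shows "druns width PrimeSearch m w ((prm + 1) * (prm + 1) * 4 + 1)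
    (\<lambda>m' w'. w' = w \<and> (\<exists>d. m' = m(3 := int prm, 4 := d)))"
proof -
  define I where "I m' w' \<longleftrightarrow> w' = w \<and> (\<exists>q d. m' = m(3 := int q, 4 := int d) \<and>
     prm_lb \<le> q \<and> q \<le> prm \<and> 2 \<le> d \<and> d \<le> q \<and> (\<forall>e. 2 \<le> e \<longrightarrow> e < d \<longrightarrow> \<not> e dvd q))" for m' w'
  \<comment> \<open>The lexicographic order on candidate and divisor, both counted down from
    \<open>prm\<close>, flattened in base \<open>prm + 1\<close>.\<close>
  define f where "f m' = nat ((int prm - m' 3) * (int prm + 1) + (int prm - m' 4))" for m' :: "nat \<Rightarrow> int"
  have small: "int x < 2 ^ width" if "x \<le> prm + 1" for x using that by (intro less_width) auto
  have init: "I m w"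
    unfolding I_def using assms prm(2) prm_lb_ge
    by (intro conjI refl exI[of _ prm_lb] exI[of _ 2]) auto
  have step: "druns width (IfPos (Op Less (Op Mod (Reg 3) (Reg 4)) (Const 1))
       (Seq (Assign 3 (Op Add (Reg 3) (Const 1))) (Assign 4 (Const 2)))
       (Assign 4 (Op Add (Reg 4) (Const 1)))) m1 w1 3 (\<lambda>m' w'. I m' w' \<and> f m' < f m1)"
    if I: "I m1 w1" and c: "0 < expr_val (Op Less (Reg 4) (Reg 3)) m1" for m1 w1
  proof -
    from I obtain q d where qd: "w1 = w" "m1 = m(3 := int q, 4 := int d)" "prm_lb \<le> q" "q \<le> prm" "2 \<le> d"
      "\<And>e. 2 \<le> e \<Longrightarrow> e < d \<Longrightarrow> \<not> e dvd q" unfolding I_def by blast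
    have dq: "d < q" using c qd by (simp split: if_splits)
    have v3: "m1 3 = int q" and v4: "m1 4 = int d" using qd by auto
    have "druns width (IfPos (Op Less (Op Mod (Reg 3) (Reg 4)) (Const 1))
       (Seq (Assign 3 (Op Add (Reg 3) (Const 1))) (Assign 4 (Const 2)))
       (Assign 4 (Op Add (Reg 4) (Const 1)))) m1 w1 (Suc 2) (\<lambda>m' w'. I m' w' \<and> f m' < f m1)"
    proof (rule runs_if)
      assume "0 < expr_val (Op Less (Op Mod (Reg 3) (Reg 4)) (Const 1)) m1"
      then have "q mod d = 0" using v3 v4 by (simp add: zmod_int[symmetric] split: if_splits)
      then have "d dvd q" by auto
      then have "\<not> prime q" using dq qd(5) by (auto simp: prime_nat_iff)
      then have q': "q < prm" using prm(1) qd(4) by (metis le_neq_implies_less)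
      have "f (m1(3 := int q + 1, 4 := 2)) < f m1"
      proof -
        have "(int prm - (int q + 1)) * (int prm + 1) + (int prm - 2)
            < (int prm - int q) * (int prm + 1) + (int prm - int d)"
          using dq q' by (simp add: algebra_simps)
        moreover have "0 \<le> (int prm - (int q + 1)) * (int prm + 1)" using q' by simp
        moreover have "2 \<le> prm" using prm(1) by (rule prime_ge_2_nat)
        ultimately show ?thesis unfolding f_def v3 v4 by simp
      qed
      moreover have "I (m1(3 := int q + 1, 4 := 2)) w1"
        unfolding I_def using qd(1-5) dq q' by (intro conjI qd(1) exI[of _ "q + 1"] exI[of _ 2]) auto
      ultimately have "druns width (Seq (Assign 3 (Op Add (Reg 3) (Const 1))) (Assign 4 (Const 2))) m1 w1 (Suc 1)
          (\<lambda>m' w'. I m' w' \<and> f m' < f m1)"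
        using v3 q' small[of "q + 1"] small[of 2] prime_ge_2_nat[OF prm(1)]
        by (intro runs_assign_seq runs_assign) (auto simp: add.commute)
      then show "druns width (Seq (Assign 3 (Op Add (Reg 3) (Const 1))) (Assign 4 (Const 2))) m1 w1 2
          (\<lambda>m' w'. I m' w' \<and> f m' < f m1)" by (simp add: numeral_2_eq_2)
    next
      assume "expr_val (Op Less (Op Mod (Reg 3) (Reg 4)) (Const 1)) m1 \<le> 0"
      then have "int (q mod d) \<ge> 1" using v3 v4 by (simp add: zmod_int split: if_splits)
      then have nd: "\<not> d dvd q" by auto
      have "\<not> e dvd q" if "2 \<le> e" "e < d + 1" for e
        using qd(6)[of e] nd that by (cases "e = d") auto
      then have "I (m1(4 := int d + 1)) w1"
        unfolding I_def using qd(2-5) dq by (intro conjI qd(1) exI[of _ q] exI[of _ "d + 1"]) auto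
      moreover have "f (m1(4 := int d + 1)) < f m1"
      proof -
        define P where "P = (int prm - int q) * (int prm + 1)"
        have "0 \<le> P" using qd by (simp add: P_def)
        moreover have "f (m1(4 := int d + 1)) = nat (P + (int prm - (int d + 1)))" "f m1 = nat (P + (int prm - int d))"
          by (simp_all add: f_def v3 v4 P_def)
        ultimately show ?thesis using dq qd(4) by linarith
      qed
      ultimately have "druns width (Assign 4 (Op Add (Reg 4) (Const 1))) m1 w1 1 (\<lambda>m' w'. I m' w' \<and> f m' < f m1)"
        using v4 dq qd(4) small[of "d + 1"] by (intro runs_assign) (auto simp: add.commute)
      then show "druns width (Assign 4 (Op Add (Reg 4) (Const 1))) m1 w1 2 (\<lambda>m' w'. I m' w' \<and> f m' < f m1)"
        by (rule runs_weaken) auto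
    qed
    then show ?thesis by (simp add: numeral_3_eq_3 numeral_2_eq_2)
  qed
  have "druns width PrimeSearch m w (f m * Suc 3 + 1)
      (\<lambda>m' w'. I m' w' \<and> expr_val (Op Less (Reg 4) (Reg 3)) m' \<le> 0)"
    unfolding PrimeSearch_def by (rule runs_while[of I, OF init step])
  moreover have "f m \<le> (prm + 1) * (prm + 1)"
  proof -
    have "(int prm - int prm_lb) * (int prm + 1) \<le> int prm * (int prm + 1)"
      by (intro mult_right_mono) auto
    moreover have "0 \<le> int prm * (int prm + 1)" by simp
    ultimately have "int (f m) \<le> int prm * (int prm + 1) + int prm"
      unfolding f_def assms by linarith
    also have "\<dots> \<le> int ((prm + 1) * (prm + 1))" by (simp add: algebra_simps)
    finally show ?thesis by (simp only: of_nat_le_iff)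
  qed
  ultimately show ?thesis
  proof (rule runs_weaken[OF _ add_mono[OF mult_mono order_refl]])
    fix m' w' assume "I m' w' \<and> expr_val (Op Less (Reg 4) (Reg 3)) m' \<le> 0"
    then obtain q d where qd: "w' = w" "m' = m(3 := int q, 4 := int d)" "prm_lb \<le> q" "q \<le> prm" "2 \<le> d"
      "\<And>e. 2 \<le> e \<Longrightarrow> e < d \<Longrightarrow> \<not> e dvd q" "q \<le> d" unfolding I_def by (auto split: if_splits)
    \<comment> \<open>The loop ends with \<open>q \<le> d\<close>, so all of \<open>2..q - 1\<close>
      have been tested without finding a divisor.\<close>
    have "prime q" using qd prm_lb_ge
      by (auto simp: prime_nat_iff')
    then have "q = prm" using prm_least[of q] qd by simp
    then show "w' = w \<and> (\<exists>d. m' = m(3 := int prm, 4 := d))" using qd by auto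
  qed auto
qed

lemma runs_block_search:
  assumes "m 2 = int wgt" "m 3 = int prm" "m 5 = 1"
  shows "druns width BlockSearch m w (lgb * 2 + 1) (\<lambda>m' w'. w' = w \<and> m' = m(5 := int blk))"
proof -
  define I where "I m' w' \<longleftrightarrow> w' = w \<and> (\<exists>e\<le>lgb. m' = m(5 := 2 ^ e))" for m' w'
  \<comment> \<open>The number of doublings still due. It is phrased by a least exponent because the
    measure has to be a function of the memory.\<close>
  define f where "f m' = (LEAST e. int blk \<le> m' 5 * 2 ^ e)" for m' :: "nat \<Rightarrow> int"
  have f: "f (m(5 := 2 ^ e)) = lgb - e" for e
  proof -
    have "int blk \<le> 2 ^ e * 2 ^ x \<longleftrightarrow> lgb \<le> e + x" for x
      unfolding blk_def by (simp add: power_add[symmetric])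
    then have "f (m(5 := 2 ^ e)) = (LEAST x. lgb \<le> e + x)" by (simp add: f_def)
    also have "\<dots> = lgb - e" by (rule Least_equality) auto
    finally show ?thesis .
  qed
  have cond: "(int prm < 2 * int wgt * 2 ^ e) = (prm < 2 * wgt * 2 ^ e)" for e
    using of_nat_less_iff[of prm "2 * wgt * 2 ^ e", where 'a = int] by simp
  have run: "druns width BlockSearch m w (f m * Suc 1 + 1)
      (\<lambda>m' w'. I m' w' \<and> expr_val (Op Less (Op Mul (Op Mul (Const 2) (Reg 2)) (Reg 5)) (Op Add (Reg 3) (Const 1))) m' \<le> 0)"
    unfolding BlockSearch_def
  proof (rule runs_while[of I])
    show "I m w" unfolding I_def using assms by (auto intro!: exI[of _ 0])
    fix m1 w1 assume I: "I m1 w1"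
      and c: "0 < expr_val (Op Less (Op Mul (Op Mul (Const 2) (Reg 2)) (Reg 5)) (Op Add (Reg 3) (Const 1))) m1"
    from I obtain e where e: "w1 = w" "m1 = m(5 := 2 ^ e)" "e \<le> lgb" unfolding I_def by blast
    have "\<not> int prm < 2 * int wgt * 2 ^ e" using c e assms by (simp split: if_splits)
    then have "\<not> prm < 2 * wgt * 2 ^ e" by (simp only: cond not_False_eq_True)
    then have "e \<noteq> lgb" using lgb_upper by (auto simp: blk_def)
    then have e': "Suc e \<le> lgb" using e by simp
    have "int (2 ^ Suc e) \<le> int blk" using e' unfolding blk_def of_nat_le_iff by (intro power_increasing) auto
    moreover have "int blk < 2 ^ width" using blk_le_pts by (intro less_width) (simp add: dmn_def)
    moreover have "int (2 ^ Suc e) = 2 * 2 ^ e" by simp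
    ultimately have "(2::int) * 2 ^ e < 2 ^ width" by linarith
    moreover have "I (m1(5 := 2 ^ Suc e)) w1" unfolding I_def using e e' by auto
    moreover have "f (m1(5 := 2 ^ Suc e)) < f m1" using e e' f[of "Suc e"] f[of e] by simp
    ultimately show "druns width (Assign 5 (Op Mul (Const 2) (Reg 5))) m1 w1 1 (\<lambda>m' w'. I m' w' \<and> f m' < f m1)"
      using e by (intro runs_assign) auto
  qed
  have "m = m(5 := 2 ^ 0)" using assms by auto
  then have "f m = lgb" using f[of 0] by (simp only: diff_zero)
  show ?thesis
  proof (rule runs_weaken[OF run[unfolded \<open>f m = lgb\<close>]])
    fix m' w' assume "I m' w' \<and> expr_val (Op Less (Op Mul (Op Mul (Const 2) (Reg 2)) (Reg 5)) (Op Add (Reg 3) (Const 1))) m' \<le> 0"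
    then obtain e where e: "w' = w" "m' = m(5 := 2 ^ e)" "e \<le> lgb" "int prm < 2 * int wgt * 2 ^ e"
      unfolding I_def using assms by (auto split: if_splits)
    then have "e = lgb" using lgb_least[of e] unfolding cond by simp
    then show "w' = w \<and> m' = m(5 := int blk)" using e by (simp add: blk_def)
  qed simp
qed

definition "env m \<longleftrightarrow> m 0 = int r \<and> m 1 = int chk \<and> m 2 = int wgt \<and> m 3 = int prm \<and>
   m 5 = int blk \<and> m 6 = int pts \<and> m 7 = int (chk + r) \<and> m 8 = int dmn" for m :: "nat \<Rightarrow> int"

lemma env_agree: "env m \<Longrightarrow> agree v m m' \<Longrightarrow> 9 \<le> v \<Longrightarrow> env m'"
  by (simp add: env_def agree_def)

lemma param_less_width:
  "int r < 2 ^ width" "int chk < 2 ^ width" "int wgt < 2 ^ width" "int prm < 2 ^ width"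
  "int blk < 2 ^ width" "int pts < 2 ^ width" "int (chk + r) < 2 ^ width" "int dmn < 2 ^ width"
  "int prm_lb < 2 ^ width" "(1::int) < 2 ^ width" "(2::int) < 2 ^ width"
proof -
  note blk_le_pts wgt_le_pts
  then show "int r < 2 ^ width" "int chk < 2 ^ width" "int wgt < 2 ^ width" "int prm < 2 ^ width"
  "int blk < 2 ^ width" "int pts < 2 ^ width" "int (chk + r) < 2 ^ width" "int dmn < 2 ^ width"
  "int prm_lb < 2 ^ width" using prm(2) by (intro less_width; simp add: dmn_def)+
  show "(1::int) < 2 ^ width" "(2::int) < 2 ^ width" using less_width[of 1] less_width[of 2] by simp_all
qed

lemma runs_setup:
  assumes m: "m 0 = int r0" and r: "r = max 1 r0"
  shows "druns width (Setup b) m w (4 * (prm + 1) * (prm + 1) + 2 * lgb + 11) (\<lambda>m' w'. env m' \<and> w' = w)"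
proof -
  have r': "m 0 + (if m 0 < 1 then 1 else 0) = int r" using m r by auto
  have chk': "int b * int r = int chk" by (simp add: chk_def)
  have wgt': "int (b + 3) * int r = int wgt" by (simp only: wgt_def of_nat_mult)
  have lb': "36 * (2 * int wgt) ^ (b + 1) = int prm_lb" by (simp only: prm_lb_def of_nat_mult of_nat_power of_nat_numeral)
  let ?T3 = "Suc (Suc 1)"
  let ?T2 = "(lgb * 2 + 1) + ?T3"
  let ?T1 = "((prm + 1) * (prm + 1) * 4 + 1) + Suc ?T2"
  let ?rest3 = "Seq (Assign 6 (Op Mul (Reg 2) (Reg 5)))
    (Seq (Assign 7 (Op Add (Reg 1) (Reg 0))) (Assign 8 (Op Add (Reg 7) (Reg 6))))"
  let ?rest2 = "Seq BlockSearch ?rest3"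
  let ?rest1 = "Seq PrimeSearch (Seq (Assign 5 (Const 1)) ?rest2)"
  let ?Q = "\<lambda>m' w'. env m' \<and> w' = w"
  note pw = param_less_width
  have 3: "druns width ?rest3 m3 w ?T3 ?Q"
    if "m3 0 = int r" "m3 1 = int chk" "m3 2 = int wgt" "m3 3 = int prm" "m3 5 = int blk" for m3
    using that pw by (intro runs_assign_seq runs_assign) (auto simp: env_def pts_def dmn_def)
  have 2: "druns width ?rest2 m2 w ?T2 ?Q"
    if "m2 0 = int r" "m2 1 = int chk" "m2 2 = int wgt" "m2 3 = int prm" "m2 5 = 1" for m2
    by (rule runs_seq_det[OF runs_block_search]) (use that 3 in auto)
  have 1: "druns width ?rest1 m1 w ?T1 ?Q"
    if "m1 0 = int r" "m1 1 = int chk" "m1 2 = int wgt" "m1 3 = int prm_lb" "m1 4 = 2" for m1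
  proof (rule runs_seq_det[OF runs_prime_search])
    fix m' w' assume "w' = w \<and> (\<exists>d. m' = m1(3 := int prm, 4 := d))"
    then obtain d where d: "w' = w" "m' = m1(3 := int prm, 4 := d)" by blast
    have "druns width (Seq (Assign 5 (Const 1)) ?rest2) m' w (Suc ?T2) ?Q"
      by (rule runs_assign_seq, use pw in simp, rule 2) (use that d in auto)
    then show "druns width (Seq (Assign 5 (Const 1)) ?rest2) m' w' (Suc ?T2) ?Q" by (simp only: d(1))
  qed (use that in auto)
  have "druns width (Setup b) m w (Suc (Suc (Suc (Suc (Suc ?T1))))) ?Q"
    unfolding Setup_def
  proof (intro runs_assign_seq, goal_cases)
    case 6
    show ?case
      by (rule 1) (use r' chk' wgt' lb' in \<open>auto simp: PowExpr_val simp del: of_nat_add\<close>)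
  qed (use r' chk' wgt' lb' pw in \<open>auto simp: PowExpr_val simp del: of_nat_add\<close>)
  then show ?thesis by (rule runs_weaken) (auto simp: algebra_simps)
qed

lemma blk_pow: "int blk ^ wgt = 2 ^ (lgb * wgt)" "int blk = 2 ^ lgb" "lgb * wgt < width" "lgb < width"
proof -
  show 1: "int blk ^ wgt = 2 ^ (lgb * wgt)" "int blk = 2 ^ lgb" by (simp_all add: blk_def power_mult)
  note blk_le_pts
  then have "int blk ^ wgt < 2 ^ width" by (intro pow_less_width) (auto simp: dmn_def)
  then show "lgb * wgt < width" unfolding 1(1) by (rule power_less_imp_less_exp[rotated]) simp
  show "lgb < width" using param_less_width(5) unfolding 1(2) by (rule power_less_imp_less_exp[rotated]) simp
qed

lemma runs_draw_shift:
  assumes "env m"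
  shows "runs width (pmf_of_set {0..<int blk ^ wgt}) DrawShift m w (3 * wgt + 4 * (lgb * wgt) + 8)
    (\<lambda>P m' w'. env m' \<and> m' 9 = P \<and> w' = w)"
proof -
  have "runs width (pmf_of_set {0..<int blk ^ wgt}) DrawShift m w
     ((3 * wgt + 3) + Suc ((4 * (lgb * wgt) + 3) + 1)) (\<lambda>P m' w'. env m' \<and> m' 9 = P \<and> w' = w)"
    unfolding DrawShift_def
  proof (rule runs_seq_det[OF runs_pow[where x = blk and y = wgt]])
    show "expr_val (Reg 5) m' = int blk \<and> expr_val (Reg 2) m' = int wgt" if "agree 15 m m'" for m'
      using env_agree[OF assms that] by (simp add: env_def)
    note blk_le_pts
    then show bd: "int blk ^ wgt < 2 ^ width" by (intro pow_less_width) (auto simp: dmn_def)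
    fix m1 w1 assume m1: "agree 15 m m1 \<and> m1 15 = int blk ^ wgt \<and> w1 = w"
    show "runs width (pmf_of_set {0..<int blk ^ wgt}) (Seq (Assign 13 (Reg 15)) (Seq (Sample 13) (Assign 9 (Reg 14)))) m1 w1
      (Suc ((4 * (lgb * wgt) + 3) + 1)) (\<lambda>P m' w'. env m' \<and> m' 9 = P \<and> w' = w)"
    proof (rule runs_assign_seq)
      let ?m = "m1(13 := expr_val (Reg 15) m1)"
      have e: "env ?m" using env_agree[OF assms, of 15 m1] m1 by (simp add: env_def)
      have "runs width (pmf_of_set {0..<2 ^ (lgb * wgt)}) (Sample 13) ?m w1 (4 * (lgb * wgt) + 3)
          (\<lambda>x m' w'. agree 14 ?m m' \<and> m' 14 = x \<and> w' = w1)"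
        by (rule runs_sample) (use m1 blk_pow in auto)
      then show "runs width (pmf_of_set {0..<int blk ^ wgt}) (Seq (Sample 13) (Assign 9 (Reg 14))) ?m w1
         ((4 * (lgb * wgt) + 3) + 1) (\<lambda>P m' w'. env m' \<and> m' 9 = P \<and> w' = w)"
        unfolding blk_pow(1)[symmetric]
      proof (rule runs_det_seq)
        fix P m2 w2 assume P: "P \<in> set_pmf (pmf_of_set {0..<int blk ^ wgt})"
          and m2: "agree 14 ?m m2 \<and> m2 14 = P \<and> w2 = w1"
        have "{0..<int blk ^ wgt} \<noteq> {}" by (simp add: blk_def)
        then have "0 \<le> P" "P < 2 ^ width" using P bd by auto
        then show "druns width (Assign 9 (Reg 14)) m2 w2 1 (\<lambda>m' w'. env m' \<and> m' 9 = P \<and> w' = w)"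
          using m2 m1 env_agree[OF e, of 14 m2] by (intro runs_assign) (auto simp: env_def)
      qed
    qed (use m1 bd in auto)
  qed (use param_less_width in auto)
  then show ?thesis by (rule runs_weaken) auto
qed

lemma runs_top_rows:
  assumes "env m"
  shows "druns width TopRows m w (chk * (3 * (chk + r) + 2 + (pts * (3 * chk + 6) + 2) + 2) + 2)
    (\<lambda>m' w'. agree 10 m m' \<and> w' = w @ concat (map (\<lambda>i. unit_row (chk + r) i (int (blk * prm)) @
        map (\<lambda>a. int blk * int a ^ i) [0..<pts]) [0..<chk]))"
  unfolding TopRows_def
proof (rule druns_for_rows)
  fix i m1 w1 assume i: "i < chk" and m1: "agree 10 m m1" "m1 10 = int i"
  have e: "env m1" using env_agree[OF assms m1(1)] by simp
  show "druns width (Seq (UnitRow (Reg 7) (Reg 10) (Op Mul (Reg 5) (Reg 3)))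
     (For 11 (Reg 6) (Seq (PowProg (Reg 11) (Reg 10)) (Write (Op Mul (Reg 5) (Reg 15)))))) m1 w1
     ((3 * (chk + r) + 2) + (pts * (3 * chk + 6) + 2)) (\<lambda>m' w'. agree (Suc 10) m1 m' \<and> w' = w1 @
        unit_row (chk + r) i (int (blk * prm)) @ map (\<lambda>a. int blk * int a ^ i) [0..<pts])"
  proof (rule runs_seq_det[OF runs_unit_row[where n = "chk + r" and i = i and x = "int (blk * prm)"]])
    fix m2 w2 assume m2: "agree 11 m1 m2 \<and> w2 = w1 @ map (\<lambda>j. if i = j then int (blk * prm) else 0) [0..<chk + r]"
    have e2: "env m2" using env_agree[OF e, of 11 m2] m2 by simp
    have "druns width (For 11 (Reg 6) (Seq (PowProg (Reg 11) (Reg 10)) (Write (Op Mul (Reg 5) (Reg 15))))) m2 w2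
       (pts * ((3 * chk + 4) + 2) + 2)
       (\<lambda>m' w'. agree 11 m2 m' \<and> w' = w2 @ concat (map (\<lambda>a. [int blk * int a ^ i]) [0..<pts]))"
    proof (rule druns_for_rows)
      fix a m3 w3 assume a: "a < pts" and m3: "agree 11 m2 m3" "m3 11 = int a"
      have e3: "env m3" using env_agree[OF e2 m3(1)] by simp
      have v10: "m3 10 = int i" using m3 m2 m1 by (simp add: agree_def)
      have "druns width (Seq (PowProg (Reg 11) (Reg 10)) (Write (Op Mul (Reg 5) (Reg 15)))) m3 w3 ((3 * i + 3) + 1)
         (\<lambda>m' w'. agree (Suc 11) m3 m' \<and> w' = w3 @ [int blk * int a ^ i])"
      proof (rule runs_seq_det[OF runs_pow[where x = a and y = i]])
        show "expr_val (Reg 11) m' = int a \<and> expr_val (Reg 10) m' = int i" if "agree 15 m3 m'" for m'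
          using that m3 v10 by (simp add: agree_def)
        show "int a ^ i < 2 ^ width" using a i chk_less_wgt by (intro pow_less_width) (auto simp: dmn_def)
        show "int i < 2 ^ width" using i param_less_width(2) by linarith
        fix m4 w4 assume "agree 15 m3 m4 \<and> m4 15 = int a ^ i \<and> w4 = w3"
        then show "druns width (Write (Op Mul (Reg 5) (Reg 15))) m4 w4 1
            (\<lambda>m' w'. agree (Suc 11) m3 m' \<and> w' = w3 @ [int blk * int a ^ i])"
          using e3 by (intro runs_write) (auto simp: env_def agree_def)
      qed
      then show "druns width (Seq (PowProg (Reg 11) (Reg 10)) (Write (Op Mul (Reg 5) (Reg 15)))) m3 w3 (3 * chk + 4)
         (\<lambda>m' w'. agree (Suc 11) m3 m' \<and> w' = w3 @ [int blk * int a ^ i])"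
        using i by (elim runs_weaken) auto
    qed (use e2 env_agree[OF e2] param_less_width in \<open>auto simp: env_def agree_def\<close>)
    then show "druns width (For 11 (Reg 6) (Seq (PowProg (Reg 11) (Reg 10)) (Write (Op Mul (Reg 5) (Reg 15))))) m2 w2
       (pts * (3 * chk + 6) + 2) (\<lambda>m' w'. agree (Suc 10) m1 m' \<and> w' = w1 @
        unit_row (chk + r) i (int (blk * prm)) @ map (\<lambda>a. int blk * int a ^ i) [0..<pts])"
      by (rule runs_weaken) (use m2 in \<open>auto simp: agree_def unit_row_def concat_map_singleton\<close>)
  qed (use e m1 param_less_width in \<open>auto simp: env_def agree_def\<close>)
qed (use assms param_less_width in \<open>auto simp: env_def agree_def\<close>)

lemma runs_mid_rows:
  assumes "env m"
  shows "runs width (replicate_pmf r (replicate_pmf pts (pmf_of_set {0..<int blk}))) MidRows m w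
    (r * (3 * (chk + r) + 2 + (pts * (4 * lgb + 6) + 2) + 2) + 2)
    (\<lambda>Ts m' w'. agree 10 m m' \<and> w' = w @ concat (map (\<lambda>i. unit_row (chk + r) (chk + i) (int blk) @
        Ts ! i) [0..<r]))"
  unfolding MidRows_def
proof (rule runs_for_rows[where row = "\<lambda>i x. unit_row (chk + r) (chk + i) (int blk) @ x"])
  fix i m1 w1 assume i: "i < r" and m1: "agree 10 m m1" "m1 10 = int i"
  have e: "env m1" using env_agree[OF assms m1(1)] by simp
  show "runs width (replicate_pmf pts (pmf_of_set {0..<int blk}))
     (Seq (UnitRow (Reg 7) (Op Add (Reg 1) (Reg 10)) (Reg 5))
     (For 11 (Reg 6) (Seq (Sample 5) (Write (Reg 14))))) m1 w1
     ((3 * (chk + r) + 2) + (pts * (4 * lgb + 6) + 2)) (\<lambda>x m' w'. agree (Suc 10) m1 m' \<and> w' = w1 @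
        unit_row (chk + r) (chk + i) (int blk) @ x)"
  proof (rule runs_seq_det[OF runs_unit_row[where n = "chk + r" and i = "chk + i" and x = "int blk"]])
    fix m2 w2 assume m2: "agree 11 m1 m2 \<and> w2 = w1 @ map (\<lambda>j. if chk + i = j then int blk else 0) [0..<chk + r]"
    have e2: "env m2" using env_agree[OF e, of 11 m2] m2 by simp
    have "runs width (replicate_pmf pts (pmf_of_set {0..<int blk})) (For 11 (Reg 6) (Seq (Sample 5) (Write (Reg 14)))) m2 w2
       (pts * ((4 * lgb + 3 + 1) + 2) + 2)
       (\<lambda>xs m' w'. agree 11 m2 m' \<and> w' = w2 @ concat (map (\<lambda>a. [xs ! a]) [0..<pts]))"
    proof (rule runs_for_rows[where row = "\<lambda>a x. [x]"])
      fix a m3 w3 assume m3: "agree 11 m2 m3"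
      have e3: "env m3" using env_agree[OF e2 m3] by simp
      show "runs width (pmf_of_set {0..<int blk}) (Seq (Sample 5) (Write (Reg 14))) m3 w3 (4 * lgb + 3 + 1)
         (\<lambda>x m' w'. agree (Suc 11) m3 m' \<and> w' = w3 @ [x])"
        unfolding blk_pow(2)
      proof (rule runs_det_seq[OF runs_sample])
        fix x m4 w4 assume "agree 14 m3 m4 \<and> m4 14 = x \<and> w4 = w3"
        then show "druns width (Write (Reg 14)) m4 w4 1 (\<lambda>m' w'. agree (Suc 11) m3 m' \<and> w' = w3 @ [x])"
          by (intro runs_write) (auto simp: agree_def)
      qed (use e3 blk_pow in \<open>auto simp: env_def\<close>)
    qed (use e2 param_less_width in \<open>auto simp: env_def agree_def\<close>)
    then show "runs width (replicate_pmf pts (pmf_of_set {0..<int blk})) (For 11 (Reg 6) (Seq (Sample 5) (Write (Reg 14)))) m2 w2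
       (pts * (4 * lgb + 6) + 2) (\<lambda>x m' w'. agree (Suc 10) m1 m' \<and> w' = w1 @
        unit_row (chk + r) (chk + i) (int blk) @ x)"
    proof (rule runs_weaken)
      fix x m' w' assume x: "x \<in> set_pmf (replicate_pmf pts (pmf_of_set {0..<int blk}))"
        and *: "agree 11 m2 m' \<and> w' = w2 @ concat (map (\<lambda>a. [x ! a]) [0..<pts])"
      have "length x = pts" using x by (simp add: set_replicate_pmf)
      then have "concat (map (\<lambda>a. [x ! a]) [0..<pts]) = x"
        by (simp add: concat_map_singleton map_nth flip: \<open>length x = pts\<close>)
      then show "agree (Suc 10) m1 m' \<and> w' = w1 @ unit_row (chk + r) (chk + i) (int blk) @ x"
        using * m2 by (auto simp: agree_def unit_row_def)
    qed auto
  qed (use e m1 param_less_width in \<open>auto simp: env_def agree_def\<close>)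
qed (use assms param_less_width in \<open>auto simp: env_def agree_def\<close>)

lemma runs_bot_rows:
  assumes "env m"
  shows "druns width BotRows m w (pts * (3 * dmn + 2 + 2) + 2)
    (\<lambda>m' w'. agree 10 m m' \<and> w' = w @ concat (map (\<lambda>i. unit_row dmn (chk + r + i) 1) [0..<pts]))"
  unfolding BotRows_def
proof (rule druns_for_rows)
  fix i m1 w1 assume i: "i < pts" and m1: "agree 10 m m1" "m1 10 = int i"
  have e: "env m1" using env_agree[OF assms m1(1)] by simp
  have "druns width (UnitRow (Reg 8) (Op Add (Reg 7) (Reg 10)) (Const 1)) m1 w1 (3 * dmn + 2)
    (\<lambda>m' w'. agree 11 m1 m' \<and> w' = w1 @ map (\<lambda>j. if chk + r + i = j then 1 else 0) [0..<dmn])"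
    by (rule runs_unit_row) (use e m1 param_less_width in \<open>auto simp: env_def agree_def\<close>)
  then show "druns width (UnitRow (Reg 8) (Op Add (Reg 7) (Reg 10)) (Const 1)) m1 w1 (3 * dmn + 2)
    (\<lambda>m' w'. agree (Suc 10) m1 m' \<and> w' = w1 @ unit_row dmn (chk + r + i) 1)"
    by (rule runs_weaken) (auto simp: unit_row_def)
qed (use assms param_less_width in \<open>auto simp: env_def agree_def\<close>)

lemma runs_proj_rows:
  assumes "env m"
  shows "druns width ProjRows m w (r * (3 * dmn + 2 + 2) + 2)
    (\<lambda>m' w'. agree 10 m m' \<and> w' = w @ concat (map (\<lambda>i. unit_row dmn (chk + i) 1) [0..<r]))"
  unfolding ProjRows_def
proof (rule druns_for_rows)
  fix i m1 w1 assume i: "i < r" and m1: "agree 10 m m1" "m1 10 = int i"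
  have e: "env m1" using env_agree[OF assms m1(1)] by simp
  have "druns width (UnitRow (Reg 8) (Op Add (Reg 1) (Reg 10)) (Const 1)) m1 w1 (3 * dmn + 2)
    (\<lambda>m' w'. agree 11 m1 m' \<and> w' = w1 @ map (\<lambda>j. if chk + i = j then 1 else 0) [0..<dmn])"
    by (rule runs_unit_row) (use e m1 param_less_width in \<open>auto simp: env_def agree_def\<close>)
  then show "druns width (UnitRow (Reg 8) (Op Add (Reg 1) (Reg 10)) (Const 1)) m1 w1 (3 * dmn + 2)
    (\<lambda>m' w'. agree (Suc 10) m1 m' \<and> w' = w1 @ unit_row dmn (chk + i) 1)"
    by (rule runs_weaken) (auto simp: unit_row_def)
qed (use assms param_less_width in \<open>auto simp: env_def agree_def\<close>)

definition "dig P i = P div blk ^ i mod blk" for P i :: nat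

text \<open>Coordinate \<open>j\<close> of \<open>H u\<close> for the vector encoded by
  \<open>P\<close>, as a plain integer: nothing is reduced modulo \<open>prm\<close>, neither here
  nor in the shift that is written out. The reduction is left to the coefficients \<open>g\<close>
  of the lattice.\<close>

definition "syn P j = (\<Sum>i<wgt. (i * blk + dig P i) ^ j)" for P j :: nat

lemma blk_pos: "0 < blk" by (simp add: blk_def)

lemma dig_less: "dig P i < blk" using blk_pos by (simp add: dig_def)

lemma position_less: "i < wgt \<Longrightarrow> i * blk + dig P i < pts"
proof -
  assume "i < wgt"
  then have "Suc i * blk \<le> pts" unfolding pts_def by (intro mult_right_mono) auto
  then show ?thesis using dig_less[of P i] by simp
qed

lemma partial_syn_bound:
  assumes "j < chk" "n \<le> wgt"
  shows "int (\<Sum>i<n. (i * blk + dig P i) ^ j) < 2 ^ width"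
proof -
  let ?X = "dmn + prm + 2"
  have "(\<Sum>i<n. (i * blk + dig P i) ^ j) \<le> (\<Sum>i<n. ?X ^ chk)"
  proof (rule sum_mono)
    fix i assume "i \<in> {..<n}"
    then have "i * blk + dig P i \<le> ?X" using position_less[of i P] assms by (simp add: dmn_def)
    then show "(i * blk + dig P i) ^ j \<le> ?X ^ chk"
      using assms by (intro order_trans[OF power_mono power_increasing]) auto
  qed
  also have "\<dots> = n * ?X ^ chk" by simp
  also have "\<dots> \<le> ?X * ?X ^ chk" using assms wgt_le_pts by (intro mult_right_mono) (auto simp: dmn_def)
  also have "\<dots> = ?X ^ (chk + 1)" by simp
  finally have "int (\<Sum>i<n. (i * blk + dig P i) ^ j) \<le> int (?X ^ (chk + 1))" by (simp only: of_nat_le_iff)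
  also have "\<dots> = int ?X ^ (chk + 1)" by (simp only: of_nat_power)
  also have "\<dots> < 2 ^ width" using chk_less_wgt by (intro pow_less_width) auto
  finally show ?thesis .
qed

lemma runs_shift_head:
  assumes "env m" "m 9 = int P" "P < blk ^ wgt"
  shows "druns width ShiftHead m w (chk * ((wgt * (3 * chk + 7) + 5) + 2) + 2)
    (\<lambda>m' w'. agree 10 m m' \<and> w' = w @ concat (map (\<lambda>j. [- int (blk * syn P j)]) [0..<chk]))"
  unfolding ShiftHead_def
proof (rule druns_for_rows)
  fix j m1 and w1 :: "int list" assume j: "j < chk" and m1: "agree 10 m m1" "m1 10 = int j"
  have e: "env m1" using env_agree[OF assms(1) m1(1)] by simp
  have P: "m1 9 = int P" using m1 assms by (simp add: agree_def)
  have Pbd: "int P < 2 ^ width"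
  proof -
    have "int P < int (blk ^ wgt)" using assms(3) by (simp only: of_nat_less_iff)
    also have "\<dots> = int blk ^ wgt" by (simp only: of_nat_power)
    also have "\<dots> < 2 ^ width" using blk_le_pts by (intro pow_less_width) (auto simp: dmn_def)
    finally show ?thesis .
  qed
  let ?base = "Op Add (Op Mul (Reg 11) (Reg 5)) (Op Mod (Reg 13) (Reg 5))"
  let ?body = "Seq (PowProg ?base (Reg 10))
          (Seq (Assign 12 (Op Add (Reg 12) (Reg 15))) (Assign 13 (Op Div (Reg 13) (Reg 5))))"
  let ?S = "\<lambda>n. \<Sum>i<n. (i * blk + dig P i) ^ j"
  let ?m2 = "m1(12 := expr_val (Const 0) m1)"
  let ?m3 = "?m2(13 := expr_val (Reg 9) ?m2)"
  let ?I = "\<lambda>i m' w'. agree 11 m1 m' \<and> m' 11 = int i \<and> m' 12 = int (?S i) \<and> m' 13 = int (P div blk ^ i) \<and> w' = w1"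
  have loop: "druns width (For 11 (Reg 2) ?body) ?m3 w1 (wgt * ((3 * chk + 3 + Suc 1) + 2) + 2) (?I wgt)"
  proof (rule runs_for_det[where I = ?I])
    fix i m4 w4 assume i: "i < wgt" and I: "?I i m4 w4"
    have e4: "env m4" using env_agree[OF e, of 11 m4] I by simp
    have "druns width ?body m4 w4 ((3 * j + 3) + Suc 1)
       (\<lambda>m' w'. m' 11 = int i \<and> ?I (Suc i) (m'(11 := int (Suc i))) w')"
    proof (rule runs_seq_det[OF runs_pow[where x = "i * blk + dig P i" and y = j]])
      show "expr_val ?base m' = int (i * blk + dig P i) \<and> expr_val (Reg 10) m' = int j" if "agree 15 m4 m'" for m'
        using that I m1 e4 by (simp add: agree_def env_def dig_def zmod_int)
      show "int (i * blk + dig P i) ^ j < 2 ^ width"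
        using position_less[OF i, of P] j chk_less_wgt by (intro pow_less_width) (auto simp: dmn_def)
      show "int j < 2 ^ width" using j param_less_width(2) by linarith
      fix m5 w5 assume m5: "agree 15 m4 m5 \<and> m5 15 = int (i * blk + dig P i) ^ j \<and> w5 = w4"
      have v: "m5 5 = int blk" "m5 11 = int i" "m5 12 = int (?S i)" "m5 13 = int (P div blk ^ i)"
        using m5 I e4 by (auto simp: agree_def env_def)
      have s12: "expr_val (Op Add (Reg 12) (Reg 15)) m5 = int (?S (Suc i))"
        using v m5 by simp
      let ?m6 = "m5(12 := expr_val (Op Add (Reg 12) (Reg 15)) m5)"
      have s13: "expr_val (Op Div (Reg 13) (Reg 5)) ?m6 = int (P div blk ^ Suc i)"
        unfolding power_Suc2 div_mult2_eq using v by (simp add: zdiv_int)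
      have "P div blk ^ Suc i \<le> P" by (rule div_le_dividend)
      then have b13: "int (P div blk ^ Suc i) < 2 ^ width" using Pbd by linarith
      have b12: "int (?S (Suc i)) < 2 ^ width" using i j by (intro partial_syn_bound) auto
      show "druns width (Seq (Assign 12 (Op Add (Reg 12) (Reg 15))) (Assign 13 (Op Div (Reg 13) (Reg 5)))) m5 w5
         (Suc 1) (\<lambda>m' w'. m' 11 = int i \<and> ?I (Suc i) (m'(11 := int (Suc i))) w')"
      proof (intro runs_assign_seq runs_assign)
        show "\<bar>expr_val (Op Add (Reg 12) (Reg 15)) m5\<bar> < 2 ^ width" unfolding s12 using b12 by linarith
        show "\<bar>expr_val (Op Div (Reg 13) (Reg 5)) ?m6\<bar> < 2 ^ width" unfolding s13 using b13 by linarith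
        show "(?m6(13 := expr_val (Op Div (Reg 13) (Reg 5)) ?m6)) 11 = int i \<and>
          ?I (Suc i) ((?m6(13 := expr_val (Op Div (Reg 13) (Reg 5)) ?m6))(11 := int (Suc i))) w5"
          unfolding s13 unfolding s12 using m5 I v by (auto simp: agree_def simp del: sum.lessThan_Suc)
      qed
    qed
    then show "druns width ?body m4 w4 (3 * chk + 3 + Suc 1)
       (\<lambda>m' w'. m' 11 = int i \<and> ?I (Suc i) (m'(11 := int (Suc i))) w')"
      by (rule runs_weaken) (use j in auto)
  next
    show "m' 11 = int i \<and> expr_val (Reg 2) m' = int wgt" if "?I i m' w'" for i m' w'
      using that env_agree[OF e, of 11 m'] by (auto simp: env_def)
  qed (use e P param_less_width in \<open>auto simp: env_def agree_def\<close>)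
  have "druns width (Seq (Assign 12 (Const 0)) (Seq (Assign 13 (Reg 9)) (Seq (For 11 (Reg 2) ?body)
       (Write (Op Sub (Const 0) (Op Mul (Reg 5) (Reg 12))))))) m1 w1
     (Suc (Suc ((wgt * ((3 * chk + 3 + Suc 1) + 2) + 2) + 1)))
     (\<lambda>m' w'. agree (Suc 10) m1 m' \<and> w' = w1 @ [- int (blk * syn P j)])"
  proof (rule runs_assign_seq, goal_cases)
    case 2
    show ?case
    proof (rule runs_assign_seq, goal_cases)
      case 2
      show ?case
      proof (rule runs_seq_det[OF loop])
        fix m4 w4 assume "?I wgt m4 w4"
        then show "druns width (Write (Op Sub (Const 0) (Op Mul (Reg 5) (Reg 12)))) m4 w4 1
          (\<lambda>m' w'. agree (Suc 10) m1 m' \<and> w' = w1 @ [- int (blk * syn P j)])"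
          using env_agree[OF e, of 11 m4] by (intro runs_write) (auto simp: env_def syn_def agree_def)
      qed
    qed (use P Pbd in simp)
  qed simp
  then show "druns width (Seq (Assign 12 (Const 0)) (Seq (Assign 13 (Reg 9)) (Seq (For 11 (Reg 2) ?body)
       (Write (Op Sub (Const 0) (Op Mul (Reg 5) (Reg 12))))))) m1 w1 (wgt * (3 * chk + 7) + 5)
     (\<lambda>m' w'. agree (Suc 10) m1 m' \<and> w' = w1 @ [- int (blk * syn P j)])"
    by (rule runs_weaken) auto
qed (use assms param_less_width in \<open>auto simp: env_def agree_def\<close>)

end

section \<open>Reading the input and assembling the whole program\<close>

definition Emit :: prog where
  "Emit = Seq (Write (Reg 8)) (Seq (Write (Reg 8)) (Seq (Write (Op Mul (Const 2) (Reg 1)))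
     (Seq TopRows (Seq MidRows (Seq BotRows (Seq ShiftHead
       (Seq (UnitRow (Op Sub (Reg 8) (Reg 1)) (Reg 8) (Const 0)) ProjRows)))))))"

text \<open>An exhausted tape reads as 0, so a zero in register 10 marks the end of the unary
  input.\<close>

definition ReadLoop :: prog where
  "ReadLoop = WhilePos (Reg 10) (Seq (Assign 0 (Op Add (Reg 0) (Const 1))) (Read (Const (int 10))))"

definition Main :: "nat \<Rightarrow> prog" where
  "Main b = Seq (Seq (Read (Const (int 10))) ReadLoop) (Seq (Setup b) (Seq DrawShift Emit))"

lemma exec_seq_return:
  "exec c s (return_pmf t) \<Longrightarrow> exec d t \<mu> \<Longrightarrow> exec (Seq c d) s \<mu>"
  using exec.Seq[of c s "return_pmf t" d "\<lambda>_. \<mu>"] by (simp add: bind_return_pmf)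

text \<open>\<open>runs\<close> says nothing about the input tape, so the reading phase is followed
  state by state. It tosses no coins and its distributions are point masses.\<close>

lemma exec_read_iteration:
  fixes s :: ram
  assumes s: "mem s = (\<lambda>_. 0)(0 := int c, 10 := 1)" "read_head s \<in> {0, 1}" "int (c + 1) < 2 ^ L" "0 < L"
  shows "\<exists>s'. exec (Seq (Assign 0 (Op Add (Reg 0) (Const 1))) (Read (Const (int 10)))) (charge (Reg 10) s) (return_pmf s') \<and>
    mem s' = (\<lambda>_. 0)(0 := int (c + 1), 10 := read_head s) \<and> inp s' = tl (inp s) \<and> out s' = out s \<and>
    cost s' \<le> cost s + L * prog_weight ReadLoop"
proof -
  let ?e = "Op Add (Reg 0) (Const 1)"
  define s1 where "s1 = charge (Reg 10) s"
  define s2 where "s2 = set_reg (value_of (Const (int 0)) s1) (value_of ?e s1) (charge (Const (int 0)) (charge ?e s1))"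
  define s3 where "s3 = set_reg (value_of (Const (int 10)) s2) (read_head s2) (charge (Const (int 10)) (s2\<lparr>inp := tl (inp s2)\<rparr>))"
  have 1: "(1::int) < 2 ^ L" using s(4) by simp
  moreover have "int c < 2 ^ L" using s(3) by linarith
  ultimately have bd: "mem_bounded L (mem s)" using s(1,4) by (auto simp: mem_bounded_def)
  have e: "value_of ?e s1 = int (c + 1)" using s by (simp add: s1_def charge_def value_of_def)
  have m2: "mem s2 = (\<lambda>_. 0)(0 := int (c + 1), 10 := 1)"
    using s e by (auto simp: s2_def s1_def charge_def set_reg_def value_of_def)
  have rh: "read_head s2 = read_head s" by (simp add: s2_def s1_def charge_def set_reg_def read_head_def)
  have m3: "mem s3 = (\<lambda>_. 0)(0 := int (c + 1), 10 := read_head s)"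
    using m2 rh by (auto simp: s3_def charge_def set_reg_def value_of_def)
  have o3: "inp s3 = tl (inp s)" "out s3 = out s"
    by (simp_all add: s3_def s2_def s1_def charge_def set_reg_def)
  have "bits (int (c + 1)) \<le> Suc L" using s(3) by (intro bits_le) simp
  moreover have "bits (read_head s) \<le> Suc 1" using s(2) by (intro bits_le) auto
  moreover have "expr_cost (Reg 10) (mem s) \<le> L * expr_weight (Reg 10)" "expr_cost ?e (mem s) \<le> L * expr_weight ?e"
    "expr_cost (Const (int 10)) (mem s) \<le> L * expr_weight (Const (int 10))"
    "expr_cost (Const (int 0)) (mem s) \<le> L * expr_weight (Const (int 0))"
    by (rule expr_cost_bound[OF bd])+
  moreover have "cost s3 = cost s + (1 + expr_cost (Reg 10) (mem s)) + (1 + expr_cost ?e (mem s))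
     + (1 + expr_cost (Const (int 0)) (mem s)) + bits (int (c + 1)) + (1 + expr_cost (Const (int 10)) (mem s)) + bits (read_head s)"
    unfolding s3_def using rh e by (simp add: s2_def s1_def charge_def set_reg_def value_of_def add.commute)
  moreover have "L * prog_weight ReadLoop = L + L * expr_weight (Reg 10) + (L * 4 + L * expr_weight (Const (int 0)) + L * expr_weight ?e)
      + (L * 3 + L * expr_weight (Const (int 10)))"
    unfolding ReadLoop_def prog_weight.simps by (simp only: add_mult_distrib2 mult_1_right add_ac)
  ultimately have "cost s3 \<le> cost s + L * prog_weight ReadLoop" using s(4) by linarith
  moreover have "exec (Seq (Assign 0 ?e) (Read (Const (int 10)))) s1 (return_pmf s3)"
    unfolding s3_def by (rule exec_seq_return[OF _ exec.Read]) (unfold s2_def, rule exec.Store)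
  ultimately show ?thesis using m3 o3 unfolding s1_def by blast
qed

lemma exec_read_loop:
  fixes s :: ram
  assumes "mem s = (\<lambda>_. 0)(0 := int c, 10 := of_bool (0 < j))" "inp s = replicate (j - 1) 1" "out s = []"
    "int (c + j) < 2 ^ L" "0 < L"
  shows "\<exists>s'. exec ReadLoop s (return_pmf s') \<and> mem s' = (\<lambda>_. 0)(0 := int (c + j)) \<and> out s' = [] \<and>
    cost s' \<le> cost s + L * prog_weight ReadLoop * (j + 1)"
  using assms
proof (induction j arbitrary: c s)
  case (0 c s)
  let ?s = "charge (Reg 10) s"
  have m: "mem s = (\<lambda>_. 0)(0 := int c)" using 0 by auto
  then have "mem_bounded L (mem s)" using 0 by (auto simp: mem_bounded_def)
  then have "expr_cost (Reg 10) (mem s) \<le> L * expr_weight (Reg 10)" by (rule expr_cost_bound)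
  moreover have "cost ?s = cost s + 1 + expr_cost (Reg 10) (mem s)" by (simp add: charge_def)
  moreover have "L * (1 + expr_weight (Reg 10)) \<le> L * prog_weight ReadLoop"
    unfolding ReadLoop_def prog_weight.simps by (intro mult_le_mono2) simp
  ultimately have "cost ?s \<le> cost s + L * prog_weight ReadLoop"
    using \<open>0 < L\<close> unfolding add_mult_distrib2 by linarith
  moreover have "exec ReadLoop s (return_pmf ?s)"
    unfolding ReadLoop_def by (rule exec.WhileFalse) (simp add: value_of_def m)
  ultimately show ?case using m 0 by (intro exI[of _ ?s]) (simp add: charge_def)
next
  case (Suc j c s)
  have m: "mem s = (\<lambda>_. 0)(0 := int c, 10 := 1)" using Suc.prems(1) by (simp only: zero_less_Suc of_bool_eq)
  have head: "read_head s = of_bool (0 < j)" using Suc.prems(2) by (cases j) (simp_all add: read_head_def)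
  then obtain s1 where s1: "exec (Seq (Assign 0 (Op Add (Reg 0) (Const 1))) (Read (Const (int 10)))) (charge (Reg 10) s) (return_pmf s1)"
    "mem s1 = (\<lambda>_. 0)(0 := int (c + 1), 10 := of_bool (0 < j))" "inp s1 = tl (inp s)" "out s1 = out s"
    "cost s1 \<le> cost s + L * prog_weight ReadLoop"
    using exec_read_iteration[OF m, of L] Suc.prems by auto
  have i1: "inp s1 = replicate (j - 1) 1" using s1(3) Suc.prems(2) by (cases j) simp_all
  have o1: "out s1 = []" using s1(4) Suc.prems(3) by simp
  have b1: "int (c + 1 + j) < 2 ^ L" using Suc.prems(4) by (simp only: add_Suc_right add_Suc add_0_right One_nat_def)
  from Suc.IH[OF s1(2) i1 o1 b1 Suc.prems(5)] obtain s2 where s2: "exec ReadLoop s1 (return_pmf s2)" "mem s2 = (\<lambda>_. 0)(0 := int (c + 1 + j))" "out s2 = []"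
    "cost s2 \<le> cost s1 + L * prog_weight ReadLoop * (j + 1)"
    by blast
  have "exec ReadLoop s (return_pmf s2)"
    unfolding ReadLoop_def
    by (rule exec.WhileTrue) (use m exec_seq_return[OF s1(1) s2(1)[unfolded ReadLoop_def]] in \<open>simp_all add: value_of_def\<close>)
  moreover have "cost s2 \<le> cost s + L * prog_weight ReadLoop * (Suc j + 1)"
    using s1(5) s2(4) by (simp add: algebra_simps)
  ultimately show ?case using s2 by (intro exI[of _ s2]) simp
qed

lemma exec_read_input:
  assumes "int (r0 + 1) < 2 ^ L" "0 < L"
  shows "\<exists>s'. exec (Seq (Read (Const (int 10))) ReadLoop) (initial (unary r0)) (return_pmf s') \<and>
    mem s' = (\<lambda>_. 0)(0 := int r0) \<and> out s' = [] \<and>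
    cost s' \<le> L * prog_weight (Seq (Read (Const (int 10))) ReadLoop) * (r0 + 2)"
proof -
  let ?s = "initial (unary r0)"
  define s1 where "s1 = set_reg (value_of (Const (int 10)) ?s) (read_head ?s)
     (charge (Const (int 10)) (?s\<lparr>inp := tl (inp ?s)\<rparr>))"
  have ex: "exec (Read (Const (int 10))) ?s (return_pmf s1)" unfolding s1_def by (rule exec.Read)
  have head: "read_head ?s = of_bool (0 < r0)" by (cases r0) (simp_all add: read_head_def initial_def unary_def)
  have m1: "mem s1 = (\<lambda>_. 0)(0 := int 0, 10 := of_bool (0 < r0))" "inp s1 = replicate (r0 - 1) 1" "out s1 = []"
    using head by (cases r0; auto simp: s1_def set_reg_def charge_def initial_def value_of_def unary_def)+
  have "bits (of_bool (0 < r0)) \<le> Suc 1" by (intro bits_le) auto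
  moreover have "cost s1 = 1 + bits (int 10) + bits (of_bool (0 < r0))"
    using head by (simp add: s1_def set_reg_def charge_def initial_def)
  moreover have "bits (int 10) \<le> L * bits (int 10)" using assms by simp
  moreover have "L * prog_weight (Read (Const (int 10))) = L * 3 + L * bits (int 10)" by (simp add: algebra_simps)
  ultimately have c1: "cost s1 \<le> L * prog_weight (Read (Const (int 10)))" using assms(2) by linarith
  have r0: "int (0 + r0) < 2 ^ L" using assms(1) by linarith
  obtain s2 where s2: "exec ReadLoop s1 (return_pmf s2)" "mem s2 = (\<lambda>_. 0)(0 := int r0)" "out s2 = []"
    "cost s2 \<le> cost s1 + L * prog_weight ReadLoop * (r0 + 1)"
    using exec_read_loop[OF m1, of L] r0 assms(2) by auto
  have "cost s2 \<le> L * prog_weight (Read (Const (int 10))) + L * prog_weight ReadLoop * (r0 + 1)"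
    using c1 s2(4) by linarith
  also have "\<dots> \<le> L * prog_weight (Seq (Read (Const (int 10))) ReadLoop) * (r0 + 2)"
    by (simp add: algebra_simps del: prog_weight.simps(3))
  finally show ?thesis using exec_seq_return[OF ex s2(1)] s2 by blast
qed

context lattice_params
begin

definition "mat_data Ts =
   concat (map (\<lambda>i. unit_row (chk + r) i (int (blk * prm)) @ map (\<lambda>a. int blk * int a ^ i) [0..<pts]) [0..<chk])
   @ concat (map (\<lambda>i. unit_row (chk + r) (chk + i) (int blk) @ Ts ! i) [0..<r])
   @ concat (map (\<lambda>i. unit_row dmn (chk + r + i) 1) [0..<pts])"

definition "shift_data P = map (\<lambda>j. - int (blk * syn P j)) [0..<chk] @ replicate (r + pts) 0"

definition "proj_data = concat (map (\<lambda>i. unit_row dmn (chk + i) 1) [0..<r])"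

definition "output P Ts = [int dmn, int dmn, int (2 * chk)] @ mat_data Ts @ shift_data P @ proj_data"

definition "emit_steps =
  (chk * (3 * (chk + r) + 2 + (pts * (3 * chk + 6) + 2) + 2) + 2) +
  ((r * (3 * (chk + r) + 2 + (pts * (4 * lgb + 6) + 2) + 2) + 2) +
  ((pts * (3 * dmn + 2 + 2) + 2) +
  ((chk * ((wgt * (3 * chk + 7) + 5) + 2) + 2) +
  ((3 * (r + pts) + 2) + (r * (3 * dmn + 2 + 2) + 2)))))"

abbreviation "hash_pmf \<equiv> replicate_pmf r (replicate_pmf pts (pmf_of_set {0..<int blk}))"

lemma runs_emit:
  assumes e: "env m" "m 9 = int P" "P < blk ^ wgt"
  shows "runs width hash_pmf Emit m w (emit_steps + 3) (\<lambda>Ts m' w'. w' = w @ output P Ts)"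
proof -
  have 1: "druns width (Seq BotRows (Seq ShiftHead
       (Seq (UnitRow (Op Sub (Reg 8) (Reg 1)) (Reg 8) (Const 0)) ProjRows))) m1 w1
     ((pts * (3 * dmn + 2 + 2) + 2) + ((chk * ((wgt * (3 * chk + 7) + 5) + 2) + 2) +
     ((3 * (r + pts) + 2) + (r * (3 * dmn + 2 + 2) + 2))))
     (\<lambda>m' w'. w' = w1 @ concat (map (\<lambda>i. unit_row dmn (chk + r + i) 1) [0..<pts]) @ shift_data P @ proj_data)"
    if "agree 10 m m1" for m1 w1
  proof (rule runs_seq_det[OF runs_bot_rows])
    show e1: "env m1" using env_agree[OF e(1) that] by simp
    fix m2 w2 assume m2: "agree 10 m1 m2 \<and> w2 = w1 @ concat (map (\<lambda>i. unit_row dmn (chk + r + i) 1) [0..<pts])"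
    have e2: "env m2" using env_agree[OF e1, of 10 m2] m2 by simp
    have P2: "m2 9 = int P" using m2 that e by (simp add: agree_def)
    show "druns width (Seq ShiftHead
       (Seq (UnitRow (Op Sub (Reg 8) (Reg 1)) (Reg 8) (Const 0)) ProjRows)) m2 w2
     ((chk * ((wgt * (3 * chk + 7) + 5) + 2) + 2) + ((3 * (r + pts) + 2) + (r * (3 * dmn + 2 + 2) + 2)))
     (\<lambda>m' w'. w' = w1 @ concat (map (\<lambda>i. unit_row dmn (chk + r + i) 1) [0..<pts]) @ shift_data P @ proj_data)"
    proof (rule runs_seq_det[OF runs_shift_head[OF e2 P2 e(3)]])
      fix m3 w3 assume m3: "agree 10 m2 m3 \<and> w3 = w2 @ concat (map (\<lambda>j. [- int (blk * syn P j)]) [0..<chk])"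
      have e3: "env m3" using env_agree[OF e2, of 10 m3] m3 by simp
      show "druns width (Seq (UnitRow (Op Sub (Reg 8) (Reg 1)) (Reg 8) (Const 0)) ProjRows) m3 w3
         ((3 * (r + pts) + 2) + (r * (3 * dmn + 2 + 2) + 2))
         (\<lambda>m' w'. w' = w1 @ concat (map (\<lambda>i. unit_row dmn (chk + r + i) 1) [0..<pts]) @ shift_data P @ proj_data)"
      \<comment> \<open>The zero block of the shift, obtained as a unit row with entry 0.\<close>
      proof (rule runs_seq_det[OF runs_unit_row[where n = "r + pts" and i = dmn and x = 0]])
        show "int (r + pts) < 2 ^ width" using param_less_width(8) by (simp add: dmn_def)
        fix m4 w4 assume m4: "agree 11 m3 m4 \<and> w4 = w3 @ map (\<lambda>j. if dmn = j then 0 else 0) [0..<r + pts]"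
        have e4: "env m4" using env_agree[OF e3, of 11 m4] m4 by simp
        have z: "map (\<lambda>j. if dmn = j then 0 else 0) [0..<r + pts] = replicate (r + pts) (0::int)"
          by (simp add: map_replicate_const)
        have w4: "w4 = w1 @ concat (map (\<lambda>i. unit_row dmn (chk + r + i) 1) [0..<pts]) @ shift_data P"
          using m4 m3 m2 unfolding z shift_data_def by (simp add: concat_map_singleton)
        show "druns width ProjRows m4 w4 (r * (3 * dmn + 2 + 2) + 2)
          (\<lambda>m' w'. w' = w1 @ concat (map (\<lambda>i. unit_row dmn (chk + r + i) 1) [0..<pts]) @ shift_data P @ proj_data)"
          by (rule runs_weaken[OF runs_proj_rows[OF e4]]) (simp_all add: w4 proj_data_def)
      qed (use e3 in \<open>auto simp: env_def agree_def dmn_def\<close>)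
    qed
  qed
  have 2: "runs width hash_pmf (Seq TopRows (Seq MidRows (Seq BotRows (Seq ShiftHead
       (Seq (UnitRow (Op Sub (Reg 8) (Reg 1)) (Reg 8) (Const 0)) ProjRows))))) m w1 emit_steps
      (\<lambda>Ts m' w'. w' = w1 @ mat_data Ts @ shift_data P @ proj_data)" for w1
    unfolding emit_steps_def
  proof (rule runs_seq_det[OF runs_top_rows[OF e(1)]], rule runs_det_seq[OF runs_mid_rows])
    fix m2 w2 assume "agree 10 m m2 \<and> w2 = w1 @ concat (map (\<lambda>i. unit_row (chk + r) i (int (blk * prm)) @
        map (\<lambda>a. int blk * int a ^ i) [0..<pts]) [0..<chk])"
    note m2 = this
    show "env m2" using env_agree[OF e(1), of 10 m2] m2 by simp
    fix Ts m3 w3 assume m3: "agree 10 m2 m3 \<and> w3 = w2 @ concat (map (\<lambda>i. unit_row (chk + r) (chk + i) (int blk) @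
        Ts ! i) [0..<r])"
    have "agree 10 m m3" using m2 m3 agree_trans by blast
    then show "druns width (Seq BotRows (Seq ShiftHead
       (Seq (UnitRow (Op Sub (Reg 8) (Reg 1)) (Reg 8) (Const 0)) ProjRows))) m3 w3
     ((pts * (3 * dmn + 2 + 2) + 2) + ((chk * ((wgt * (3 * chk + 7) + 5) + 2) + 2) +
     ((3 * (r + pts) + 2) + (r * (3 * dmn + 2 + 2) + 2))))
     (\<lambda>m' w'. w' = w1 @ mat_data Ts @ shift_data P @ proj_data)"
      by (rule runs_weaken[OF 1]) (use m2 m3 in \<open>simp_all add: mat_data_def\<close>)
  qed
  have "runs width hash_pmf Emit m w (Suc (Suc (Suc emit_steps))) (\<lambda>Ts m' w'. w' = w @ output P Ts)"
    unfolding Emit_def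
    by (intro runs_write_seq runs_weaken[OF 2]) (use e in \<open>auto simp: env_def output_def\<close>)
  then show ?thesis by (rule runs_weaken) auto
qed

definition "body_steps = (4 * (prm + 1) * (prm + 1) + 2 * lgb + 11) +
   ((3 * wgt + 4 * (lgb * wgt) + 8) + (emit_steps + 3))"

lemma runs_body:
  assumes "m 0 = int r0" "r = max 1 r0"
  shows "runs width (pair_pmf (pmf_of_set {0..<int blk ^ wgt}) hash_pmf)
    (Seq (Setup b) (Seq DrawShift Emit)) m w body_steps (\<lambda>(P, Ts) m' w'. w' = w @ output (nat P) Ts)"
  unfolding body_steps_def
proof (rule runs_seq_det[OF runs_setup[of m r0, OF assms]])
  fix m1 w1 assume m1: "env m1 \<and> w1 = w"
  then have "env m1" by simp
  show "runs width (pair_pmf (pmf_of_set {0..<int blk ^ wgt}) hash_pmf) (Seq DrawShift Emit) m1 w1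
     ((3 * wgt + 4 * (lgb * wgt) + 8) + (emit_steps + 3)) (\<lambda>(P, Ts) m' w'. w' = w @ output (nat P) Ts)"
  proof (rule runs_seq[OF runs_draw_shift[OF \<open>env m1\<close>]])
    fix P m2 w2 assume P: "P \<in> set_pmf (pmf_of_set {0..<int blk ^ wgt})"
      and m2: "env m2 \<and> m2 9 = P \<and> w2 = w1"
    have "{0..<int blk ^ wgt} \<noteq> {}" using blk_pos by simp
    then have "0 \<le> P" "P < int blk ^ wgt" using P by auto
    then have "nat P < blk ^ wgt" "int (nat P) = P" by (auto simp: nat_less_iff)
    then show "runs width hash_pmf Emit m2 w2 (emit_steps + 3) (\<lambda>Ts m' w'. w' = w @ output (nat P) Ts)"
      using runs_emit[of m2 "nat P" w2] m2 m1 by simp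
  qed
qed

text \<open>All randomness is the pair of an independent uniform \<open>P\<close> and uniform hash
  tables, and the output is a function of it. Stated for \<open>r = max 1 r0\<close>, so that the
  cost bound also covers input 0.\<close>

lemma exec_main:
  assumes r: "r = max 1 r0"
  defines "\<nu> \<equiv> pair_pmf (pmf_of_set {0..<int blk ^ wgt}) hash_pmf"
  shows "\<exists>f. exec (Main b) (initial (unary r0)) (map_pmf f \<nu>) \<and>
    (\<forall>v \<in> set_pmf \<nu>. cost (f v) \<le> width * prog_weight (Main b) * (body_steps + r + 2) \<and>
      out (f v) = output (nat (fst v)) (snd v))"
proof -
  let ?R = "Seq (Read (Const (int 10))) ReadLoop" and ?B = "Seq (Setup b) (Seq DrawShift Emit)"
  have w: "0 < width" by (simp add: width_def)
  have r0: "r0 \<le> r" using r by simp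
  then have "int (r0 + 1) < 2 ^ width" by (intro less_width) (simp add: dmn_def)
  then obtain s1 where s1: "exec ?R (initial (unary r0)) (return_pmf s1)" "mem s1 = (\<lambda>_. 0)(0 := int r0)"
     "out s1 = []" "cost s1 \<le> width * prog_weight ?R * (r0 + 2)"
    using exec_read_input[OF _ w] by blast
  have "int r0 < 2 ^ width" using r0 by (intro less_width) (simp add: dmn_def)
  then have bd: "mem_bounded width ((\<lambda>_. 0)(0 := int r0))" using w by (auto simp: mem_bounded_def)
  have "runs width \<nu> ?B ((\<lambda>_. 0)(0 := int r0)) [] body_steps (\<lambda>(P, Ts) m' w'. w' = [] @ output (nat P) Ts)"
    unfolding \<nu>_def by (rule runs_body) (use r in auto)
  from runsD[OF this s1(2,3) bd] obtain f where f: "exec ?B s1 (map_pmf f \<nu>)"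
    "\<forall>v \<in> set_pmf \<nu>. cost (f v) \<le> cost s1 + width * prog_weight ?B * body_steps"
    "\<forall>v \<in> set_pmf \<nu>. (case v of (P, Ts) \<Rightarrow> \<lambda>m' w'. w' = [] @ output (nat P) Ts) (mem (f v)) (out (f v))"
    by (elim exE conjE) (rule that)
  have "exec (Main b) (initial (unary r0)) (map_pmf f \<nu>)"
    unfolding Main_def by (rule exec_seq_return[OF s1(1) f(1)])
  moreover have "cost (f v) \<le> width * prog_weight (Main b) * (body_steps + r + 2)" if "v \<in> set_pmf \<nu>" for v
  proof -
    have "cost (f v) \<le> width * prog_weight ?R * (r0 + 2) + width * prog_weight ?B * body_steps"
      using s1(4) bspec[OF f(2) that] by linarith
    also have "\<dots> \<le> width * prog_weight ?R * (body_steps + r + 2) + width * prog_weight ?B * (body_steps + r + 2)"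
      using r0 by (intro add_mono mult_left_mono) auto
    also have "\<dots> = width * prog_weight (Main b) * (body_steps + r + 2)"
      unfolding Main_def prog_weight.simps(6)[of ?R ?B] by (simp only: add_mult_distrib add_mult_distrib2)
    finally show ?thesis .
  qed
  moreover have "out (f v) = output (nat (fst v)) (snd v)" if "v \<in> set_pmf \<nu>" for v
    using bspec[OF f(3) that] by (cases v) simp
  ultimately show ?thesis by blast
qed

end

section \<open>The lattice\<close>

text \<open>For an integer \<open>x\<close> and \<open>p \<ge> 1\<close> one has
  \<open>\<bar>x\<bar> \<le> \<bar>x\<bar> powr p\<close>. An l1 bound on the lattice therefore
  serves all \<open>p\<close> at once.\<close>

lemma lp_norm_ge:
  fixes v :: "int vec"
  assumes p: "1 \<le> p" and l: "int l \<le> (\<Sum>i<dim_vec v. \<bar>v $ i\<bar>)"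
  shows "real l powr (1 / p) \<le> lp_norm p (map_vec real_of_int v)"
proof -
  have "real l \<le> real_of_int (\<Sum>i<dim_vec v. \<bar>v $ i\<bar>)" using l by linarith
  also have "\<dots> = (\<Sum>i<dim_vec v. \<bar>real_of_int (v $ i)\<bar>)" by simp
  also have "\<dots> \<le> (\<Sum>i<dim_vec v. \<bar>real_of_int (v $ i)\<bar> powr p)"
  proof (rule sum_mono)
    fix i
    show "\<bar>real_of_int (v $ i)\<bar> \<le> \<bar>real_of_int (v $ i)\<bar> powr p"
    proof (cases "v $ i = 0")
      case False
      then have "1 \<le> \<bar>real_of_int (v $ i)\<bar>" by linarith
      then show ?thesis using powr_mono[OF p, of "\<bar>real_of_int (v $ i)\<bar>"] by simp
    qed simp
  qed
  finally have "real l powr (1 / p) \<le> (\<Sum>i<dim_vec v. \<bar>real_of_int (v $ i)\<bar> powr p) powr (1 / p)"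
    using p by (intro powr_mono2) auto
  then show ?thesis by (simp add: lp_norm_def)
qed

lemma concat_map_split3:
  "concat (map f [0..<a + b + c]) = concat (map f [0..<a]) @ concat (map (\<lambda>i. f (a + i)) [0..<b])
     @ concat (map (\<lambda>i. f (a + b + i)) [0..<c])"
proof -
  have "map f [0..<a + b + c] = map f [0..<a] @ map (\<lambda>i. f (a + i)) [0..<b] @ map (\<lambda>i. f (a + b + i)) [0..<c]"
    by (rule nth_equalityI) (auto simp: nth_append)
  then show ?thesis by simp
qed

context lattice_params
begin

text \<open>Columns are ordered by the coefficients \<open>g\<close>, \<open>y\<close>,
  \<open>u\<close>, of lengths \<open>chk\<close>, \<open>r\<close>, \<open>pts\<close>. The
  convention \<open>0 ^ 0 = 1\<close> lets the point 0 count in the check row of exponent 0.\<close>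

definition ent :: "int list list \<Rightarrow> nat \<Rightarrow> nat \<Rightarrow> int" where
  "ent Ts i j =
    (if i < chk then if j < chk + r then if i = j then int (blk * prm) else 0 else int blk * int (j - (chk + r)) ^ i
     else if i < chk + r then if j < chk + r then if i = j then int blk else 0 else Ts ! (i - chk) ! (j - (chk + r))
     else if i = j then 1 else 0)"

definition "basis Ts = mat dmn dmn (\<lambda>(i, j). ent Ts i j)"

definition "shift P = vec dmn (\<lambda>i. if i < chk then - int (blk * syn P i) else 0)"

definition "proj = mat r dmn (\<lambda>(i, j). if chk + i = j then 1 else 0 :: int)"

definition "tables = {Ts. length Ts = r \<and> (\<forall>row \<in> set Ts. length row = pts \<and> set row \<subseteq> {0..<int blk})}"

text \<open>The numbers are written without separators, so the two lists agree only if every hash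
  row has length \<open>pts\<close> and there are \<open>r\<close> of them.\<close>

lemma output_eq_encode:
  assumes "Ts \<in> tables"
  shows "output P Ts = encode (basis Ts) (2 * chk) (shift P) proj"
proof -
  have len: "length Ts = r" "\<And>i. i < r \<Longrightarrow> length (Ts ! i) = pts" using assms by (auto simp: tables_def)
  have row: "map (\<lambda>j. ent Ts i j) [0..<dmn] = map (\<lambda>j. ent Ts i j) [0..<chk + r] @ map (\<lambda>a. ent Ts i (chk + r + a)) [0..<pts]" for i
    by (rule nth_equalityI) (auto simp: nth_append dmn_def)
  have "concat (mat_to_list (basis Ts)) = concat (map (\<lambda>i. map (\<lambda>j. ent Ts i j) [0..<dmn]) [0..<dmn])"
    by (auto simp: mat_to_list_def basis_def intro!: arg_cong[of _ _ concat])
  also have "\<dots> = concat (map (\<lambda>i. map (\<lambda>j. ent Ts i j) [0..<dmn]) [0..<chk + r + pts])"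
    by (simp only: dmn_def)
  also have "\<dots> = concat (map (\<lambda>i. map (\<lambda>j. ent Ts i j) [0..<dmn]) [0..<chk])
     @ concat (map (\<lambda>i. map (\<lambda>j. ent Ts (chk + i) j) [0..<dmn]) [0..<r])
     @ concat (map (\<lambda>i. map (\<lambda>j. ent Ts (chk + r + i) j) [0..<dmn]) [0..<pts])"
    by (rule concat_map_split3)
  also have "\<dots> = mat_data Ts"
    unfolding mat_data_def
  proof (intro arg_cong2[of _ _ _ _ "(@)"] arg_cong[of _ _ concat] map_cong refl)
    fix i assume "i \<in> set [0..<chk]"
    then show "map (\<lambda>j. ent Ts i j) [0..<dmn] = unit_row (chk + r) i (int (blk * prm)) @ map (\<lambda>a. int blk * int a ^ i) [0..<pts]"
      unfolding row by (auto simp: unit_row_def ent_def)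
  next
    fix i assume i: "i \<in> set [0..<r]"
    have "map (\<lambda>a. Ts ! i ! a) [0..<pts] = Ts ! i" using len(2)[of i] i map_nth[of "Ts ! i"] by simp
    then show "map (\<lambda>j. ent Ts (chk + i) j) [0..<dmn] = unit_row (chk + r) (chk + i) (int blk) @ Ts ! i"
      unfolding row using i by (auto simp: unit_row_def ent_def)
  next
    fix i assume "i \<in> set [0..<pts]"
    then show "map (\<lambda>j. ent Ts (chk + r + i) j) [0..<dmn] = unit_row dmn (chk + r + i) 1"
      by (auto simp: unit_row_def ent_def)
  qed
  finally have A: "concat (mat_to_list (basis Ts)) = mat_data Ts" .
  have x: "list_of_vec (shift P) = shift_data P"
    by (rule nth_equalityI) (auto simp: shift_def shift_data_def nth_append list_of_vec_index dmn_def)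
  have T: "concat (mat_to_list proj) = proj_data"
    by (auto simp: mat_to_list_def proj_def proj_data_def unit_row_def intro!: arg_cong[of _ _ concat])
  show ?thesis unfolding output_def encode_def A x T by (simp add: basis_def)
qed

lemma sum_dmn_split: "(\<Sum>j<dmn. f j) = (\<Sum>j<chk + r. f j) + (\<Sum>a<pts. f (chk + r + a))" for f :: "nat \<Rightarrow> 'a::comm_monoid_add"
proof -
  have "(\<Sum>j<dmn. f j) = (\<Sum>j\<in>{..<chk + r}. f j) + (\<Sum>j\<in>{chk + r..<dmn}. f j)"
    by (subst sum.union_disjoint[symmetric]) (auto simp: dmn_def intro!: sum.cong)
  also have "(\<Sum>j\<in>{chk + r..<dmn}. f j) = (\<Sum>a<pts. f (chk + r + a))"
    by (rule sum.reindex_bij_witness[of _ "\<lambda>a. chk + r + a" "\<lambda>j. j - (chk + r)"]) (auto simp: dmn_def)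
  finally show ?thesis .
qed

text \<open>Over an arbitrary commutative ring, since linear independence asks for real coefficients
  and the lattice for integral ones.\<close>

lemma basis_mult:
  fixes z :: "'a::comm_ring_1 vec" and Ts :: "int list list"
  assumes z: "z \<in> carrier_vec dmn"
  defines "v \<equiv> map_mat of_int (basis Ts) *\<^sub>v z"
  shows "i < chk \<Longrightarrow> v $ i = of_nat blk * (of_nat prm * z $ i + (\<Sum>a<pts. of_nat a ^ i * z $ (chk + r + a)))"
    and "i < r \<Longrightarrow> v $ (chk + i) = of_nat blk * z $ (chk + i) + (\<Sum>a<pts. of_int (Ts ! i ! a) * z $ (chk + r + a))"
    and "i < pts \<Longrightarrow> v $ (chk + r + i) = z $ (chk + r + i)"
proof -
  have v: "v $ i = (\<Sum>j<chk + r. of_int (ent Ts i j) * z $ j) + (\<Sum>a<pts. of_int (ent Ts i (chk + r + a)) * z $ (chk + r + a))"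
    if "i < dmn" for i
  proof -
    have "v $ i = (\<Sum>j<dmn. of_int (ent Ts i j) * z $ j)"
      using z that by (simp add: v_def basis_def scalar_prod_def atLeast0LessThan)
    then show ?thesis by (simp only: sum_dmn_split)
  qed
  have delta: "(\<Sum>j<chk + r. (if i = j then c else 0) * z $ j) = c * z $ i" if "i < chk + r" for i c
  proof -
    have "(\<Sum>j<chk + r. (if i = j then c else 0) * z $ j) = (\<Sum>j<chk + r. if i = j then c * z $ j else 0)"
      by (intro sum.cong) auto
    then show ?thesis using that by simp
  qed
  {
    assume i: "i < chk"
    have "(\<Sum>j<chk + r. of_int (ent Ts i j) * z $ j) = (\<Sum>j<chk + r. (if i = j then of_nat (blk * prm) else 0) * z $ j)"
      using i by (intro sum.cong) (auto simp: ent_def)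
    moreover have "(\<Sum>a<pts. of_int (ent Ts i (chk + r + a)) * z $ (chk + r + a))
        = (\<Sum>a<pts. of_nat blk * (of_nat a ^ i * z $ (chk + r + a)))"
      using i by (intro sum.cong) (auto simp: ent_def mult.assoc)
    ultimately show "v $ i = of_nat blk * (of_nat prm * z $ i + (\<Sum>a<pts. of_nat a ^ i * z $ (chk + r + a)))"
      using v[of i] delta[of i] i by (simp add: dmn_def sum_distrib_left[symmetric] algebra_simps)
  }
  {
    assume i: "i < r"
    have "(\<Sum>j<chk + r. of_int (ent Ts (chk + i) j) * z $ j) = (\<Sum>j<chk + r. (if chk + i = j then of_nat blk else 0) * z $ j)"
      using i by (intro sum.cong) (auto simp: ent_def)
    moreover have "(\<Sum>a<pts. of_int (ent Ts (chk + i) (chk + r + a)) * z $ (chk + r + a))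
        = (\<Sum>a<pts. of_int (Ts ! i ! a) * z $ (chk + r + a))"
      using i by (intro sum.cong) (auto simp: ent_def)
    ultimately show "v $ (chk + i) = of_nat blk * z $ (chk + i) + (\<Sum>a<pts. of_int (Ts ! i ! a) * z $ (chk + r + a))"
      using v[of "chk + i"] delta[of "chk + i"] i by (simp add: dmn_def)
  }
  {
    assume i: "i < pts"
    have "(\<Sum>j<chk + r. of_int (ent Ts (chk + r + i) j) * z $ j) = 0"
      by (intro sum.neutral) (auto simp: ent_def)
    moreover have "(\<Sum>a<pts. of_int (ent Ts (chk + r + i) (chk + r + a)) * z $ (chk + r + a))
        = (\<Sum>a<pts. if i = a then z $ (chk + r + a) else 0)"
      by (intro sum.cong) (auto simp: ent_def)
    ultimately show "v $ (chk + r + i) = z $ (chk + r + i)"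
      using v[of "chk + r + i"] i by (simp add: dmn_def)
  }
qed

lemma basis_mult_int:
  assumes z: "z \<in> carrier_vec dmn"
  shows "i < chk \<Longrightarrow> (basis Ts *\<^sub>v z) $ i = int blk * (int prm * z $ i + (\<Sum>a<pts. int a ^ i * z $ (chk + r + a)))"
    and "i < r \<Longrightarrow> (basis Ts *\<^sub>v z) $ (chk + i) = int blk * z $ (chk + i) + (\<Sum>a<pts. Ts ! i ! a * z $ (chk + r + a))"
    and "i < pts \<Longrightarrow> (basis Ts *\<^sub>v z) $ (chk + r + i) = z $ (chk + r + i)"
proof -
  have "map_mat of_int (basis Ts) = basis Ts" by (rule eq_matI) auto
  then show "i < chk \<Longrightarrow> (basis Ts *\<^sub>v z) $ i = int blk * (int prm * z $ i + (\<Sum>a<pts. int a ^ i * z $ (chk + r + a)))"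
    and "i < r \<Longrightarrow> (basis Ts *\<^sub>v z) $ (chk + i) = int blk * z $ (chk + i) + (\<Sum>a<pts. Ts ! i ! a * z $ (chk + r + a))"
    and "i < pts \<Longrightarrow> (basis Ts *\<^sub>v z) $ (chk + r + i) = z $ (chk + r + i)"
    using basis_mult[OF z, of _ Ts] by simp_all
qed

lemma pts_pos: "0 < pts" using wgt_pos blk_pos by (simp add: pts_def)

lemma dmn_cases:
  assumes "i < dmn"
  obtains "i < chk" | i' where "i = chk + i'" "i' < r" | a where "i = chk + r + a" "a < pts"
proof (cases "i < chk")
  case False
  show ?thesis
  proof (cases "i < chk + r")
    case True
    then show ?thesis using False that(2)[of "i - chk"] by simp
  next
    case False
    then show ?thesis using assms that(3)[of "i - (chk + r)"] by (simp add: dmn_def)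
  qed
qed (rule that(1))

text \<open>Independence is back substitution in the triangular matrix: \<open>u\<close> vanishes,
  then \<open>y\<close>, then \<open>g\<close>.\<close>

lemma ld_shape_basis: "ld_shape r dmn (basis Ts) (2 * chk) (shift P) proj"
proof -
  have "z = 0\<^sub>v dmn" if z: "z \<in> carrier_vec dmn" and 0: "map_mat real_of_int (basis Ts) *\<^sub>v z = 0\<^sub>v dmn" for z
  proof -
    have v: "(map_mat real_of_int (basis Ts) *\<^sub>v z) $ i = 0" if "i < dmn" for i using 0 that by simp
    have u: "z $ (chk + r + a) = 0" if "a < pts" for a
      using basis_mult(3)[OF z that, of Ts] v[of "chk + r + a"] that by (simp add: dmn_def)
    have B: "real blk \<noteq> 0" "real prm \<noteq> 0" using blk_pos prime_gt_0_nat[OF prm(1)] by auto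
    have y: "z $ (chk + i) = 0" if "i < r" for i
      using basis_mult(2)[OF z that, of Ts] v[of "chk + i"] that u B by (simp add: dmn_def)
    have g: "z $ i = 0" if "i < chk" for i
      using basis_mult(1)[OF z that, of Ts] v[of i] that u B by (simp add: dmn_def)
    show ?thesis
    proof (rule eq_vecI)
      fix i assume "i < dim_vec (0\<^sub>v dmn :: real vec)"
      then have i: "i < dmn" by simp
      then show "z $ i = 0\<^sub>v dmn $ i" using u y g by (cases rule: dmn_cases[OF i]) auto
    qed (use z in simp)
  qed
  then have "independent_cols (map_mat real_of_int (basis Ts))"
    by (auto simp: independent_cols_def basis_def)
  then show ?thesis using r_pos chk_pos by (simp add: ld_shape_def basis_def shift_def proj_def dmn_def)
qed

text \<open>A nonzero check coordinate is a multiple of \<open>blk \<ge> 2 * chk\<close>. If all of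
  them vanish, \<open>u\<close> lies in the kernel modulo \<open>prm\<close>, and a small norm
  forces \<open>u = 0\<close>; then the hash coordinates are multiples of \<open>blk\<close> too,
  whatever the table. The bound is thus independent of the coins.\<close>

lemma lattice_l1:
  assumes z: "z \<in> carrier_vec dmn" and nz: "basis Ts *\<^sub>v z \<noteq> 0\<^sub>v dmn"
  shows "int (2 * chk) \<le> (\<Sum>i<dmn. \<bar>(basis Ts *\<^sub>v z) $ i\<bar>)"
proof -
  define v where "v = basis Ts *\<^sub>v z"
  have single: "int (2 * chk) \<le> (\<Sum>i<dmn. \<bar>v $ i\<bar>)" if "i < dmn" "v $ i = int blk * c" "c \<noteq> 0" for i c
  proof -
    have "int blk * 1 \<le> int blk * \<bar>c\<bar>" using that by (intro mult_left_mono) auto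
    then have "int (2 * chk) \<le> \<bar>v $ i\<bar>" using chk_le_blk that by (simp add: abs_mult)
    also have "\<dots> \<le> (\<Sum>i<dmn. \<bar>v $ i\<bar>)" using that by (intro member_le_sum) auto
    finally show ?thesis .
  qed
  show ?thesis unfolding v_def[symmetric]
  proof (cases "\<exists>i<chk. v $ i \<noteq> 0")
    case True
    then obtain i where "i < chk" "v $ i \<noteq> 0" by blast
    then show "int (2 * chk) \<le> (\<Sum>i<dmn. \<bar>v $ i\<bar>)"
      using basis_mult_int(1)[OF z, of i Ts] by (intro single[of i]) (auto simp: v_def dmn_def)
  next
    case False
    show "int (2 * chk) \<le> (\<Sum>i<dmn. \<bar>v $ i\<bar>)"
    proof (rule ccontr)
      assume small: "\<not> ?thesis"
      let ?u = "\<lambda>a. z $ (chk + r + a)"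
      have "(\<Sum>a<pts. \<bar>?u a\<bar>) = (\<Sum>a<pts. \<bar>v $ (chk + r + a)\<bar>)"
        using basis_mult_int(3)[OF z] by (intro sum.cong) (auto simp: v_def)
      also have "\<dots> \<le> (\<Sum>i<dmn. \<bar>v $ i\<bar>)"
        unfolding sum_dmn_split by (simp add: sum_nonneg)
      finally have le: "(\<Sum>a<pts. \<bar>?u a\<bar>) < 2 * int chk" using small by simp
      have ker: "int prm dvd (\<Sum>a<pts. ?u a * int a ^ j)" if "j < chk" for j
      proof -
        have "int blk * (int prm * z $ j + (\<Sum>a<pts. int a ^ j * ?u a)) = 0"
          using False that basis_mult_int(1)[OF z that, of Ts] by (simp add: v_def)
        then have "(\<Sum>a<pts. ?u a * int a ^ j) = int prm * (- z $ j)"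
          using blk_pos by (simp add: mult.commute)
        then show ?thesis by simp
      qed
      have "2 * chk \<le> prm" using chk_less_wgt prm_lb_ge prm(2) by linarith
      then have u0: "?u a = 0" if "a < pts" for a
        by (rule vandermonde_kernel_l1[OF prm(1) _ pts_le ker le that])
      obtain i where i: "i < dmn" "v $ i \<noteq> 0"
      proof -
        have "dim_vec v = dmn" by (simp add: v_def basis_def)
        then show ?thesis using nz that unfolding v_def[symmetric] by (metis eq_vecI index_zero_vec(1) index_zero_vec(2))
      qed
      from i(1) show False
      proof (cases rule: dmn_cases)
        case 1
        then show False using False i by simp
      next
        case (2 i')
        then have "v $ i = int blk * z $ i" using basis_mult_int(2)[OF z, of i' Ts] u0 by (simp add: v_def)
        then show False using single[OF i(1)] i(2) small by auto
      next
        case (3 a)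
        then show False using basis_mult_int(3)[OF z, of a Ts] u0[of a] i by (simp add: v_def)
      qed
    qed
  qed
qed

lemma ld_min_dist_basis:
  assumes p: "1 \<le> p"
  shows "ld_min_dist p (basis Ts) (2 * chk)"
proof -
  have dim: "dim_row (basis Ts) = dmn" "dim_col (basis Ts) = dmn" by (simp_all add: basis_def)
  \<comment> \<open>The infimum in \<open>lambda1\<close> is meaningful only over a nonempty set.
    The first column of the part for \<open>u\<close> has a diagonal entry 1 and is a nonzero
    lattice vector.\<close>
  let ?z = "unit_vec dmn (chk + r) :: int vec"
  let ?S = "{lp_norm p (map_vec real_of_int v) | v. v \<in> lattice_gen (basis Ts) \<and> v \<noteq> 0\<^sub>v (dim_vec v)}"
  have "(basis Ts *\<^sub>v ?z) $ (chk + r + 0) = 1"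
    using basis_mult_int(3)[of ?z 0 Ts] pts_pos by (simp add: dmn_def)
  then have "basis Ts *\<^sub>v ?z \<noteq> 0\<^sub>v dmn" using pts_pos by (auto simp: dmn_def)
  then have "lp_norm p (map_vec real_of_int (basis Ts *\<^sub>v ?z)) \<in> ?S"
    using dim by (auto simp: lattice_gen_def)
  then have "?S \<noteq> {}" by blast
  moreover have "real (2 * chk) powr (1 / p) \<le> x" if "x \<in> ?S" for x
  proof -
    from that obtain z where z: "z \<in> carrier_vec dmn" "basis Ts *\<^sub>v z \<noteq> 0\<^sub>v dmn"
        "x = lp_norm p (map_vec real_of_int (basis Ts *\<^sub>v z))"
      using dim by (auto simp: lattice_gen_def)
    show ?thesis unfolding z(3) using lattice_l1[OF z(1,2)] dim by (intro lp_norm_ge[OF p]) simp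
  qed
  ultimately show ?thesis unfolding ld_min_dist_def lambda1_def by (intro cInf_greatest)
qed

text \<open>The binary vector encoded by \<open>P\<close>: block \<open>i\<close> is hit exactly
  once, at offset \<open>dig P i\<close>, whence its weight \<open>wgt\<close>.\<close>

definition "ind P a = (if a mod blk = dig P (a div blk) then 1 else 0 :: int)" for P a :: nat

lemma ind_power_sum: "(\<Sum>a<pts. ind P a * int a ^ j) = int (syn P j)"
proof -
  have "(\<Sum>a<pts. ind P a * int a ^ j) = (\<Sum>i<wgt. \<Sum>a = i * blk..<i * blk + blk. ind P a * int a ^ j)"
    unfolding pts_def by (rule sum.nat_group[symmetric])
  also have "\<dots> = (\<Sum>i<wgt. int (i * blk + dig P i) ^ j)"
  proof (rule sum.cong[OF refl])
    fix i
    have "(\<Sum>a = i * blk..<i * blk + blk. ind P a * int a ^ j)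
        = (\<Sum>a = i * blk..<i * blk + blk. if a = i * blk + dig P i then int a ^ j else 0)"
    proof (rule sum.cong[OF refl])
      fix a assume a: "a \<in> {i * blk..<i * blk + blk}"
      then obtain c where c: "a = i * blk + c" "c < blk" by (metis atLeastLessThan_iff le_Suc_ex nat_add_left_cancel_less)
      then have "a div blk = i" "a mod blk = c" by simp_all
      then show "ind P a * int a ^ j = (if a = i * blk + dig P i then int a ^ j else 0)"
        using c by (simp add: ind_def)
    qed
    then show "(\<Sum>a = i * blk..<i * blk + blk. ind P a * int a ^ j) = int (i * blk + dig P i) ^ j"
      using dig_less[of P i] by simp
  qed
  finally show ?thesis by (simp add: syn_def)
qed

lemma ind_sum: "(\<Sum>a<pts. ind P a) = int wgt"
  using ind_power_sum[of P 0] by (simp add: syn_def)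

lemma ld_dense_basis:
  assumes p: "1 \<le> p" and \<alpha>: "0 < \<alpha>" "real (b + 4) \<le> \<alpha> powr p * (2 * real b)"
    and hit: "\<And>w. (\<forall>i<r. w i \<in> {0, 1}) \<Longrightarrow> \<exists>P'. (\<forall>j<chk. [syn P' j = syn P j] (mod prm)) \<and>
        (\<forall>i<r. [(\<Sum>a<pts. Ts ! i ! a * ind P' a) = w i] (mod int blk))"
  shows "ld_dense p \<alpha> r (basis Ts) (2 * chk) (shift P) proj"
  unfolding ld_dense_def
proof
  fix w :: "int vec" assume "w \<in> {w \<in> carrier_vec r. \<forall>i<r. w $ i \<in> {0, 1}}"
  then have w: "dim_vec w = r" "\<And>i. i < r \<Longrightarrow> w $ i \<in> {0, 1}" by auto
  then obtain P' where P': "\<And>j. j < chk \<Longrightarrow> [syn P' j = syn P j] (mod prm)"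
      "\<And>i. i < r \<Longrightarrow> [(\<Sum>a<pts. Ts ! i ! a * ind P' a) = w $ i] (mod int blk)"
    using hit[of "\<lambda>i. w $ i"] by blast
  define v where "v = vec dmn (\<lambda>i. if i < chk then 0 else if i < chk + r then w $ (i - chk) else ind P' (i - (chk + r)))"
  \<comment> \<open>The coefficients \<open>(g, y, u')\<close> of the short vector: \<open>g\<close>
    absorbs the difference of the two syndromes and \<open>y\<close> the difference between
    \<open>w\<close> and the hash value. Both quotients are exact by the congruences for
    \<open>P'\<close>.\<close>
  define z where "z = vec dmn (\<lambda>i. if i < chk then (int (syn P i) - int (syn P' i)) div int prm
     else if i < chk + r then (w $ (i - chk) - (\<Sum>a<pts. Ts ! (i - chk) ! a * ind P' a)) div int blk
     else ind P' (i - (chk + r)))"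
  have z: "z \<in> carrier_vec dmn" by (simp add: z_def)
  have zu: "z $ (chk + r + a) = ind P' a" if "a < pts" for a using that by (simp add: z_def dmn_def)
  have "v = shift P + basis Ts *\<^sub>v z"
  proof (rule eq_vecI)
    fix i assume "i < dim_vec (shift P + basis Ts *\<^sub>v z)"
    then have i: "i < dmn" by (simp add: basis_def)
    then have R: "(shift P + basis Ts *\<^sub>v z) $ i = shift P $ i + (basis Ts *\<^sub>v z) $ i" by (simp add: basis_def)
    from i show "v $ i = (shift P + basis Ts *\<^sub>v z) $ i"
      unfolding R
    proof (cases rule: dmn_cases)
      case 1
      have "int prm dvd int (syn P i) - int (syn P' i)"
        using cong_int_iff P'(1)[OF 1] by (metis cong_iff_dvd_diff cong_sym)
      then have "int prm * z $ i = int (syn P i) - int (syn P' i)" using 1 i by (simp add: z_def)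
      moreover have "(\<Sum>a<pts. int a ^ i * z $ (chk + r + a)) = int (syn P' i)"
        unfolding ind_power_sum[symmetric] using zu by (intro sum.cong) (auto simp: mult.commute)
      ultimately show "v $ i = shift P $ i + (basis Ts *\<^sub>v z) $ i"
        using basis_mult_int(1)[OF z 1, of Ts] 1 i by (simp add: v_def shift_def)
    next
      case (2 i')
      have "int blk dvd w $ i' - (\<Sum>a<pts. Ts ! i' ! a * ind P' a)"
        using P'(2)[OF 2(2)] by (simp add: cong_iff_dvd_diff dvd_diff_commute)
      then have "int blk * z $ (chk + i') = w $ i' - (\<Sum>a<pts. Ts ! i' ! a * ind P' a)"
        using 2 i by (simp add: z_def)
      moreover have "(\<Sum>a<pts. Ts ! i' ! a * z $ (chk + r + a)) = (\<Sum>a<pts. Ts ! i' ! a * ind P' a)"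
        using zu by (intro sum.cong) auto
      ultimately show "v $ i = shift P $ i + (basis Ts *\<^sub>v z) $ i"
        using basis_mult_int(2)[OF z 2(2), of Ts] 2 i by (simp add: v_def shift_def)
    next
      case (3 a)
      then show "v $ i = shift P $ i + (basis Ts *\<^sub>v z) $ i"
        using basis_mult_int(3)[OF z 3(2), of Ts] zu[of a] i by (simp add: v_def shift_def)
    qed
  qed (simp add: v_def basis_def)
  then have coset: "v \<in> {shift P + u | u. u \<in> lattice_gen (basis Ts)}"
    using z by (auto simp: lattice_gen_def basis_def)
  have "(\<Sum>i<dmn. \<bar>real_of_int (v $ i)\<bar> powr p) \<le> (\<Sum>i<chk + r. if i < chk then 0 else 1) + (\<Sum>a<pts. real_of_int (ind P' a))"
    unfolding sum_dmn_split
  proof (intro add_mono sum_mono)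
    fix i assume i: "i \<in> {..<chk + r}"
    show "\<bar>real_of_int (v $ i)\<bar> powr p \<le> (if i < chk then 0 else 1)"
    proof (cases "i < chk")
      case False
      then have "i - chk < r" using i by auto
      then show ?thesis using w(2)[of "i - chk"] i False by (auto simp: v_def dmn_def)
    qed (use i in \<open>simp add: v_def dmn_def\<close>)
  next
    fix a assume "a \<in> {..<pts}"
    then show "\<bar>real_of_int (v $ (chk + r + a))\<bar> powr p \<le> real_of_int (ind P' a)"
      by (auto simp: v_def dmn_def ind_def)
  qed
  also have "(\<Sum>i<chk + r. if i < chk then 0 else 1 :: real) = real r"
  proof -
    have "(\<Sum>i<chk + r. if i < chk then 0 else 1 :: real) = (\<Sum>i\<in>{chk..<chk + r}. 1)"
      by (rule sum.mono_neutral_cong_right) auto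
    then show ?thesis by simp
  qed
  also have "(\<Sum>a<pts. real_of_int (ind P' a)) = real wgt"
    using arg_cong[OF ind_sum[of P'], of real_of_int] by simp
  \<comment> \<open>The binary \<open>w\<close> costs at most \<open>r\<close> and the code vector
    \<open>wgt = (b + 3) * r\<close>; comparing with \<open>2 * chk = 2 * b * r\<close> gives the
    condition on \<open>b\<close>.\<close>
  also have "real r + real wgt = real (b + 4) * real r" by (simp add: wgt_def algebra_simps)
  also have "\<dots> \<le> \<alpha> powr p * (2 * real b) * real r" using \<alpha>(2) by (intro mult_right_mono) auto
  also have "\<dots> = \<alpha> powr p * real (2 * chk)" by (simp add: chk_def)
  finally have "(\<Sum>i<dmn. \<bar>real_of_int (v $ i)\<bar> powr p) powr (1 / p) \<le> (\<alpha> powr p * real (2 * chk)) powr (1 / p)"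
    using p by (intro powr_mono2 sum_nonneg) auto
  also have "\<dots> = \<alpha> * real (2 * chk) powr (1 / p)"
    using p \<alpha>(1) by (simp add: powr_mult powr_powr)
  finally have "lp_norm p (map_vec real_of_int v) \<le> \<alpha> * real (2 * chk) powr (1 / p)"
    by (simp add: lp_norm_def v_def)
  then have "v \<in> short_coset_vectors p \<alpha> (basis Ts) (2 * chk) (shift P)"
    using coset by (simp add: short_coset_vectors_def)
  moreover have "proj *\<^sub>v v = w"
  proof (rule eq_vecI)
    fix i assume "i < dim_vec w"
    then have i: "i < r" using w by simp
    have "(proj *\<^sub>v v) $ i = (\<Sum>j<dmn. (if chk + i = j then 1 else 0) * v $ j)"
      using i by (simp add: proj_def v_def scalar_prod_def atLeast0LessThan)
    also have "\<dots> = (\<Sum>j<dmn. if chk + i = j then v $ j else 0)" by (intro sum.cong) auto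
    also have "\<dots> = v $ (chk + i)" using i by (simp add: dmn_def)
    also have "\<dots> = w $ i" using i by (simp add: v_def dmn_def)
    finally show "(proj *\<^sub>v v) $ i = w $ i" .
  qed (simp add: proj_def w)
  ultimately show "w \<in> (\<lambda>v. proj *\<^sub>v v) ` short_coset_vectors p \<alpha> (basis Ts) (2 * chk) (shift P)"
    by blast
qed

end

section \<open>Success probability\<close>

lemma replicate_pmf_of_set:
  assumes "finite A" "A \<noteq> {}"
  shows "replicate_pmf n (pmf_of_set A) = pmf_of_set {xs. set xs \<subseteq> A \<and> length xs = n}"
proof (induction n)
  case 0
  have "{xs. set xs \<subseteq> A \<and> length xs = 0} = {[]}" by auto
  then show ?case by (simp add: pmf_of_set_singleton)
next
  case (Suc n)
  let ?L = "\<lambda>n. {xs. set xs \<subseteq> A \<and> length xs = n}"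
  have ne: "?L n \<noteq> {}" "finite (?L n)"
  proof -
    obtain a where "a \<in> A" using assms by blast
    then have "replicate n a \<in> ?L n" by auto
    then show "?L n \<noteq> {}" by blast
    show "finite (?L n)" by (rule finite_lists_length_eq[OF assms(1)])
  qed
  have img: "(\<lambda>(x, xs). x # xs) ` (A \<times> ?L n) = ?L (Suc n)"
    by (auto simp: length_Suc_conv image_iff)
  have inj: "inj_on (\<lambda>(x, xs). x # xs) (A \<times> ?L n)" by (auto simp: inj_on_def)
  have "replicate_pmf (Suc n) (pmf_of_set A) = map_pmf (\<lambda>(x, xs). x # xs) (pair_pmf (pmf_of_set A) (replicate_pmf n (pmf_of_set A)))"
    by (simp add: pair_pmf_def map_bind_pmf map_pmf_def bind_assoc_pmf bind_return_pmf)
  also have "\<dots> = map_pmf (\<lambda>(x, xs). x # xs) (pmf_of_set (A \<times> ?L n))"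
    unfolding Suc using assms ne by (simp add: pair_pmf_of_set)
  also have "\<dots> = pmf_of_set (?L (Suc n))"
    using map_pmf_of_set_inj[OF inj] assms ne unfolding img by simp
  finally show ?case .
qed

text \<open>The second-moment (leftover hash) argument: pairwise collisions at the uniform rate force a
  random hash function to be onto.\<close>

lemma universal_hash_onto:
  fixes f :: "'t \<Rightarrow> 'c \<Rightarrow> 'w"
  assumes fin: "finite \<Omega>" "finite C" "finite W"
    and range: "\<And>T c. T \<in> \<Omega> \<Longrightarrow> c \<in> C \<Longrightarrow> f T c \<in> W"
    and coll: "\<And>c c'. c \<in> C \<Longrightarrow> c' \<in> C \<Longrightarrow> c \<noteq> c' \<Longrightarrow> card {T \<in> \<Omega>. f T c = f T c'} * card W \<le> card \<Omega>"
  shows "card {T \<in> \<Omega>. \<not> W \<subseteq> f T ` C} * card C \<le> card \<Omega> * (card W)\<^sup>2"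
proof (cases "C = {} \<or> W = {}")
  case True
  then show ?thesis by auto
next
  case False
  define c where "c = real (card C)"
  define w where "w = real (card W)"
  have pos: "0 < c" "0 < w" using False fin by (auto simp: c_def w_def card_gt_0_iff)
  define N where "N T v = (\<Sum>x\<in>C. of_bool (f T x = v) :: real)" for T v
  define K where "K T = (\<Sum>x\<in>C. \<Sum>y\<in>C. of_bool (f T x = f T y) :: real)" for T
  define Bad where "Bad = {T \<in> \<Omega>. \<not> W \<subseteq> f T ` C}"
  have Nsum: "(\<Sum>v\<in>W. N T v) = c" if "T \<in> \<Omega>" for T
  proof -
    have "(\<Sum>v\<in>W. N T v) = (\<Sum>x\<in>C. \<Sum>v\<in>W. of_bool (f T x = v))" unfolding N_def by (rule sum.swap)
    also have "\<dots> = (\<Sum>x\<in>C. 1)" using range[OF that] fin by (intro sum.cong) (auto simp: of_bool_def)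
    finally show ?thesis by (simp add: c_def)
  qed
  have Nsq: "(\<Sum>v\<in>W. (N T v)\<^sup>2) = K T" if "T \<in> \<Omega>" for T
  proof -
    have "(\<Sum>v\<in>W. (N T v)\<^sup>2) = (\<Sum>v\<in>W. \<Sum>x\<in>C. \<Sum>y\<in>C. of_bool (f T x = v) * of_bool (f T y = v))"
      unfolding N_def power2_eq_square sum_product ..
    also have "\<dots> = (\<Sum>x\<in>C. \<Sum>y\<in>C. \<Sum>v\<in>W. of_bool (f T x = v) * of_bool (f T y = v))"
      by (subst sum.swap, rule sum.cong[OF refl], rule sum.swap)
    also have "\<dots> = K T" unfolding K_def
    proof (intro sum.cong refl)
      fix x y assume "x \<in> C" "y \<in> C"
      have "(\<Sum>v\<in>W. of_bool (f T x = v) * of_bool (f T y = v) :: real) = (\<Sum>v\<in>W. if f T x = v then of_bool (f T y = v) else 0)"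
        by (intro sum.cong) auto
      also have "\<dots> = of_bool (f T y = f T x)" using range[OF that \<open>x \<in> C\<close>] fin by simp
      finally show "(\<Sum>v\<in>W. of_bool (f T x = v) * of_bool (f T y = v) :: real) = of_bool (f T x = f T y)" by (simp add: eq_commute)
    qed
    finally show ?thesis .
  qed
  have dev: "(\<Sum>v\<in>W. (N T v - c / w)\<^sup>2) = K T - c\<^sup>2 / w" if "T \<in> \<Omega>" for T
  proof -
    have "(\<Sum>v\<in>W. (N T v - c / w)\<^sup>2) = (\<Sum>v\<in>W. (N T v)\<^sup>2 - 2 * (c / w) * N T v + (c / w)\<^sup>2)"
      by (intro sum.cong) (auto simp: power2_diff algebra_simps)
    also have "\<dots> = K T - 2 * (c / w) * c + w * (c / w)\<^sup>2"
      unfolding sum.distrib sum_subtractf sum_distrib_left[symmetric] Nsum[OF that] Nsq[OF that]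
      by (simp add: w_def)
    also have "\<dots> = K T - c\<^sup>2 / w" using pos by (simp add: power2_eq_square field_simps)
    finally show ?thesis .
  qed
  \<comment> \<open>A value that is missed has count 0 and alone contributes
    \<open>(c / w)\<^sup>2\<close> to the deviation from the mean count \<open>c / w\<close>;
    summing over \<open>\<Omega>\<close> is Markov's inequality.\<close>
  have "of_bool (T \<in> Bad) * (c / w)\<^sup>2 \<le> K T - c\<^sup>2 / w" if T: "T \<in> \<Omega>" for T
  proof (cases "T \<in> Bad")
    case True
    then obtain v where v: "v \<in> W" "v \<notin> f T ` C" by (auto simp: Bad_def)
    have "N T v = 0" unfolding N_def using v by (intro sum.neutral) auto
    then have "(c / w)\<^sup>2 = (N T v - c / w)\<^sup>2" by simp
    also have "\<dots> \<le> (\<Sum>v\<in>W. (N T v - c / w)\<^sup>2)" using v fin by (intro member_le_sum) auto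
    finally show ?thesis using True dev[OF T] by simp
  next
    case False
    have "0 \<le> (\<Sum>v\<in>W. (N T v - c / w)\<^sup>2)" by (intro sum_nonneg) auto
    then show ?thesis using False dev[OF T] by simp
  qed
  then have "(\<Sum>T\<in>\<Omega>. of_bool (T \<in> Bad) * (c / w)\<^sup>2) \<le> (\<Sum>T\<in>\<Omega>. K T - c\<^sup>2 / w)" by (rule sum_mono)
  moreover have "(\<Sum>T\<in>\<Omega>. of_bool (T \<in> Bad) * (c / w)\<^sup>2) = real (card Bad) * (c / w)\<^sup>2"
  proof -
    have "(\<Sum>T\<in>\<Omega>. of_bool (T \<in> Bad) * (c / w)\<^sup>2) = (\<Sum>T\<in>Bad. (c / w)\<^sup>2)"
      using fin by (intro sum.mono_neutral_cong_right) (auto simp: Bad_def)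
    then show ?thesis by simp
  qed
  \<comment> \<open>Every pair is charged the uniform rate, and the diagonal pairs additionally
    \<open>card \<Omega>\<close>. The uniform share cancels against \<open>c\<^sup>2 / w\<close>, so
    only the diagonal survives.\<close>
  moreover have "(\<Sum>T\<in>\<Omega>. K T) \<le> c * card \<Omega> + c\<^sup>2 * (card \<Omega> / w)"
  proof -
    have "(\<Sum>T\<in>\<Omega>. K T) = (\<Sum>x\<in>C. \<Sum>y\<in>C. \<Sum>T\<in>\<Omega>. of_bool (f T x = f T y))"
      unfolding K_def by (subst sum.swap, rule sum.cong[OF refl], rule sum.swap)
    also have "\<dots> \<le> (\<Sum>x\<in>C. \<Sum>y\<in>C. (if x = y then real (card \<Omega>) else 0) + card \<Omega> / w)"
    proof (intro sum_mono)
      fix x y assume xy: "x \<in> C" "y \<in> C"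
      have "(\<Sum>T\<in>\<Omega>. of_bool (f T x = f T y) :: real) = real (card {T \<in> \<Omega>. f T x = f T y})"
        using fin by (simp add: of_bool_def sum.If_cases Int_def)
      also have "\<dots> \<le> (if x = y then real (card \<Omega>) else 0) + card \<Omega> / w"
      proof (cases "x = y")
        case True
        then show ?thesis using pos by simp
      next
        case False
        have "real (card {T \<in> \<Omega>. f T x = f T y}) * w \<le> real (card \<Omega>)"
          using coll[OF xy False] unfolding w_def of_nat_mult[symmetric] of_nat_le_iff .
        then show ?thesis using False pos by (simp add: field_simps)
      qed
      finally show "(\<Sum>T\<in>\<Omega>. of_bool (f T x = f T y) :: real) \<le> (if x = y then real (card \<Omega>) else 0) + card \<Omega> / w" .
    qed
    also have "\<dots> = c * card \<Omega> + c\<^sup>2 * (card \<Omega> / w)"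
      using fin by (simp add: sum.distrib c_def power2_eq_square distrib_left)
    finally show ?thesis .
  qed
  ultimately have "real (card Bad) * (c / w)\<^sup>2 \<le> c * card \<Omega>"
    by (simp add: sum_subtractf mult.commute)
  then have "real (card Bad) * c \<le> real (card \<Omega>) * w\<^sup>2"
    using pos by (simp add: power2_eq_square field_simps)
  then have "real (card Bad * card C) \<le> real (card \<Omega> * (card W)\<^sup>2)" by (simp add: c_def w_def)
  then show ?thesis unfolding Bad_def[symmetric] of_nat_le_iff .
qed

text \<open>At most \<open>card S\<close> fibres, each counted only when it has fewer than
  \<open>G\<close> elements. For \<open>s\<close> the syndrome, this bounds the chance that a random
  \<open>P\<close> has too few companions.\<close>

lemma card_small_fibres:
  assumes "finite A" "finite S" "s ` A \<subseteq> S"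
  shows "card {x \<in> A. card {y \<in> A. s y = s x} < G} \<le> card S * G"
proof -
  have "{x \<in> A. card {y \<in> A. s y = s x} < G} \<subseteq> (\<Union>v\<in>{v \<in> S. card {y \<in> A. s y = v} < G}. {y \<in> A. s y = v})"
    using assms(3) by auto
  then have "card {x \<in> A. card {y \<in> A. s y = s x} < G} \<le> card (\<Union>v\<in>{v \<in> S. card {y \<in> A. s y = v} < G}. {y \<in> A. s y = v})"
    using assms by (intro card_mono) auto
  also have "\<dots> \<le> (\<Sum>v\<in>{v \<in> S. card {y \<in> A. s y = v} < G}. card {y \<in> A. s y = v})"
    using assms by (intro card_UN_le) auto
  also have "\<dots> \<le> (\<Sum>v\<in>{v \<in> S. card {y \<in> A. s y = v} < G}. G)" by (intro sum_mono) auto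
  also have "\<dots> \<le> card S * G" using assms by (simp add: card_mono)
  finally show ?thesis .
qed

text \<open>Overwriting entry \<open>j\<close> by each of the \<open>B\<close> values is injective
  on the solutions: the other entries determine \<open>row ! j\<close> modulo \<open>B\<close>
  because its coefficient is 1. This works for composite \<open>B\<close>, in particular for a power
  of two.\<close>

lemma card_linear_form_dvd:
  fixes d :: "nat \<Rightarrow> int"
  assumes j: "j < n" "d j = 1" and B: "0 < B"
  defines "hash_rows \<equiv> {row. set row \<subseteq> {0..<int B} \<and> length row = n}"
  shows "card {row \<in> hash_rows. int B dvd (\<Sum>a<n. row ! a * d a)} * B \<le> card hash_rows"
proof -
  let ?S = "{row \<in> hash_rows. int B dvd (\<Sum>a<n. row ! a * d a)}"
  have fin: "finite hash_rows" unfolding hash_rows_def by (rule finite_lists_length_eq) simp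
  let ?g = "\<lambda>(row, x). row[j := x]"
  have split: "(\<Sum>a<n. row ! a * d a) = row ! j + (\<Sum>a\<in>{..<n} - {j}. row ! a * d a)" for row
    using j by (simp add: sum.remove[of _ j])
  have "inj_on ?g (?S \<times> {0..<int B})"
  proof (rule inj_onI, clarify)
    fix row x row' x' assume R: "row \<in> hash_rows" "row' \<in> hash_rows" and x: "x \<in> {0..<int B}" "x' \<in> {0..<int B}"
      and D: "int B dvd (\<Sum>a<n. row ! a * d a)" "int B dvd (\<Sum>a<n. row' ! a * d a)"
      and eq: "row[j := x] = row'[j := x']"
    have len: "length row = n" "length row' = n" using R by (auto simp: hash_rows_def)
    have "x = x'" using arg_cong[OF eq, of "\<lambda>l. l ! j"] len j by simp
    have off: "row ! a = row' ! a" if "a < n" "a \<noteq> j" for a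
      using arg_cong[OF eq, of "\<lambda>l. l ! a"] that by simp
    have "(\<Sum>a\<in>{..<n} - {j}. row ! a * d a) = (\<Sum>a\<in>{..<n} - {j}. row' ! a * d a)"
      using off by (intro sum.cong) auto
    then have "int B dvd row ! j - row' ! j" using dvd_diff[OF D] by (simp add: split)
    moreover have "row ! j \<in> {0..<int B}" "row' ! j \<in> {0..<int B}"
      using R len j nth_mem[of j row] nth_mem[of j row'] by (auto simp: hash_rows_def simp del: nth_mem)
    ultimately have "row ! j = row' ! j"
      by (metis atLeastLessThan_iff mod_eq_dvd_iff mod_pos_pos_trivial)
    then have "row = row'" using off len by (intro nth_equalityI) metis+
    then show "row = row' \<and> x = x'" using \<open>x = x'\<close> by simp
  qed
  moreover have "?g ` (?S \<times> {0..<int B}) \<subseteq> hash_rows"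
    using set_update_subset_insert by (fastforce simp: hash_rows_def)
  ultimately have "card (?S \<times> {0..<int B}) \<le> card hash_rows" using fin by (rule card_inj_on_le)
  then show ?thesis by (simp add: card_cartesian_product)
qed

lemma digits_determine:
  fixes B h :: nat
  assumes "\<And>i. i < h \<Longrightarrow> x div B ^ i mod B = y div B ^ i mod B"
  shows "x mod B ^ h = y mod B ^ h"
  using assms
proof (induction h)
  case (Suc h)
  have "x mod B ^ Suc h = B ^ h * (x div B ^ h mod B) + x mod B ^ h" for x
    by (simp only: power_Suc2 mod_mult2_eq)
  then show ?case using Suc by simp
qed simp

context lattice_params
begin

section \<open>Collisions of the hash and counting of bad draws\<close>

definition "hash_rows = {row. set row \<subseteq> {0..<int blk} \<and> length row = pts}"

lemma tables_eq: "tables = {Ts. set Ts \<subseteq> hash_rows \<and> length Ts = r}"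
  by (auto simp: tables_def hash_rows_def)

lemma finite_hash_rows: "finite hash_rows" unfolding hash_rows_def by (rule finite_lists_length_eq) simp

lemma hash_rows_ne: "hash_rows \<noteq> {}"
proof -
  have "replicate pts 0 \<in> hash_rows" using blk_pos by (auto simp: hash_rows_def)
  then show ?thesis by blast
qed

lemma finite_tables: "finite tables" unfolding tables_eq by (rule finite_lists_length_eq[OF finite_hash_rows])

lemma card_tables: "card tables = card hash_rows ^ r"
  unfolding tables_eq by (rule card_lists_length_eq[OF finite_hash_rows])

lemma tables_ne: "tables \<noteq> {}"
  using card_tables finite_tables hash_rows_ne finite_hash_rows by (metis card.empty card_0_eq power_not_zero)

lemma hash_pmf_eq: "hash_pmf = pmf_of_set tables"
proof -
  have ne: "{0..<int blk} \<noteq> {}" using blk_pos by simp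
  have "replicate_pmf pts (pmf_of_set {0..<int blk}) = pmf_of_set hash_rows"
    unfolding hash_rows_def by (rule replicate_pmf_of_set) (use ne in auto)
  then show ?thesis unfolding tables_eq using replicate_pmf_of_set[OF finite_hash_rows hash_rows_ne] by simp
qed

definition "hash Ts P = map (\<lambda>i. (\<Sum>a<pts. Ts ! i ! a * ind P a) mod int blk) [0..<r]"

definition "syndrome P = map (\<lambda>j. syn P j mod prm) [0..<chk]"

text \<open>All residue vectors, not only the binary ones: the hash collides at rate at most
  \<open>1 / blk ^ r\<close>, and the second moment bound asks for the rate
  \<open>1 / card W\<close>.\<close>

definition "targets = {ws. set ws \<subseteq> {0..<int blk} \<and> length ws = r}"

lemma card_targets: "card targets = blk ^ r" "finite targets"
  unfolding targets_def by (simp_all add: card_lists_length_eq finite_lists_length_eq)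

lemma hash_in_targets: "hash Ts P \<in> targets"
  using blk_pos by (auto simp: hash_def targets_def)

text \<open>Distinct numbers differ in some digit \<open>i\<close>. At the position of that digit of
  \<open>P\<close> the first vector is 1 and the second 0, so the difference has a coefficient 1;
  the \<open>r\<close> independent rows give the power \<open>r\<close>.\<close>

lemma hash_collision:
  assumes "P < blk ^ wgt" "P' < blk ^ wgt" "P \<noteq> P'"
  shows "card {Ts \<in> tables. hash Ts P = hash Ts P'} * card targets \<le> card tables"
proof -
  obtain i where i: "i < wgt" "dig P i \<noteq> dig P' i"
    using digits_determine[of wgt P blk P'] assms unfolding dig_def by auto
  let ?j = "i * blk + dig P i" and ?d = "\<lambda>a. ind P a - ind P' a"
  have "?j div blk = i" "?j mod blk = dig P i" using dig_less[of P i] by simp_all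
  then have d: "?d ?j = 1" using i by (simp add: ind_def)
  let ?S = "{row \<in> hash_rows. int blk dvd (\<Sum>a<pts. row ! a * ?d a)}"
  have "card ?S * blk \<le> card hash_rows"
    using card_linear_form_dvd[of ?j pts ?d blk, OF position_less[OF i(1)] d blk_pos] unfolding hash_rows_def by simp
  then have le: "(card ?S * blk) ^ r \<le> card hash_rows ^ r" by (rule power_mono) simp
  have "{Ts \<in> tables. hash Ts P = hash Ts P'} \<subseteq> {Ts. set Ts \<subseteq> ?S \<and> length Ts = r}"
  proof safe
    fix Ts row assume T: "Ts \<in> tables" "hash Ts P = hash Ts P'" and row: "row \<in> set Ts"
    then show "row \<in> hash_rows" by (auto simp: tables_eq)
    from T row obtain k where k: "k < r" "row = Ts ! k" by (auto simp: tables_eq in_set_conv_nth)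
    have "(\<Sum>a<pts. row ! a * ind P a) mod int blk = (\<Sum>a<pts. row ! a * ind P' a) mod int blk"
      using arg_cong[OF T(2), of "\<lambda>l. l ! k"] k by (simp add: hash_def)
    then have "int blk dvd (\<Sum>a<pts. row ! a * ind P a) - (\<Sum>a<pts. row ! a * ind P' a)"
      by (simp add: mod_eq_dvd_iff)
    then show "int blk dvd (\<Sum>a<pts. row ! a * ?d a)"
      by (simp add: sum_subtractf right_diff_distrib)
  qed (auto simp: tables_eq)
  then have "card {Ts \<in> tables. hash Ts P = hash Ts P'} \<le> card {Ts. set Ts \<subseteq> ?S \<and> length Ts = r}"
    using finite_hash_rows by (intro card_mono finite_lists_length_eq) auto
  also have "\<dots> = card ?S ^ r" using finite_hash_rows by (intro card_lists_length_eq) auto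
  finally have "card {Ts \<in> tables. hash Ts P = hash Ts P'} * card targets \<le> card ?S ^ r * blk ^ r"
    unfolding card_targets by simp
  also have "\<dots> \<le> card tables" using le by (simp add: card_tables power_mult_distrib)
  finally show ?thesis .
qed

definition "fibre P = {P'. P' < blk ^ wgt \<and> syndrome P' = syndrome P}"

definition "bad = {(P, Ts). P < blk ^ wgt \<and> Ts \<in> tables \<and> \<not> targets \<subseteq> hash Ts ` fibre P}"

text \<open>Two failures of a sixth each. At most a sixth of the \<open>P\<close> lie in a fibre
  with fewer than \<open>G = 6 * blk ^ (2 * r)\<close> elements; for any other \<open>P\<close> at
  most a sixth of the tables miss a target, as \<open>G\<close> is 6 times the squared number of
  targets. The tables are drawn independently of \<open>P\<close>, so the hash acts on a fixed
  fibre.\<close>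

lemma card_bad: "3 * card bad \<le> blk ^ wgt * card tables"
proof -
  define G where "G = 6 * blk ^ (2 * r)"
  let ?U = "{..<blk ^ wgt}"
  define small where "small = {P \<in> ?U. card (fibre P) < G}"
  define badT where "badT P = {Ts \<in> tables. \<not> targets \<subseteq> hash Ts ` fibre P}" for P
  have fib: "fibre P = {P' \<in> ?U. syndrome P' = syndrome P}" for P by (auto simp: fibre_def)
  have "card small \<le> card {xs. set xs \<subseteq> {..<prm} \<and> length xs = chk} * G"
    unfolding small_def fib
  proof (rule card_small_fibres)
    show "syndrome ` ?U \<subseteq> {xs. set xs \<subseteq> {..<prm} \<and> length xs = chk}"
      using prime_gt_0_nat[OF prm(1)] by (auto simp: syndrome_def)
  qed (auto intro: finite_lists_length_eq)
  also have "\<dots> = prm ^ chk * G" by (simp add: card_lists_length_eq)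
  finally have "6 * card small \<le> 36 * prm ^ chk * blk ^ (2 * r)" by (simp add: G_def)
  then have small: "6 * card small \<le> blk ^ wgt" using counting_bound by linarith
  have large: "6 * card (badT P) \<le> card tables" if P: "P \<in> ?U - small" for P
  proof -
    have "card (badT P) * card (fibre P) \<le> card tables * (card targets)\<^sup>2"
      unfolding badT_def
      by (rule universal_hash_onto) (use finite_tables card_targets hash_in_targets hash_collision in \<open>auto simp: fibre_def\<close>)
    also have "(card targets)\<^sup>2 = blk ^ (2 * r)" by (simp add: card_targets power_mult[symmetric] mult.commute)
    finally have "card (badT P) * card (fibre P) \<le> card tables * blk ^ (2 * r)" .
    moreover have "card (badT P) * G \<le> card (badT P) * card (fibre P)"
      using P by (intro mult_le_mono2) (auto simp: small_def)
    moreover have "card (badT P) * G = (6 * card (badT P)) * blk ^ (2 * r)" by (simp add: G_def)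
    ultimately have "(6 * card (badT P)) * blk ^ (2 * r) \<le> card tables * blk ^ (2 * r)" by linarith
    then show ?thesis using blk_pos by simp
  qed
  have "bad = Sigma ?U badT" by (auto simp: bad_def badT_def)
  then have "card bad = (\<Sum>P\<in>?U. card (badT P))" using finite_tables by (simp add: card_SigmaI badT_def)
  then have "6 * card bad = (\<Sum>P\<in>?U. 6 * card (badT P))" by (simp add: sum_distrib_left)
  also have "\<dots> \<le> (\<Sum>P\<in>?U. (if P \<in> small then 6 * card tables else 0) + card tables)"
  proof (rule sum_mono)
    fix P assume "P \<in> ?U"
    moreover have "card (badT P) \<le> card tables" unfolding badT_def using finite_tables by (intro card_mono) auto
    ultimately show "6 * card (badT P) \<le> (if P \<in> small then 6 * card tables else 0) + card tables"
      using large[of P] by auto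
  qed
  also have "\<dots> = (6 * card small) * card tables + blk ^ wgt * card tables"
  proof -
    have "(\<Sum>P\<in>?U. if P \<in> small then 6 * card tables else 0) = (\<Sum>P\<in>small. 6 * card tables)"
      by (rule sum.mono_neutral_cong_right) (auto simp: small_def)
    then show ?thesis by (simp add: sum.distrib)
  qed
  also have "\<dots> \<le> blk ^ wgt * card tables + blk ^ wgt * card tables" using small by simp
  finally show ?thesis by linarith
qed

lemma prob_hit:
  "measure_pmf.prob (pair_pmf (pmf_of_set {0..<int blk ^ wgt}) hash_pmf)
     {(P, Ts). (nat P, Ts) \<in> bad} \<le> 1 / 3"
proof -
  let ?V = "{0..<int blk ^ wgt} \<times> tables"
  have ne: "{0..<int blk ^ wgt} \<noteq> {}" using blk_pos by simp
  have eq: "pair_pmf (pmf_of_set {0..<int blk ^ wgt}) hash_pmf = pmf_of_set ?V"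
    unfolding hash_pmf_eq by (rule pair_pmf_of_set) (use ne finite_tables tables_ne in auto)
  have fin: "finite ?V" "?V \<noteq> {}" using finite_tables tables_ne ne by auto
  have "?V \<inter> {(P, Ts). (nat P, Ts) \<in> bad} \<subseteq> (\<lambda>(P, Ts). (int P, Ts)) ` bad"
    by (force simp: image_iff)
  moreover have fbad: "finite bad"
    by (rule finite_subset[of _ "{..<blk ^ wgt} \<times> tables"]) (use finite_tables in \<open>auto simp: bad_def\<close>)
  ultimately have "card (?V \<inter> {(P, Ts). (nat P, Ts) \<in> bad}) \<le> card bad"
    by (meson card_image_le card_mono finite_imageI le_trans)
  then have "3 * card (?V \<inter> {(P, Ts). (nat P, Ts) \<in> bad}) \<le> blk ^ wgt * card tables"
    using card_bad by linarith
  moreover have "card ?V = blk ^ wgt * card tables"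
    by (simp add: card_cartesian_product nat_power_eq)
  ultimately have "real (3 * card (?V \<inter> {(P, Ts). (nat P, Ts) \<in> bad})) \<le> real (card ?V)"
    by (simp only: of_nat_le_iff)
  moreover have "0 < card ?V" unfolding card_gt_0_iff using fin by blast
  ultimately show ?thesis unfolding eq measure_pmf_of_set[OF fin(2,1)] by (simp add: divide_simps)
qed

lemma not_bad_dense:
  assumes p: "1 \<le> p" and \<alpha>: "0 < \<alpha>" "real (b + 4) \<le> \<alpha> powr p * (2 * real b)"
    and P: "P < blk ^ wgt" and Ts: "Ts \<in> tables" and good: "(P, Ts) \<notin> bad"
  shows "ld_dense p \<alpha> r (basis Ts) (2 * chk) (shift P) proj"
proof (rule ld_dense_basis[OF p \<alpha>])
  fix w :: "nat \<Rightarrow> int" assume w: "\<forall>i<r. w i \<in> {0, 1}"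
  \<comment> \<open>This puts 0 and 1 among the residues, so that every binary \<open>w\<close> is
    one of the targets.\<close>
  have "2 \<le> blk" using chk_le_blk chk_pos by linarith
  then have "map w [0..<r] \<in> targets" using w by (fastforce simp: targets_def)
  then obtain P' where P': "P' \<in> fibre P" "map w [0..<r] = hash Ts P'"
    using P Ts good by (auto simp: bad_def)
  have "[syn P' j = syn P j] (mod prm)" if "j < chk" for j
    using arg_cong[of _ _ "\<lambda>l. l ! j", OF conjunct2[OF P'(1)[unfolded fibre_def mem_Collect_eq]]] that
    by (simp add: syndrome_def cong_def)
  moreover have "[(\<Sum>a<pts. Ts ! i ! a * ind P' a) = w i] (mod int blk)" if "i < r" for i
    using arg_cong[OF P'(2), of "\<lambda>l. l ! i"] that by (simp add: hash_def cong_def)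
  ultimately show "\<exists>P'. (\<forall>j<chk. [syn P' j = syn P j] (mod prm)) \<and>
        (\<forall>i<r. [(\<Sum>a<pts. Ts ! i ! a * ind P' a) = w i] (mod int blk))" by blast
qed

end

section \<open>Polynomial bounds\<close>

lemma poly_bounded_const: "poly_bounded (\<lambda>_. c)"
  unfolding poly_bounded_def by (intro exI[of _ "[:c:]"]) simp

lemma poly_bounded_id: "poly_bounded (\<lambda>x. x)"
  unfolding poly_bounded_def by (intro exI[of _ "[:0, 1:]"]) simp

lemma poly_bounded_add:
  assumes "poly_bounded f" "poly_bounded g"
  shows "poly_bounded (\<lambda>x. f x + g x)"
proof -
  from assms obtain P Q where "\<forall>x. f x \<le> poly P x" "\<forall>x. g x \<le> poly Q x" unfolding poly_bounded_def by blast
  then show ?thesis unfolding poly_bounded_def by (intro exI[of _ "P + Q"]) (simp add: add_mono)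
qed

lemma poly_bounded_mult:
  assumes "poly_bounded f" "poly_bounded g"
  shows "poly_bounded (\<lambda>x. f x * g x)"
proof -
  from assms obtain P Q where "\<forall>x. f x \<le> poly P x" "\<forall>x. g x \<le> poly Q x" unfolding poly_bounded_def by blast
  then show ?thesis unfolding poly_bounded_def by (intro exI[of _ "P * Q"]) (simp add: mult_mono)
qed

lemma poly_bounded_power:
  assumes "poly_bounded f"
  shows "poly_bounded (\<lambda>x. f x ^ n)"
  by (induction n) (simp_all add: assms poly_bounded_const poly_bounded_mult)

lemma poly_bounded_mono:
  assumes "poly_bounded g" "\<And>x. f x \<le> g x"
  shows "poly_bounded f"
  using assms unfolding poly_bounded_def by (meson le_trans)

lemma poly_bounded_max_1: "poly_bounded (\<lambda>x. max 1 x)"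
  by (rule poly_bounded_mono[OF poly_bounded_add[OF poly_bounded_id poly_bounded_const[of 1]]]) simp

lemmas poly_bounded_intros = poly_bounded_const poly_bounded_id poly_bounded_add poly_bounded_mult poly_bounded_power

lemma (in lattice_params) lgb_le_prm: "lgb \<le> prm"
proof -
  have "lgb < blk" by (simp add: blk_def)
  then show ?thesis using blk_le_pts pts_le by linarith
qed

text \<open>\<open>b\<close> is fixed by \<open>p\<close> and \<alpha>, so the power with exponent
  \<open>b + 1\<close> in \<open>prm_lb\<close> is polynomial in the input. The prime is at most
  about the square of that bound and in turn bounds \<open>pts\<close> and \<open>lgb\<close>.
  \<open>max 1 x\<close> is the value of \<open>r\<close> used on input \<open>x\<close>.\<close>

lemma poly_bounded_params:
  assumes b: "0 < b"
  shows "poly_bounded (\<lambda>x. lattice_params.dmn b (max 1 x))"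
    and "poly_bounded (\<lambda>x. lattice_params.width b (max 1 x))"
    and "poly_bounded (\<lambda>x. lattice_params.body_steps b (max 1 x))"
proof -
  have L: "lattice_params b (max 1 x)" for x using b by unfold_locales auto
  note r = poly_bounded_max_1
  have chk: "poly_bounded (\<lambda>x. lattice_params.chk b (max 1 x))"
    unfolding lattice_params.chk_def[OF L] by (intro poly_bounded_intros r)
  have wgt: "poly_bounded (\<lambda>x. lattice_params.wgt b (max 1 x))"
    unfolding lattice_params.wgt_def[OF L] by (intro poly_bounded_intros r)
  have lb: "poly_bounded (\<lambda>x. lattice_params.prm_lb b (max 1 x))"
    unfolding lattice_params.prm_lb_def[OF L] by (intro poly_bounded_intros wgt)
  have prm: "poly_bounded (\<lambda>x. lattice_params.prm b (max 1 x))"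
    by (rule poly_bounded_mono[OF _ lattice_params.prm(3)[OF L]]) (intro poly_bounded_intros lb)
  have pts: "poly_bounded (\<lambda>x. lattice_params.pts b (max 1 x))"
    by (rule poly_bounded_mono[OF prm lattice_params.pts_le[OF L]])
  have lgb: "poly_bounded (\<lambda>x. lattice_params.lgb b (max 1 x))"
    by (rule poly_bounded_mono[OF prm lattice_params.lgb_le_prm[OF L]])
  show dmn: "poly_bounded (\<lambda>x. lattice_params.dmn b (max 1 x))"
    unfolding lattice_params.dmn_def[OF L] by (intro poly_bounded_intros r chk pts)
  note all = r chk wgt prm pts lgb dmn
  show "poly_bounded (\<lambda>x. lattice_params.width b (max 1 x))"
    unfolding lattice_params.width_def[OF L] by (intro poly_bounded_intros all)
  show "poly_bounded (\<lambda>x. lattice_params.body_steps b (max 1 x))"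
    unfolding lattice_params.body_steps_def[OF L] lattice_params.emit_steps_def[OF L]
    by (intro poly_bounded_intros all)
qed

lemma poly_time_main:
  assumes b: "0 < b"
  shows "poly_time_on_unary (Main b)"
proof -
  let ?c = "\<lambda>x. lattice_params.width b (max 1 x) * prog_weight (Main b) * (lattice_params.body_steps b (max 1 x) + max 1 x + 2)"
  have "poly_bounded ?c" by (intro poly_bounded_intros poly_bounded_max_1 poly_bounded_params[OF b])
  then obtain P where P: "\<And>x. ?c x \<le> poly P x" unfolding poly_bounded_def by blast
  have "halts_within (Main b) (unary x) (poly P x)" for x
  proof -
    interpret lattice_params b "max 1 x" using b by unfold_locales auto
    show ?thesis unfolding halts_within_def using exec_main[of x] P[of x]
      by (fastforce intro: order_trans)
  qed
  then show ?thesis unfolding poly_time_on_unary_def by blast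
qed

lemma (in lattice_params) output_dist_main:
  "output_dist (Main b) (unary r) =
     map_pmf (\<lambda>(P, Ts). encode (basis Ts) (2 * chk) (shift (nat P)) proj)
       (pair_pmf (pmf_of_set {0..<int blk ^ wgt}) hash_pmf)"
proof -
  let ?\<nu> = "pair_pmf (pmf_of_set {0..<int blk ^ wgt}) hash_pmf"
  have "r = max 1 r" using r_pos by simp
  from exec_main[OF this] obtain f where f: "exec (Main b) (initial (unary r)) (map_pmf f ?\<nu>)"
    "\<forall>v \<in> set_pmf ?\<nu>. out (f v) = output (nat (fst v)) (snd v)" by blast
  have "(THE \<mu>. exec (Main b) (initial (unary r)) \<mu>) = map_pmf f ?\<nu>"
    using f(1) exec_unique by blast
  then have "output_dist (Main b) (unary r) = map_pmf (\<lambda>v. out (f v)) ?\<nu>"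
    by (simp add: output_dist_def pmf.map_comp comp_def)
  also have "\<dots> = map_pmf (\<lambda>(P, Ts). encode (basis Ts) (2 * chk) (shift (nat P)) proj) ?\<nu>"
  proof (rule map_pmf_cong[OF refl])
    fix v assume v: "v \<in> set_pmf ?\<nu>"
    then have "snd v \<in> tables"
      using finite_tables tables_ne by (auto simp: hash_pmf_eq)
    then show "out (f v) = (\<lambda>(P, Ts). encode (basis Ts) (2 * chk) (shift (nat P)) proj) v"
      using f(2) v output_eq_encode by (cases v) force
  qed
  finally show ?thesis .
qed

text \<open>The preimage of the event is the whole sample space: shape and minimum distance hold for
  all \<open>P\<close> and \<open>Ts\<close>.\<close>

lemma (in lattice_params) prob_min_dist:
  assumes "1 \<le> p"
  shows "measure_pmf.prob (output_dist (Main b) (unary r))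
     {ys. \<exists>A l x T. ys = encode A l x T \<and> ld_shape r dmn A l x T \<and> ld_min_dist p A l} = 1"
proof -
  let ?E = "{ys. \<exists>A l x T. ys = encode A l x T \<and> ld_shape r dmn A l x T \<and> ld_min_dist p A l}"
  have "encode (basis Ts) (2 * chk) (shift P) proj \<in> ?E" for P Ts
    using ld_shape_basis ld_min_dist_basis[OF assms] by blast
  then have "(\<lambda>(P, Ts). encode (basis Ts) (2 * chk) (shift (nat P)) proj) -` ?E = UNIV" by auto
  then show ?thesis unfolding output_dist_main measure_map_pmf by simp
qed

lemma (in lattice_params) prob_locally_dense:
  assumes p: "1 \<le> p" and \<alpha>: "0 < \<alpha>" "real (b + 4) \<le> \<alpha> powr p * (2 * real b)"
  shows "measure_pmf.prob (output_dist (Main b) (unary r))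
     {ys. \<exists>A l x T. ys = encode A l x T \<and> locally_dense_lattice p \<alpha> r dmn A l x T} \<ge> 2 / 3"
proof -
  let ?E = "{ys. \<exists>A l x T. ys = encode A l x T \<and> locally_dense_lattice p \<alpha> r dmn A l x T}"
  let ?\<nu> = "pair_pmf (pmf_of_set {0..<int blk ^ wgt}) hash_pmf"
  let ?g = "\<lambda>(P, Ts). encode (basis Ts) (2 * chk) (shift (nat P)) proj"
  let ?B = "{(P, Ts). (nat P, Ts) \<in> bad}"
  have "2 / 3 \<le> 1 - measure_pmf.prob ?\<nu> ?B" using prob_hit by simp
  also have "\<dots> = measure_pmf.prob ?\<nu> (- ?B)" using measure_pmf.prob_compl[of ?B ?\<nu>] by (simp add: Compl_eq_Diff_UNIV)
  also have "\<dots> = measure_pmf.prob ?\<nu> (- ?B \<inter> set_pmf ?\<nu>)" by (rule measure_Int_set_pmf[symmetric])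
  also have "\<dots> \<le> measure_pmf.prob ?\<nu> (?g -` ?E)"
  proof (rule measure_pmf.finite_measure_mono)
    show "- ?B \<inter> set_pmf ?\<nu> \<subseteq> ?g -` ?E"
    proof
      fix v assume v: "v \<in> - ?B \<inter> set_pmf ?\<nu>"
      obtain P Ts where PT: "v = (P, Ts)" by (cases v)
      have "{0..<int blk ^ wgt} \<noteq> {}" using blk_pos by simp
      then have "P \<in> {0..<int blk ^ wgt}" and Ts: "Ts \<in> tables"
        using v PT finite_tables tables_ne by (auto simp: hash_pmf_eq)
      then have "nat P < blk ^ wgt" by (simp add: nat_less_iff)
      then have "ld_dense p \<alpha> r (basis Ts) (2 * chk) (shift (nat P)) proj"
        using v PT Ts by (intro not_bad_dense[OF p \<alpha>]) auto
      then have "locally_dense_lattice p \<alpha> r dmn (basis Ts) (2 * chk) (shift (nat P)) proj"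
        using ld_shape_basis ld_min_dist_basis[OF p] by (simp add: locally_dense_lattice_def)
      then show "v \<in> ?g -` ?E" unfolding PT by (simp, blast)
    qed
  qed simp
  finally show ?thesis unfolding output_dist_main measure_map_pmf .
qed

theorem theorem4p4:
  fixes p \<alpha> :: real
  assumes "1 \<le> p" and "\<alpha> > 1 / 2 powr (1 / p)"
  shows "\<exists>(M :: prog) (R :: nat \<Rightarrow> nat).
    poly_time_on_unary M \<and> poly_bounded R \<and>
    (\<exists>r\<^sub>0. \<forall>r \<ge> r\<^sub>0. 0 < r \<longrightarrow>
       measure_pmf.prob (output_dist M (unary r))
         {ys. \<exists>A l x T. ys = encode A l x T \<and> locally_dense_lattice p \<alpha> r (R r) A l x T} \<ge> 2 / 3 \<and>
       measure_pmf.prob (output_dist M (unary r))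
         {ys. \<exists>A l x T. ys = encode A l x T \<and> ld_shape r (R r) A l x T \<and> ld_min_dist p A l} = 1)"
proof -
  have pos: "0 < \<alpha>" using assms(2) by (smt (verit) divide_pos_pos powr_gt_zero)
  have "1 / 2 = (1 / 2 powr (1 / p)) powr p" using assms(1) by (simp add: powr_divide powr_powr)
  also have "\<dots> < \<alpha> powr p" using assms by (intro powr_less_mono2) auto
  finally have \<delta>: "0 < 2 * \<alpha> powr p - 1" by simp
  \<comment> \<open>Density asks for \<open>b + 4 \<le> 2 * b * \<alpha> powr p\<close>, that is,
    \<open>4 \<le> b * (2 * \<alpha> powr p - 1)\<close>, whose factor is positive by the assumption
    on \<alpha>.\<close>
  define b where "b = nat \<lceil>4 / (2 * \<alpha> powr p - 1)\<rceil> + 1"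
  have b: "0 < b" by (simp add: b_def)
  have "4 / (2 * \<alpha> powr p - 1) \<le> real b" unfolding b_def by linarith
  then have "4 \<le> real b * (2 * \<alpha> powr p - 1)" using \<delta> by (simp add: divide_simps)
  then have dense: "real (b + 4) \<le> \<alpha> powr p * (2 * real b)" by (simp add: algebra_simps)
  have "measure_pmf.prob (output_dist (Main b) (unary r))
         {ys. \<exists>A l x T. ys = encode A l x T \<and> locally_dense_lattice p \<alpha> r (lattice_params.dmn b (max 1 r)) A l x T} \<ge> 2 / 3 \<and>
       measure_pmf.prob (output_dist (Main b) (unary r))
         {ys. \<exists>A l x T. ys = encode A l x T \<and> ld_shape r (lattice_params.dmn b (max 1 r)) A l x T \<and> ld_min_dist p A l} = 1"
    if "0 < r" for r
  proof -
    interpret lattice_params b r using b that by unfold_locales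
    have "max 1 r = r" using that by simp
    then show ?thesis using prob_locally_dense[OF assms(1) pos dense] prob_min_dist[OF assms(1)] by simp
  qed
  then show ?thesis using poly_time_main[OF b] poly_bounded_params(1)[OF b]
    by (intro exI[of _ "Main b"] exI[of _ "\<lambda>r. lattice_params.dmn b (max 1 r)"]) auto
qed

end
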